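(* Let $\mu_1, \ldots, \mu_n$ be Borel probability measures on $\mathbb{R}$, each one of type $\mathscr{L}$. Suppose that $(X_1,\dots,X_n)$ is a random vector in $\mathbb{R}^n$ whose law $\rho$ on $\mathbb{R}^n$ is of the form $$\mathrm{d}\rho(x_1,\ldots,x_n) = Z^{-1}\exp\left(\sum_{j=1}^n h_jx_j+\sum_{j,k=1}^n J_{jk}x_jx_k\right)\mathrm{d}\mu_1(x_1)\cdots\mathrm{d}\mu_n(x_n)$$ with $h_j \geq 0$ and $J_{jk} \geq 0$ for all $j,k \leq n$, where $Z$ is the normalising constant. Then for all nonnegative $a_1, \ldots, a_n$, the sum $X = \sum_{j=1}^n a_jX_j$ satisfies $$\|X\|_q \leq \frac{\|G\|_q}{\|G\|_p}\,\|X\|_p$$ for all positive even integers $p \leq q$, where $G$ is a standard Gaussian random variable.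
   Context: A real-valued random variable $X$ is of type $\mathscr{L}$ if (i) there are positive constants $C, C'$ such that $|\mathbb{E}\exp(zX)| \leq C\exp(C'|z|^2)$ for all $z \in \mathbb{C}$, and (ii) the function $z \mapsto \mathbb{E}\exp(zX)$ on $\mathbb{C}$ is even and has only pure imaginary zeros (it may have no zeros at all). A Borel probability measure on $\mathbb{R}$ is of type $\mathscr{L}$ if a random variable with that law is of type $\mathscr{L}$. For a real random variable $Y$, $\|Y\|_p = (\mathbb{E}|Y|^p)^{1/p}$. *)

theory Defs
  imports "HOL-Probability.Probability"
begin

definition laplace :: "'a measure \<Rightarrow> ('a \<Rightarrow> real) \<Rightarrow> complex \<Rightarrow> complex" where
  "laplace M X z = (LINT \<omega>|M. exp (z * complex_of_real (X \<omega>)))"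

(* Integrability is part of the growth bound: without it the Bochner integral would silently be 0. *)
definition type_L_rv :: "'a measure \<Rightarrow> ('a \<Rightarrow> real) \<Rightarrow> bool" where
  "type_L_rv M X \<longleftrightarrow>
     prob_space M \<and> X \<in> borel_measurable M \<and>
     (\<forall>z. integrable M (\<lambda>\<omega>. exp (z * complex_of_real (X \<omega>)))) \<and>
     (\<exists>C>0. \<exists>C'>0. \<forall>z. cmod (laplace M X z) \<le> C * exp (C' * (cmod z)\<^sup>2)) \<and>
     (\<forall>z. laplace M X (- z) = laplace M X z) \<and>
     (\<forall>z. laplace M X z = 0 \<longrightarrow> Re z = 0)"

(* The identity on (\<real>, \<mu>) serves as the random variable with law \<mu>;
   type_L_distr below shows that the choice of the random variable does not matter. *)
definition type_L :: "real measure \<Rightarrow> bool" where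
  "type_L \<mu> \<longleftrightarrow> sets \<mu> = sets borel \<and> type_L_rv \<mu> (\<lambda>x. x)"

lemma type_L_distr:
  assumes "prob_space M" and X [measurable]: "X \<in> borel_measurable M"
  shows "type_L (distr M borel X) \<longleftrightarrow> type_L_rv M X"
proof -
  have *: "laplace (distr M borel X) (\<lambda>x. x) = laplace M X"
    by (rule ext, unfold laplace_def, subst integral_distr) auto
  have **: "integrable (distr M borel X) (\<lambda>x. exp (z * complex_of_real x)) \<longleftrightarrow>
      integrable M (\<lambda>\<omega>. exp (z * complex_of_real (X \<omega>)))" for z
    by (subst integrable_distr_eq) auto
  show ?thesis
    using assms by (simp add: type_L_def type_L_rv_def * ** prob_space.prob_space_distr)
qed

(* (E |Y|^p)^(1/p) with values in [0, \<infinity>]. *)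
definition Lp_norm :: "'a measure \<Rightarrow> real \<Rightarrow> ('a \<Rightarrow> real) \<Rightarrow> ennreal" where
  "Lp_norm M p Y =
     (let I = (\<integral>\<^sup>+ \<omega>. ennreal (\<bar>Y \<omega>\<bar> powr p) \<partial>M)
      in if I = \<infinity> then \<infinity> else ennreal (enn2real I powr (1 / p)))"

lemma Lp_norm_integrable:
  assumes "integrable M (\<lambda>\<omega>. \<bar>Y \<omega>\<bar> powr p)"
  shows "Lp_norm M p Y = ennreal ((LINT \<omega>|M. \<bar>Y \<omega>\<bar> powr p) powr (1 / p))"
  using assms by (simp add: Lp_norm_def nn_integral_eq_integral integral_nonneg_AE)

definition gibbs_weight ::
    "nat \<Rightarrow> (nat \<Rightarrow> real) \<Rightarrow> (nat \<Rightarrow> nat \<Rightarrow> real) \<Rightarrow> (nat \<Rightarrow> real) \<Rightarrow> real" where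
  "gibbs_weight n h J x =
     exp ((\<Sum>j=1..n. h j * x j) + (\<Sum>j=1..n. \<Sum>k=1..n. J j k * x j * x k))"

definition gibbs_Z ::
    "nat \<Rightarrow> (nat \<Rightarrow> real measure) \<Rightarrow> (nat \<Rightarrow> real) \<Rightarrow> (nat \<Rightarrow> nat \<Rightarrow> real) \<Rightarrow> ennreal" where
  "gibbs_Z n \<mu> h J = (\<integral>\<^sup>+ x. ennreal (gibbs_weight n h J x) \<partial>(PiM {1..n} \<mu>))"

end

theory Submission
  imports Defs
    "HOL-Complex_Analysis.Complex_Analysis"
    "HOL-Computational_Algebra.Fundamental_Theorem_Algebra"
    "HOL-Real_Asymp.Real_Asymp"
begin

text \<open>
  Let \<open>b k\<close> be the quotient of the \<open>2k\<close>-th moments of \<open>X\<close> and \<open>G\<close>. The theorem says that the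
  \<open>k\<close>-th root of \<open>b k\<close> does not increase with \<open>k\<close>, and this holds as soon as \<open>b\<close> is log-concave, because
  \<open>b 0 = 1\<close>. As the \<open>2k\<close>-th moment of \<open>G\<close> is \<open>(2k)! / (2^k k!)\<close>, the number \<open>b k\<close> is \<open>2^k k!\<close> times
  the coefficient of \<open>s^k\<close> in the even part of \<open>E exp(z X)\<close>, read as a series in \<open>s = z\<^sup>2\<close>. A series that
  is a product of factors \<open>1 + c s\<close> with \<open>c \<ge> 0\<close> has the required log-concavity, so everything
  rests on a theorem of Lee-Yang type: the even part of \<open>E exp(z X)\<close> vanishes only at imaginary \<open>z\<close>.

  If the Laplace transforms of the laws \<open>\<mu>\<^sub>j\<close> were polynomials with imaginary zeros, each would be
  a product of factors \<open>1 + \<beta> z\<close> with imaginary \<open>\<beta>\<close>. Such a factor is the generating function of a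
  formal spin with first moment \<open>\<beta>\<close> and vanishing higher moments. For spins whose squares
  vanish, the exponential of a quadratic form is a sum over matchings of the spins, and the
  partition function is, up to a constant, the matching polynomial in the variables
  \<open>1/\<beta> + h\<^sub>j + z a\<^sub>j\<close>. Its zeros are controlled by the argument of Heilmann and Lieb
  (\<open>matching_recursion_nonzero\<close>): it does not vanish if all variables have positive real part.
  The field \<open>h\<close> destroys the symmetry of \<open>X\<close>, but only even moments matter, and a Hermite-Biehler
  argument (\<open>even_part_stable_zeros\<close>) transfers the zero-free half-plane to the even part.

  The Laplace transform of a general law of type \<open>\<L>\<close> is \<open>F(z\<^sup>2)\<close> with \<open>F\<close> entire of exponential type and
  with negative zeros. A weak form of Hadamard's factorization, obtained by dividing out the zeros
  in a large disc and applying the Borel-Caratheodory inequality to the logarithm of the quotient,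
  yields products of factors \<open>1 + c s\<close> whose coefficients converge to those of \<open>F\<close> from below
  (\<open>lin_prod_approximation\<close>). Convergence from below is what makes the limit harmless: since \<open>h\<close>,
  \<open>J\<close>, \<open>a\<close> are nonnegative, a Gibbs moment of even order is a series with nonnegative coefficients in
  the moments of the \<open>\<mu>\<^sub>j\<close> (\<open>nn_integral_gibbs_moment\<close>), so the approximating quantities are bounded
  by the true ones and converge term by term. The expansion is an identity in \<open>[0, \<infinity>]\<close>; this covers
  couplings so strong that \<open>Z\<close> is finite while some moments of \<open>X\<close> are infinite.
\<close>

section \<open>Products of linear factors and log-concavity\<close>

definition lin_prod :: "'a::comm_ring_1 list \<Rightarrow> 'a poly" where
  "lin_prod cs = (\<Prod>c\<leftarrow>cs. [:1, c:])"

lemma lin_prod_Nil [simp]: "lin_prod [] = 1"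
  and lin_prod_Cons: "lin_prod (c # cs) = [:1, c:] * lin_prod cs"
  and lin_prod_append: "lin_prod (cs @ ds) = lin_prod cs * lin_prod ds"
  by (simp_all add: lin_prod_def)

lemma poly_lin_prod_Cons [simp]: "poly (lin_prod (c # cs)) x = (1 + c * x) * poly (lin_prod cs) x"
  by (simp add: lin_prod_def algebra_simps)

lemma coeff_linear_mult:
  fixes c :: "'a::comm_ring_1"
  shows "coeff ([:1, c:] * p) k = coeff p k + (if k = 0 then 0 else c * coeff p (k - 1))"
  by (cases k) (simp_all add: mult_pCons_left)

lemma coeff_lin_prod_0: "coeff (lin_prod cs) 0 = 1"
  by (induction cs) (simp_all only: lin_prod_Cons lin_prod_Nil coeff_linear_mult, simp_all)

lemma coeff_lin_prod_nonneg:
  fixes cs :: "real list"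
  assumes "\<And>c. c \<in> set cs \<Longrightarrow> 0 \<le> c"
  shows "0 \<le> coeff (lin_prod cs) k"
  using assms
proof (induction cs arbitrary: k)
  case (Cons c cs)
  then show ?case by (simp only: lin_prod_Cons coeff_linear_mult) simp
qed simp

lemma coeff_lin_prod_of_real:
  "coeff (lin_prod (map of_real cs)) k = (of_real (coeff (lin_prod cs) k) :: complex)"
proof (induction cs arbitrary: k)
  case (Cons c cs)
  then show ?case by (simp only: list.map lin_prod_Cons coeff_linear_mult) simp
qed simp


text \<open>
  Stated for pairs of indices \<open>i \<le> j\<close> rather than for \<open>i = j\<close> alone: for sequences with zeros this is
  the stronger property, and it is the one preserved below.
\<close>

definition log_concave :: "(nat \<Rightarrow> real) \<Rightarrow> bool" where
  "log_concave b \<longleftrightarrow> (\<forall>k. 0 \<le> b k) \<and> (\<forall>i j. i \<le> j \<longrightarrow> b i * b (j + 2) \<le> b (i + 1) * b (j + 1))"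

text \<open>
  Multiplying the series with coefficients \<open>b k / k!\<close> by \<open>1 + c s\<close> turns \<open>b k\<close> into \<open>b k + k c b (k - 1)\<close>.
  The difference of the two sides of the new inequality is a quadratic polynomial in \<open>c\<close>, and each
  of its three coefficients is nonnegative by log-concavity of \<open>b\<close>.
\<close>

lemma log_concave_linear_mult:
  assumes c: "0 \<le> c" and lc: "log_concave b"
  shows "log_concave (\<lambda>k. b k + real k * c * b (k - 1))"
proof -
  have b: "0 \<le> b k" for k using lc by (simp add: log_concave_def)
  have step: "b i * b (j + 2) \<le> b (i + 1) * b (j + 1)" if "i \<le> j" for i j
    using lc that by (simp add: log_concave_def)
  show ?thesis
    unfolding log_concave_def
  proof (intro conjI allI impI)
    fix k show "0 \<le> b k + real k * c * b (k - 1)" using b c by simp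
  next
    fix i j :: nat assume ij: "i \<le> j"
    \<comment> \<open>The coefficients of \<open>1\<close>, \<open>c\<close> and \<open>c\<^sup>2\<close>.\<close>
    define T0 where "T0 = b (i+1) * b (j+1) - b i * b (j+2)"
    define T1 where "T1 = (real j + 1) * (b (i+1) * b j - b i * b (j+1))
      + real i * (b i * b (j+1) - b (i-1) * b (j+2))"
    define T2 where "T2 = (real i + 1) * (real j + 1) * (b i * b j) - real i * (real j + 2) * (b (i-1) * b (j+1))"
    have "0 \<le> T0" using step[OF ij] by (simp add: T0_def)
    moreover have "0 \<le> T1"
    proof -
      have "b i * b (j+1) \<le> b (i+1) * b j"
      proof (cases "i = j")
        case False
        with ij step[of i "j - 1"] show ?thesis by simp
      qed simp
      moreover have "real i * (b (i-1) * b (j+2)) \<le> real i * (b i * b (j+1))"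
        using step[of "i - 1" j] ij by (cases i) (simp_all add: mult_left_mono)
      ultimately show ?thesis
        unfolding T1_def right_diff_distrib[of "real i"] by (intro add_nonneg_nonneg mult_nonneg_nonneg) simp_all
    qed
    moreover have "0 \<le> T2"
    proof -
      have "real i * (real j + 2) * (b (i-1) * b (j+1)) \<le> (real i + 1) * (real j + 1) * (b i * b j)"
      proof (cases i)
        case (Suc i')
        show ?thesis
        proof (rule mult_mono)
          show "real i * (real j + 2) \<le> (real i + 1) * (real j + 1)"
            using ij by (simp add: algebra_simps)
          show "b (i-1) * b (j+1) \<le> b i * b j"
            using step[of "i - 1" "j - 1"] ij Suc by simp
        qed (use b in simp_all)
      qed (use b in simp)
      then show ?thesis by (simp add: T2_def)
    qed
    ultimately have "0 \<le> T0 + c * T1 + c\<^sup>2 * T2" using c by simp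
    also have "\<dots> = (b (i+1) + real (i+1) * c * b (i+1-1)) * (b (j+1) + real (j+1) * c * b (j+1-1))
      - (b i + real i * c * b (i-1)) * (b (j+2) + real (j+2) * c * b (j+2-1))"
      by (simp add: T0_def T1_def T2_def algebra_simps power2_eq_square)
    finally show "(b i + real i * c * b (i-1)) * (b (j+2) + real (j+2) * c * b (j+2-1))
      \<le> (b (i+1) + real (i+1) * c * b (i+1-1)) * (b (j+1) + real (j+1) * c * b (j+1-1))"
      by linarith
  qed
qed

lemma log_concave_lin_prod:
  assumes "\<And>c. c \<in> set cs \<Longrightarrow> 0 \<le> c"
  shows "log_concave (\<lambda>k. fact k * coeff (lin_prod cs) k)"
  using assms
proof (induction cs)
  case Nil
  show ?case by (auto simp: log_concave_def)
next
  case (Cons c cs)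
  have "(\<lambda>k. fact k * coeff (lin_prod (c # cs)) k)
      = (\<lambda>k. fact k * coeff (lin_prod cs) k + real k * c * (fact (k-1) * coeff (lin_prod cs) (k-1)))"
    by (rule ext, unfold lin_prod_Cons coeff_linear_mult) (auto simp: fact_reduce algebra_simps)
  with Cons log_concave_linear_mult[of c] show ?case by simp
qed

text \<open>
  The case \<open>l = k + 1\<close> follows by induction from \<open>b (k - 1) b (k + 1) \<le> b k ^ 2\<close> and \<open>b 0 = 1\<close>;
  it is then iterated.
\<close>

lemma log_concave_root_decreasing:
  assumes lc: "log_concave b" and b0: "b 0 = 1" and kl: "k \<le> l" and k: "0 < k"
  shows "b l ^ k \<le> b k ^ l"
proof -
  have b: "0 \<le> b k" for k using lc by (simp add: log_concave_def)
  have step: "b i * b (j + 2) \<le> b (i + 1) * b (j + 1)" if "i \<le> j" for i j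
    using lc that by (simp add: log_concave_def)
  have succ: "b (Suc m) ^ m \<le> b m ^ Suc m" for m
  proof (induction m)
    case (Suc m)
    show ?case
    proof (cases "b (Suc m) = 0")
      case True
      with step[of 0 m] b[of "Suc (Suc m)"] b0 show ?thesis by simp
    next
      case False
      with b[of "Suc m"] have pos: "0 < b (Suc m) ^ m" by simp
      have "b (Suc (Suc m)) ^ Suc m * b (Suc m) ^ m \<le> b (Suc (Suc m)) ^ Suc m * b m ^ Suc m"
        using Suc.IH b by (intro mult_left_mono) simp_all
      also have "\<dots> = (b m * b (m + 2)) ^ Suc m"
        by (simp add: power_mult_distrib mult_ac)
      also have "\<dots> \<le> (b (m + 1) * b (m + 1)) ^ Suc m"
        using step[of m m] b by (intro power_mono) simp_all
      also have "\<dots> = b (Suc m) ^ Suc (Suc m) * b (Suc m) ^ m"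
        by (simp add: power_mult_distrib)
      finally show ?thesis using pos by (simp only: mult_le_cancel_right_pos)
    qed
  qed (simp add: b0)
  show ?thesis
    using kl
  proof (induction l rule: dec_induct)
    case (step l)
    have "(b (Suc l) ^ k) ^ l = (b (Suc l) ^ l) ^ k" by (simp flip: power_mult add: mult.commute)
    also have "\<dots> \<le> (b l ^ Suc l) ^ k" using succ b by (intro power_mono) simp_all
    also have "\<dots> = (b l ^ k) ^ Suc l" by (simp flip: power_mult power_Suc add: mult.commute)
    also have "\<dots> \<le> (b k ^ l) ^ Suc l" using step b by (intro power_mono) simp_all
    also have "\<dots> = (b k ^ Suc l) ^ l" by (simp flip: power_mult power_Suc add: mult.commute)
    finally show ?case
      using k step b power_mono_iff[of "b (Suc l) ^ k" "b k ^ Suc l" l] by simp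
  qed simp
qed

section \<open>Zeros of weighted matching polynomials\<close>

text \<open>
  The recursion is the one satisfied by the weighted matching polynomial, the sum over all matchings
  of \<open>S\<close> of the product of the \<open>w\<close> of the edges and the \<open>y\<close> of the unmatched vertices, expanded
  according to the partner of the vertex \<open>e\<close>. Following Heilmann and Lieb, one shows inductively that the ratios
  \<open>q S / q (S - {e})\<close> have positive real part: the recursion expresses such a ratio as \<open>y e\<close> plus a
  nonnegative combination of reciprocals of ratios for smaller sets.
\<close>

lemma matching_recursion_nonzero:
  fixes q :: "'e set \<Rightarrow> complex" and y :: "'e \<Rightarrow> complex" and w :: "'e \<Rightarrow> 'e \<Rightarrow> real"
  assumes empty: "q {} \<noteq> 0"
    and rec: "\<And>S e. S \<subseteq> U \<Longrightarrow> e \<in> S \<Longrightarrow>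
      q S = y e * q (S - {e}) + (\<Sum>f\<in>S - {e}. of_real (w e f) * q (S - {e} - {f}))"
    and y: "\<And>e. e \<in> U \<Longrightarrow> 0 < Re (y e)"
    and w: "\<And>e f. e \<in> U \<Longrightarrow> f \<in> U \<Longrightarrow> 0 \<le> w e f"
    and "finite U"
  shows "q U \<noteq> 0"
proof -
  have "S \<subseteq> U \<Longrightarrow> q S \<noteq> 0 \<and> (\<forall>e\<in>S. 0 < Re (q S / q (S - {e})))" if "finite S" for S
    using that
  proof (induction S rule: finite_psubset_induct)
    case (psubset S)
    have ratio: "0 < Re (q S / q (S - {e}))" if e: "e \<in> S" for e
    proof -
      define R where "R f = q (S - {e}) / q (S - {e} - {f})" for f
      have IH: "q (S - {e}) \<noteq> 0" "\<And>f. f \<in> S - {e} \<Longrightarrow> 0 < Re (R f)"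
        using psubset.IH[of "S - {e}"] psubset.prems e by (auto simp: R_def)
      have "q S / q (S - {e}) = y e + (\<Sum>f\<in>S - {e}. of_real (w e f) * inverse (R f))"
        using IH(1) unfolding rec[OF psubset.prems e] R_def
        by (simp add: add_divide_distrib sum_divide_distrib)
      moreover have "0 \<le> Re (\<Sum>f\<in>S - {e}. of_real (w e f) * inverse (R f))"
      proof -
        have "0 \<le> Re (of_real (w e f) * inverse (R f))" if "f \<in> S - {e}" for f
          using IH(2)[OF that] w[of e f] psubset.prems e that
          by (auto intro!: divide_nonneg_nonneg mult_nonneg_nonneg)
        then show ?thesis by (simp only: Re_sum sum_nonneg)
      qed
      moreover have "0 < Re (y e)" using y psubset.prems e by auto
      ultimately show ?thesis by simp
    qed
    show ?case
    proof (cases "S = {}")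
      case False
      then obtain e where "e \<in> S" by blast
      with ratio[of e] have "q S \<noteq> 0" by auto
      with ratio show ?thesis by blast
    qed (use empty in simp)
  qed
  with \<open>finite U\<close> show ?thesis by blast
qed

section \<open>Calculus of moment functionals\<close>

text \<open>
  A law on \<open>\<real>^n\<close>, or a formal substitute for one, is represented by the functional \<open>\<Lambda>\<close> that maps a
  multi-index \<open>\<alpha>\<close> to the moment of the monomial with exponents \<open>\<alpha>\<close>. Operations on test functions
  become operations on \<open>\<Lambda>\<close>: multiplication by the coordinate \<open>x\<^sub>j\<close> is the shift \<open>\<alpha> \<mapsto> inc j \<alpha>\<close>.
\<close>

definition inc :: "nat \<Rightarrow> (nat \<Rightarrow> nat) \<Rightarrow> nat \<Rightarrow> nat" where
  "inc j \<alpha> = \<alpha>(j := Suc (\<alpha> j))"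

definition dec :: "nat \<Rightarrow> (nat \<Rightarrow> nat) \<Rightarrow> nat \<Rightarrow> nat" where
  "dec j \<alpha> = \<alpha>(j := \<alpha> j - 1)"

text \<open>
  The functional \<open>f \<mapsto> \<Lambda> (w f)\<close> where \<open>w\<close> is the energy \<open>\<Sum> h\<^sub>j x\<^sub>j + \<Sum> J\<^sub>j\<^sub>k x\<^sub>j x\<^sub>k\<close>. The coefficients
  range over a ring so that \<open>h\<^sub>j\<close> may be replaced by a polynomial \<open>h\<^sub>j + a\<^sub>j z\<close>.
\<close>

definition energy_op ::
    "nat \<Rightarrow> (nat \<Rightarrow> 'v) \<Rightarrow> (nat \<Rightarrow> nat \<Rightarrow> 'v) \<Rightarrow> ((nat \<Rightarrow> nat) \<Rightarrow> 'v) \<Rightarrow> (nat \<Rightarrow> nat) \<Rightarrow> 'v::comm_ring_1" where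
  "energy_op n h J \<Lambda> \<alpha> =
     (\<Sum>j=1..n. h j * \<Lambda> (inc j \<alpha>)) + (\<Sum>j=1..n. \<Sum>k=1..n. J j k * \<Lambda> (inc j (inc k \<alpha>)))"

text \<open>
  The functional \<open>f \<mapsto> \<Lambda> (\<partial>f / \<partial>x\<^sub>j)\<close>.
\<close>

definition deriv_op :: "nat \<Rightarrow> ((nat \<Rightarrow> nat) \<Rightarrow> 'v) \<Rightarrow> (nat \<Rightarrow> nat) \<Rightarrow> 'v::comm_ring_1" where
  "deriv_op j \<Lambda> \<alpha> = of_nat (\<alpha> j) * \<Lambda> (dec j \<alpha>)"

text \<open>
  The functional \<open>f \<mapsto> \<Lambda> (f \<partial>w / \<partial>x\<^sub>j)\<close>.
\<close>

definition force_op ::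
    "nat \<Rightarrow> (nat \<Rightarrow> 'v) \<Rightarrow> (nat \<Rightarrow> nat \<Rightarrow> 'v) \<Rightarrow> nat \<Rightarrow> ((nat \<Rightarrow> nat) \<Rightarrow> 'v) \<Rightarrow> (nat \<Rightarrow> nat) \<Rightarrow> 'v::comm_ring_1" where
  "force_op n h J j \<Lambda> \<alpha> = h j * \<Lambda> \<alpha> + (\<Sum>k=1..n. (J j k + J k j) * \<Lambda> (inc k \<alpha>))"

lemma inc_commute: "inc j (inc k \<alpha>) = inc k (inc j \<alpha>)"
  by (cases "j = k") (auto simp: inc_def fun_upd_twist)

lemma deriv_op_inc:
  "deriv_op j \<Lambda> (inc i \<alpha>) = deriv_op j (\<lambda>\<alpha>. \<Lambda> (inc i \<alpha>)) \<alpha> + (if i = j then \<Lambda> \<alpha> else 0)"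
proof (cases "i = j")
  case True
  have "dec j (inc j \<alpha>) = \<alpha>" by (simp add: dec_def inc_def)
  moreover have "inc j (dec j \<alpha>) = \<alpha>" if "0 < \<alpha> j" using that by (simp add: dec_def inc_def)
  ultimately show ?thesis using True
    by (cases "\<alpha> j = 0") (simp_all add: deriv_op_def inc_def algebra_simps)
next
  case False
  then have "dec j (inc i \<alpha>) = inc i (dec j \<alpha>)" "inc i \<alpha> j = \<alpha> j"
    by (simp_all add: dec_def inc_def fun_upd_twist)
  with False show ?thesis by (simp add: deriv_op_def)
qed

text \<open>
  The product rule for \<open>\<partial>(w f) / \<partial>x\<^sub>j\<close>.
\<close>

lemma energy_op_deriv_op:
  assumes j: "j \<in> {1..n}"
  shows "energy_op n h J (deriv_op j \<Lambda>) \<alpha> = deriv_op j (energy_op n h J \<Lambda>) \<alpha> + force_op n h J j \<Lambda> \<alpha>"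
proof -
  have 1: "(\<Sum>i=1..n. h i * deriv_op j \<Lambda> (inc i \<alpha>))
      = (\<Sum>i=1..n. h i * deriv_op j (\<lambda>\<alpha>. \<Lambda> (inc i \<alpha>)) \<alpha>) + h j * \<Lambda> \<alpha>"
    using j unfolding deriv_op_inc by (simp add: distrib_left sum.distrib if_distrib[of "\<lambda>x. _ * x"] sum.delta cong: if_cong)
  have 2: "(\<Sum>i=1..n. \<Sum>k=1..n. J i k * deriv_op j \<Lambda> (inc i (inc k \<alpha>)))
      = (\<Sum>i=1..n. \<Sum>k=1..n. J i k * deriv_op j (\<lambda>\<alpha>. \<Lambda> (inc i (inc k \<alpha>))) \<alpha>)
        + (\<Sum>k=1..n. J j k * \<Lambda> (inc k \<alpha>)) + (\<Sum>i=1..n. J i j * \<Lambda> (inc i \<alpha>))"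
  proof -
    have "J i k * deriv_op j \<Lambda> (inc i (inc k \<alpha>)) = J i k * deriv_op j (\<lambda>\<alpha>. \<Lambda> (inc i (inc k \<alpha>))) \<alpha>
        + (if i = j then J i k * \<Lambda> (inc k \<alpha>) else 0) + (if k = j then J i k * \<Lambda> (inc i \<alpha>) else 0)" for i k
      unfolding deriv_op_inc by (simp add: distrib_left)
    moreover have "(\<Sum>i=1..n. \<Sum>k=1..n. if i = j then J i k * \<Lambda> (inc k \<alpha>) else 0) = (\<Sum>k=1..n. J j k * \<Lambda> (inc k \<alpha>))"
      using j by (subst sum.swap) (simp add: sum.delta)
    moreover have "(\<Sum>i=1..n. \<Sum>k=1..n. if k = j then J i k * \<Lambda> (inc i \<alpha>) else 0) = (\<Sum>i=1..n. J i j * \<Lambda> (inc i \<alpha>))"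
      using j by (simp add: sum.delta)
    ultimately show ?thesis by (simp add: sum.distrib)
  qed
  show ?thesis
    unfolding energy_op_def[of n h J "deriv_op j \<Lambda>"] 1 2
    by (simp add: deriv_op_def energy_op_def force_op_def sum_distrib_left sum.distrib algebra_simps)
qed

lemma energy_op_add:
  "energy_op n h J (\<lambda>\<alpha>. \<Lambda> \<alpha> + \<Lambda>' \<alpha>) \<alpha> = energy_op n h J \<Lambda> \<alpha> + energy_op n h J \<Lambda>' \<alpha>"
  by (simp add: energy_op_def sum.distrib algebra_simps)

lemma energy_op_sum:
  "energy_op n h J (\<lambda>\<alpha>. \<Sum>f\<in>A. c f * \<Lambda> f \<alpha>) \<alpha> = (\<Sum>f\<in>A. c f * energy_op n h J (\<Lambda> f) \<alpha>)"
proof -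
  have swap: "(\<Sum>j=1..n. g j * (\<Sum>f\<in>A. c f * X f j)) = (\<Sum>f\<in>A. c f * (\<Sum>j=1..n. g j * X f j))" for g X
    unfolding sum_distrib_left by (subst sum.swap) (simp add: mult_ac)
  show ?thesis
    unfolding energy_op_def swap
    using swap[of "\<lambda>_. 1" "\<lambda>f j. \<Sum>k=1..n. J j k * \<Lambda> f (inc j (inc k \<alpha>))"]
    by (simp add: sum.distrib distrib_left)
qed

lemma energy_pow_add:
  "(energy_op n h J ^^ r) (\<lambda>\<alpha>. \<Lambda> \<alpha> + \<Lambda>' \<alpha>) \<alpha> = (energy_op n h J ^^ r) \<Lambda> \<alpha> + (energy_op n h J ^^ r) \<Lambda>' \<alpha>"
proof (induction r arbitrary: \<Lambda> \<Lambda>')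
  case (Suc r)
  then show ?case by (simp add: funpow_Suc_right energy_op_add[abs_def] del: funpow.simps)
qed simp

lemma energy_pow_sum:
  "(energy_op n h J ^^ r) (\<lambda>\<alpha>. \<Sum>f\<in>A. c f * \<Lambda> f \<alpha>) \<alpha> = (\<Sum>f\<in>A. c f * (energy_op n h J ^^ r) (\<Lambda> f) \<alpha>)"
proof (induction r arbitrary: \<Lambda>)
  case (Suc r)
  then show ?case by (simp add: funpow_Suc_right energy_op_sum[abs_def] del: funpow.simps)
qed simp

lemma force_op_energy_op:
  "force_op n h J j (energy_op n h J \<Lambda>) \<alpha> = energy_op n h J (force_op n h J j \<Lambda>) \<alpha>"
proof -
  have "energy_op n h J (force_op n h J j \<Lambda>) \<alpha> =
      energy_op n h J (\<lambda>\<alpha>. (\<Sum>f\<in>{j}. h f * \<Lambda> \<alpha>) + (\<Sum>k=1..n. (J j k + J k j) * \<Lambda> (inc k \<alpha>))) \<alpha>"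
    by (simp add: force_op_def[abs_def])
  also have "\<dots> = h j * energy_op n h J \<Lambda> \<alpha> + (\<Sum>k=1..n. (J j k + J k j) * energy_op n h J (\<lambda>\<alpha>. \<Lambda> (inc k \<alpha>)) \<alpha>)"
    unfolding energy_op_add energy_op_sum by simp
  also have "\<dots> = force_op n h J j (energy_op n h J \<Lambda>) \<alpha>"
  proof -
    have "energy_op n h J (\<lambda>\<alpha>. \<Lambda> (inc k \<alpha>)) \<alpha> = energy_op n h J \<Lambda> (inc k \<alpha>)" for k
      unfolding energy_op_def inc_commute[of k] by simp
    then show ?thesis by (simp add: force_op_def)
  qed
  finally show ?thesis by simp
qed

text \<open>
  The product rule for \<open>\<partial>(w^r f) / \<partial>x\<^sub>j\<close>; the force commutes with \<open>w\<close> because both act by multiplication.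
\<close>

lemma energy_pow_deriv_op:
  assumes j: "j \<in> {1..n}"
  shows "(energy_op n h J ^^ r) (deriv_op j \<Lambda>) \<alpha> = deriv_op j ((energy_op n h J ^^ r) \<Lambda>) \<alpha>
    + of_nat r * (energy_op n h J ^^ (r - 1)) (force_op n h J j \<Lambda>) \<alpha>"
proof (induction r arbitrary: \<Lambda>)
  case (Suc r)
  have "(energy_op n h J ^^ Suc r) (deriv_op j \<Lambda>) \<alpha>
      = (energy_op n h J ^^ r) (deriv_op j (energy_op n h J \<Lambda>)) \<alpha> + (energy_op n h J ^^ r) (force_op n h J j \<Lambda>) \<alpha>"
    by (simp only: funpow_Suc_right o_apply energy_op_deriv_op[OF j, abs_def] energy_pow_add)
  also have "\<dots> = deriv_op j ((energy_op n h J ^^ Suc r) \<Lambda>) \<alpha>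
      + of_nat r * (energy_op n h J ^^ (r - 1)) (energy_op n h J (force_op n h J j \<Lambda>)) \<alpha>
      + (energy_op n h J ^^ r) (force_op n h J j \<Lambda>) \<alpha>"
    unfolding Suc.IH force_op_energy_op[abs_def] by (simp add: funpow_Suc_right del: funpow.simps)
  also have "of_nat r * (energy_op n h J ^^ (r - 1)) (energy_op n h J (force_op n h J j \<Lambda>)) \<alpha>
      = of_nat r * (energy_op n h J ^^ r) (force_op n h J j \<Lambda>) \<alpha>"
    by (cases r) (simp_all add: funpow_Suc_right del: funpow.simps)
  finally show ?case by (simp add: algebra_simps)
qed simp

text \<open>
  The moments of a sum of independent formal spins \<open>x\<^sub>e\<close>, \<open>e \<in> S\<close>, with first moment \<open>\<beta> e\<close> and
  \<open>x\<^sub>e\<^sup>2 = 0\<close>, whose moment generating function is \<open>\<Prod> (1 + \<beta> e z)\<close>.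
\<close>

definition spin_moment :: "('e \<Rightarrow> 'v) \<Rightarrow> 'e set \<Rightarrow> nat \<Rightarrow> 'v::comm_ring_1" where
  "spin_moment \<beta> S k = of_nat (fact k) * coeff (\<Prod>e\<in>S. [:1, \<beta> e:]) k"

text \<open>
  Adding a spin \<open>x\<^sub>e\<close> to the sum \<open>x\<close> uses \<open>(x + x\<^sub>e)^k = x^k + k x\<^sub>e x^(k - 1)\<close>, valid as \<open>x\<^sub>e\<^sup>2 = 0\<close>.
\<close>

lemma spin_moment_insert:
  assumes "finite S" "e \<notin> S"
  shows "spin_moment \<beta> (insert e S) k = spin_moment \<beta> S k + \<beta> e * of_nat k * spin_moment \<beta> S (k - 1)"
proof -
  have eq: "(\<Prod>e\<in>insert e S. [:1, \<beta> e:]) = [:1, \<beta> e:] * (\<Prod>e\<in>S. [:1, \<beta> e:])"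
    using assms by (rule prod.insert)
  show ?thesis
    unfolding spin_moment_def eq coeff_linear_mult
    by (cases k) (simp_all add: algebra_simps)
qed

text \<open>
  One factor of \<open>(\<Sum> x\<^sub>f)^(k + 1)\<close> selects a spin \<open>f\<close>, which cannot occur in the remaining factors.
\<close>

lemma spin_moment_Suc:
  assumes "finite S"
  shows "spin_moment \<beta> S (Suc k) = (\<Sum>f\<in>S. \<beta> f * spin_moment \<beta> (S - {f}) k)"
  using assms
proof (induction S arbitrary: k)
  case empty
  show ?case by (simp add: spin_moment_def)
next
  case (insert e S)
  have "(\<Sum>f\<in>S. \<beta> f * spin_moment \<beta> (insert e S - {f}) k)
      = (\<Sum>f\<in>S. \<beta> f * (spin_moment \<beta> (S - {f}) k + \<beta> e * of_nat k * spin_moment \<beta> (S - {f}) (k - 1)))"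
  proof (rule sum.cong[OF refl])
    fix f assume "f \<in> S"
    then have "insert e S - {f} = insert e (S - {f})" "e \<notin> S - {f}" using insert.hyps by auto
    with insert.hyps show "\<beta> f * spin_moment \<beta> (insert e S - {f}) k
        = \<beta> f * (spin_moment \<beta> (S - {f}) k + \<beta> e * of_nat k * spin_moment \<beta> (S - {f}) (k - 1))"
      by (simp add: spin_moment_insert)
  qed
  also have "\<dots> = spin_moment \<beta> S (Suc k) + \<beta> e * (of_nat k * (\<Sum>f\<in>S. \<beta> f * spin_moment \<beta> (S - {f}) (k - 1)))"
    by (simp add: insert.IH sum.distrib distrib_left sum_distrib_left mult_ac)
  also have "of_nat k * (\<Sum>f\<in>S. \<beta> f * spin_moment \<beta> (S - {f}) (k - 1)) = of_nat k * spin_moment \<beta> S k"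
    using insert.IH[of "k - 1"] by (cases k) simp_all
  finally have "(\<Sum>f\<in>insert e S. \<beta> f * spin_moment \<beta> (insert e S - {f}) k)
      = \<beta> e * spin_moment \<beta> S k + (spin_moment \<beta> S (Suc k) + \<beta> e * (of_nat k * spin_moment \<beta> S k))"
    using insert.hyps by (simp add: mult.assoc)
  then show ?case
    using spin_moment_insert[OF insert.hyps, of \<beta> "Suc k"] by (simp add: algebra_simps)
qed

lemma spin_moment_eq_0: "finite S \<Longrightarrow> card S < k \<Longrightarrow> spin_moment \<beta> S k = 0"
proof (induction S arbitrary: k rule: finite_induct)
  case (insert e S)
  then show ?case by (simp add: spin_moment_insert)
qed (simp add: spin_moment_def)


text \<open>
  The joint moments if the coordinate at site \<open>j\<close> is the sum of the formal spins that live there.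
\<close>

definition spin_functional :: "nat \<Rightarrow> ('e \<Rightarrow> nat) \<Rightarrow> ('e \<Rightarrow> 'v) \<Rightarrow> 'e set \<Rightarrow> (nat \<Rightarrow> nat) \<Rightarrow> 'v::comm_ring_1" where
  "spin_functional n site \<beta> S \<alpha> = (\<Prod>j=1..n. spin_moment \<beta> {e \<in> S. site e = j} (\<alpha> j))"

lemma spin_functional_insert:
  assumes S: "finite S" "e \<notin> S" and j: "site e \<in> {1..n}"
  shows "spin_functional n site \<beta> (insert e S) \<alpha>
    = spin_functional n site \<beta> S \<alpha> + \<beta> e * deriv_op (site e) (spin_functional n site \<beta> S) \<alpha>"
proof -
  let ?j = "site e" and ?I = "{1..n} - {site e}" and ?S = "\<lambda>j. {e \<in> S. site e = j}"
  have 1: "{f \<in> insert e S. site f = ?j} = insert e (?S ?j)" "e \<notin> ?S ?j" using S by auto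
  have 2: "(\<Prod>i\<in>?I. spin_moment \<beta> {f \<in> insert e S. site f = i} (\<alpha> i)) = (\<Prod>i\<in>?I. spin_moment \<beta> (?S i) (\<alpha> i))"
  proof (rule prod.cong[OF refl])
    fix i assume "i \<in> ?I"
    then have "{f \<in> insert e S. site f = i} = ?S i" by auto
    then show "spin_moment \<beta> {f \<in> insert e S. site f = i} (\<alpha> i) = spin_moment \<beta> (?S i) (\<alpha> i)" by simp
  qed
  have 3: "(\<Prod>i\<in>?I. spin_moment \<beta> (?S i) (dec ?j \<alpha> i)) = (\<Prod>i\<in>?I. spin_moment \<beta> (?S i) (\<alpha> i))"
    by (intro prod.cong) (auto simp: dec_def)
  have split: "spin_functional n site \<beta> T \<alpha>'
      = spin_moment \<beta> {f \<in> T. site f = ?j} (\<alpha>' ?j) * (\<Prod>i\<in>?I. spin_moment \<beta> {f \<in> T. site f = i} (\<alpha>' i))" for T \<alpha>'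
    unfolding spin_functional_def using j by (intro prod.remove) simp_all
  show ?thesis
    unfolding deriv_op_def split 1(1) 2 3 using S 1(2)
    by (simp add: spin_moment_insert dec_def algebra_simps)
qed

lemma spin_functional_inc:
  assumes S: "finite S" and k: "k \<in> {1..n}"
  shows "spin_functional n site \<beta> S (inc k \<alpha>)
    = (\<Sum>f\<in>{f \<in> S. site f = k}. \<beta> f * spin_functional n site \<beta> (S - {f}) \<alpha>)"
proof -
  let ?I = "{1..n} - {k}" and ?S = "\<lambda>j. {e \<in> S. site e = j}"
  have split: "spin_functional n site \<beta> T \<alpha>'
      = spin_moment \<beta> {f \<in> T. site f = k} (\<alpha>' k) * (\<Prod>i\<in>?I. spin_moment \<beta> {f \<in> T. site f = i} (\<alpha>' i))" for T \<alpha>'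
    unfolding spin_functional_def using k by (intro prod.remove) simp_all
  have 1: "(\<Prod>i\<in>?I. spin_moment \<beta> (?S i) (inc k \<alpha> i)) = (\<Prod>i\<in>?I. spin_moment \<beta> (?S i) (\<alpha> i))"
    by (intro prod.cong) (auto simp: inc_def)
  have 2: "spin_functional n site \<beta> (S - {f}) \<alpha>
      = spin_moment \<beta> (?S k - {f}) (\<alpha> k) * (\<Prod>i\<in>?I. spin_moment \<beta> (?S i) (\<alpha> i))" if f: "f \<in> ?S k" for f
  proof -
    have "{g \<in> S - {f}. site g = k} = ?S k - {f}" by auto
    moreover have "(\<Prod>i\<in>?I. spin_moment \<beta> {g \<in> S - {f}. site g = i} (\<alpha> i)) = (\<Prod>i\<in>?I. spin_moment \<beta> (?S i) (\<alpha> i))"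
    proof (rule prod.cong[OF refl])
      fix i assume "i \<in> ?I"
      then have "{g \<in> S - {f}. site g = i} = ?S i" using f by auto
      then show "spin_moment \<beta> {g \<in> S - {f}. site g = i} (\<alpha> i) = spin_moment \<beta> (?S i) (\<alpha> i)" by simp
    qed
    ultimately show ?thesis unfolding split[of "S - {f}"] by simp
  qed
  have "inc k \<alpha> k = Suc (\<alpha> k)" by (simp add: inc_def)
  then show ?thesis
    unfolding split[of S] 1 using S by (simp add: spin_moment_Suc sum_distrib_right 2 mult.assoc)
qed

text \<open>
  Products of more than \<open>card S\<close> nilpotent spins vanish, so all exponential series below are finite sums.
\<close>

definition vanishes_from :: "nat \<Rightarrow> nat \<Rightarrow> ((nat \<Rightarrow> nat) \<Rightarrow> 'v::comm_ring_1) \<Rightarrow> bool" where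
  "vanishes_from n m \<Lambda> \<longleftrightarrow> (\<forall>\<alpha>. m \<le> (\<Sum>j=1..n. \<alpha> j) \<longrightarrow> \<Lambda> \<alpha> = 0)"

lemma sum_inc: "j \<in> {1..n} \<Longrightarrow> (\<Sum>i=1..n. inc j \<alpha> i) = Suc (\<Sum>i=1..n. \<alpha> i)"
  unfolding inc_def by (subst (1 2) sum.remove[of _ j]) simp_all

lemma vanishes_from_energy_op:
  assumes "vanishes_from n m \<Lambda>" shows "vanishes_from n (m - 1) (energy_op n h J \<Lambda>)"
proof -
  have \<Lambda>: "\<Lambda> \<alpha> = 0" if "m \<le> (\<Sum>j=1..n. \<alpha> j)" for \<alpha>
    using assms that by (simp add: vanishes_from_def)
  have "\<Lambda> (inc j \<alpha>) = 0" "\<Lambda> (inc j (inc k \<alpha>)) = 0"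
    if "m - 1 \<le> (\<Sum>j=1..n. \<alpha> j)" "j \<in> {1..n}" "k \<in> {1..n}" for \<alpha> j k
    using that by (auto intro!: \<Lambda> simp only: sum_inc)
  then show ?thesis unfolding vanishes_from_def energy_op_def by simp
qed

lemma vanishes_from_energy_pow:
  assumes "vanishes_from n m \<Lambda>" shows "vanishes_from n (m - r) ((energy_op n h J ^^ r) \<Lambda>)"
proof (induction r)
  case (Suc r)
  from vanishes_from_energy_op[OF this, of h J] show ?case by simp
qed (use assms in simp)

lemma energy_pow_eq_0:
  assumes "vanishes_from n m \<Lambda>" "m \<le> r" shows "(energy_op n h J ^^ r) \<Lambda> \<alpha> = 0"
  using vanishes_from_energy_pow[OF assms(1), of r h J] assms(2) by (simp add: vanishes_from_def)

lemma vanishes_from_spin_functional: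
  assumes S: "finite S" shows "vanishes_from n (Suc (card S)) (spin_functional n site \<beta> S)"
  unfolding vanishes_from_def
proof (intro allI impI)
  fix \<alpha> :: "nat \<Rightarrow> nat" assume \<alpha>: "Suc (card S) \<le> (\<Sum>j=1..n. \<alpha> j)"
  have "\<exists>j\<in>{1..n}. card {e \<in> S. site e = j} < \<alpha> j"
  proof (rule ccontr)
    assume "\<not> ?thesis"
    then have "(\<Sum>j=1..n. \<alpha> j) \<le> (\<Sum>j=1..n. card {e \<in> S. site e = j})"
      by (intro sum_mono) (simp add: not_less)
    also have "\<dots> = card (\<Union>j\<in>{1..n}. {e \<in> S. site e = j})"
      using S by (intro card_UN_disjoint[symmetric]) auto
    also have "\<dots> \<le> card S" using S by (intro card_mono) auto
    finally show False using \<alpha> by simp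
  qed
  then obtain j where j: "j \<in> {1..n}" "card {e \<in> S. site e = j} < \<alpha> j" by blast
  then have "spin_moment \<beta> {e \<in> S. site e = j} (\<alpha> j) = 0"
    using S by (intro spin_moment_eq_0) simp_all
  then show "spin_functional n site \<beta> S \<alpha> = 0"
    unfolding spin_functional_def using j by (intro prod_zero) auto
qed

section \<open>The partition function of nilpotent spins\<close>

text \<open>
  The formal expectation of \<open>exp w\<close>, truncated. It is the full exponential series if \<open>\<Lambda>\<close> kills all
  monomials of degree at least \<open>K\<close>, because \<open>w\<close> has no constant term.
\<close>

definition gibbs_sum ::
    "nat \<Rightarrow> nat \<Rightarrow> (nat \<Rightarrow> complex) \<Rightarrow> (nat \<Rightarrow> nat \<Rightarrow> complex) \<Rightarrow> ((nat \<Rightarrow> nat) \<Rightarrow> complex) \<Rightarrow> complex" where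
  "gibbs_sum K n h J \<Lambda> = (\<Sum>r<K. (energy_op n h J ^^ r) \<Lambda> (\<lambda>_. 0) / fact r)"

text \<open>
  A new spin at site \<open>j\<close> replaces \<open>f\<close> by \<open>f + \<beta> e \<partial>f / \<partial>x\<^sub>j\<close>, and the derivative of \<open>exp w\<close> is
  \<open>(\<partial>w / \<partial>x\<^sub>j) exp w\<close>. A coordinate \<open>x\<^sub>k\<close> in the force then picks one of the spins at site \<open>k\<close> and
  removes it from \<open>S\<close>. This is the recursion of a matching polynomial.
\<close>

lemma gibbs_sum_spin_insert:
  assumes S: "finite S" "e \<notin> S" and site: "\<And>f. f \<in> insert e S \<Longrightarrow> site f \<in> {1..n}" and K: "Suc (card S) < K"
  shows "gibbs_sum K n h J (spin_functional n site \<beta> (insert e S))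
    = gibbs_sum K n h J (spin_functional n site \<beta> S)
      + \<beta> e * (h (site e) * gibbs_sum K n h J (spin_functional n site \<beta> S)
        + (\<Sum>f\<in>S. (J (site e) (site f) + J (site f) (site e)) * \<beta> f * gibbs_sum K n h J (spin_functional n site \<beta> (S - {f}))))"
proof -
  let ?j = "site e" and ?E = "energy_op n h J" and ?s = "spin_functional n site \<beta>" and ?o = "\<lambda>_::nat. 0::nat"
  have j: "?j \<in> {1..n}" using site by simp
  have force: "force_op n h J ?j (?s S) \<alpha>
      = (\<Sum>f\<in>{e}. h ?j * ?s S \<alpha>) + (\<Sum>f\<in>S. (J ?j (site f) + J (site f) ?j) * \<beta> f * ?s (S - {f}) \<alpha>)" for \<alpha>
  proof -
    have "(\<Sum>k=1..n. (J ?j k + J k ?j) * ?s S (inc k \<alpha>))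
        = (\<Sum>k=1..n. \<Sum>f\<in>{f \<in> S. site f = k}. (J ?j (site f) + J (site f) ?j) * \<beta> f * ?s (S - {f}) \<alpha>)"
      using S(1) by (intro sum.cong refl) (auto simp: spin_functional_inc sum_distrib_left mult.assoc)
    also have "\<dots> = (\<Sum>f\<in>S. (J ?j (site f) + J (site f) ?j) * \<beta> f * ?s (S - {f}) \<alpha>)"
      using S(1) site by (intro sum.group) auto
    finally show ?thesis by (simp add: force_op_def)
  qed
  have force_pow: "(?E ^^ r) (force_op n h J ?j (?s S)) ?o = h ?j * (?E ^^ r) (?s S) ?o
      + (\<Sum>f\<in>S. (J ?j (site f) + J (site f) ?j) * \<beta> f * (?E ^^ r) (?s (S - {f})) ?o)" for r
    unfolding force[abs_def] energy_pow_add energy_pow_sum by simp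
  \<comment> \<open>Differentiating the exponential series loses its last term, which is zero by nilpotency.\<close>
  have trunc: "(\<Sum>r<K - 1. (?E ^^ r) (?s T) ?o / fact r) = gibbs_sum K n h J (?s T)" if "T \<subseteq> S" for T
  proof -
    have "card T \<le> card S" using that S by (intro card_mono)
    then have "(?E ^^ (K - 1)) (?s T) ?o = 0"
      using K that S finite_subset by (intro energy_pow_eq_0[OF vanishes_from_spin_functional]) auto
    moreover have "K = Suc (K - 1)" using K by simp
    ultimately show ?thesis unfolding gibbs_sum_def by (metis (no_types, lifting) add.right_neutral div_0 sum.lessThan_Suc)
  qed
  have expand: "(?E ^^ r) (?s (insert e S)) ?o
      = (?E ^^ r) (?s S) ?o + \<beta> e * (of_nat r * (?E ^^ (r - 1)) (force_op n h J ?j (?s S)) ?o)" for r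
  proof -
    have eq: "?s (insert e S) = (\<lambda>\<alpha>. ?s S \<alpha> + (\<Sum>f\<in>{e}. \<beta> f * deriv_op ?j (?s S) \<alpha>))"
      using spin_functional_insert[of S e site n \<beta>, OF S j] by (auto simp: fun_eq_iff)
    show ?thesis
      unfolding eq energy_pow_add energy_pow_sum energy_pow_deriv_op[OF j] by (simp add: deriv_op_def)
  qed
  have "gibbs_sum K n h J (?s (insert e S)) = gibbs_sum K n h J (?s S)
      + \<beta> e * (\<Sum>r<K. of_nat r * (?E ^^ (r - 1)) (force_op n h J ?j (?s S)) ?o / fact r)"
    unfolding gibbs_sum_def expand by (simp add: add_divide_distrib sum.distrib sum_distrib_left)
  also have "(\<Sum>r<K. of_nat r * (?E ^^ (r - 1)) (force_op n h J ?j (?s S)) ?o / fact r)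
      = (\<Sum>r<K - 1. (?E ^^ r) (force_op n h J ?j (?s S)) ?o / fact r)"
  proof -
    have "(\<Sum>r<Suc m. of_nat r * g (r - 1) / fact r) = (\<Sum>r<m. g r / fact r)" for m and g :: "nat \<Rightarrow> complex"
    proof -
      have "of_nat (Suc r) * g r / fact (Suc r) = g r / fact r" for r
        by (simp add: fact_Suc del: of_nat_Suc)
      then show ?thesis unfolding sum.lessThan_Suc_shift by (simp del: of_nat_Suc fact_Suc)
    qed
    from this[where m = "K - 1"] show ?thesis using K by simp
  qed
  also have "\<dots> = h ?j * (\<Sum>r<K - 1. (?E ^^ r) (?s S) ?o / fact r)
      + (\<Sum>f\<in>S. (J ?j (site f) + J (site f) ?j) * \<beta> f * (\<Sum>r<K - 1. (?E ^^ r) (?s (S - {f})) ?o / fact r))"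
    unfolding force_pow by (simp add: add_divide_distrib sum.distrib sum_distrib_left sum_divide_distrib sum.swap[of _ S])
  also have "\<dots> = h ?j * gibbs_sum K n h J (?s S)
      + (\<Sum>f\<in>S. (J ?j (site f) + J (site f) ?j) * \<beta> f * gibbs_sum K n h J (?s (S - {f})))"
    by (simp only: trunc[OF subset_refl] trunc[OF Diff_subset])
  finally show ?thesis .
qed

text \<open>
  After division by the product of all \<open>\<beta> e\<close>, the recursion becomes the one for the matching
  polynomial with vertex variables \<open>1 / \<beta> e + h\<close> and nonnegative edge weights.
\<close>

lemma gibbs_sum_spin_nonzero:
  assumes U: "finite U" "card U < K"
    and site: "\<And>e. e \<in> U \<Longrightarrow> site e \<in> {1..n}" and \<beta>: "\<And>e. e \<in> U \<Longrightarrow> \<beta> e \<noteq> 0"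
    and field: "\<And>e. e \<in> U \<Longrightarrow> 0 < Re (1 / \<beta> e + h (site e))"
    and J: "\<And>j k. j \<in> {1..n} \<Longrightarrow> k \<in> {1..n} \<Longrightarrow> 0 \<le> J j k"
  shows "gibbs_sum K n h (\<lambda>j k. of_real (J j k)) (spin_functional n site \<beta> U) \<noteq> 0"
proof -
  define V where "V S = gibbs_sum K n h (\<lambda>j k. of_real (J j k)) (spin_functional n site \<beta> S)" for S
  define q where "q S = V S / (\<Prod>e\<in>S. \<beta> e)" for S
  have "q U \<noteq> 0"
  proof (rule matching_recursion_nonzero[where U = U and y = "\<lambda>e. 1 / \<beta> e + h (site e)"
        and w = "\<lambda>e f. J (site e) (site f) + J (site f) (site e)"])
    have "V {} = 1"
    proof -
      have "(energy_op n h (\<lambda>j k. of_real (J j k)) ^^ r) (spin_functional n site \<beta> {}) (\<lambda>_. 0) = (if r = 0 then 1 else 0)" for r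
      proof (cases "r = 0")
        case True
        then show ?thesis by (simp add: spin_functional_def spin_moment_def)
      next
        case False
        then show ?thesis
          by (simp add: energy_pow_eq_0[OF vanishes_from_spin_functional[OF finite.emptyI]])
      qed
      then show ?thesis
        using U(2) by (simp add: V_def gibbs_sum_def if_distrib[of "\<lambda>x. x / _"] sum.delta cong: if_cong)
    qed
    then show "q {} \<noteq> 0" by (simp add: q_def)
  next
    fix S e assume S: "S \<subseteq> U" "e \<in> S"
    let ?T = "S - {e}"
    have fin: "finite S" using S U finite_subset by blast
    have ins: "insert e ?T = S" using S by blast
    have "card S \<le> card U" using S U by (intro card_mono)
    moreover have "Suc (card ?T) = card S" using fin S by (intro card_Suc_Diff1)
    ultimately have K: "Suc (card ?T) < K" using U by simp
    let ?P = "\<Prod>e\<in>?T. \<beta> e"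
      and ?w = "\<lambda>f. complex_of_real (J (site e) (site f) + J (site f) (site e))"
    have nz: "\<beta> e \<noteq> 0" "?P \<noteq> 0" using \<beta> S fin by (auto simp: subset_iff)
    have cancel: "\<beta> f * V (?T - {f}) / ?P = q (?T - {f})" if "f \<in> ?T" for f
    proof -
      have "?P = \<beta> f * (\<Prod>e\<in>?T - {f}. \<beta> e)" using fin that by (intro prod.remove) auto
      moreover have "\<beta> f \<noteq> 0" using \<beta> S that by blast
      ultimately show ?thesis by (simp add: q_def)
    qed
    define X where "X = (\<Sum>f\<in>?T. ?w f * \<beta> f * V (?T - {f}))"
    have "V S = V ?T + \<beta> e * (h (site e) * V ?T + X)"
      using gibbs_sum_spin_insert[of ?T e site n K h "\<lambda>j k. of_real (J j k)" \<beta>] fin site S K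
      unfolding V_def ins X_def by auto
    moreover have "(\<Prod>e\<in>S. \<beta> e) = \<beta> e * ?P" using fin S by (intro prod.remove)
    ultimately have "q S = V ?T / (\<beta> e * ?P) + \<beta> e * (h (site e) * V ?T + X) / (\<beta> e * ?P)"
      unfolding q_def[of S] by (simp only: add_divide_distrib)
    also have "\<dots> = (1 / \<beta> e) * (V ?T / ?P) + (h (site e) * (V ?T / ?P) + X / ?P)"
      using nz(1) by (simp add: add_divide_distrib)
    also have "X / ?P = (\<Sum>f\<in>?T. ?w f * q (?T - {f}))"
      unfolding X_def sum_divide_distrib
    proof (rule sum.cong[OF refl])
      fix f assume "f \<in> ?T"
      from cancel[OF this, symmetric] show "?w f * \<beta> f * V (?T - {f}) / ?P = ?w f * q (?T - {f})" by simp
    qed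
    finally show "q S = (1 / \<beta> e + h (site e)) * q ?T + (\<Sum>f\<in>?T. ?w f * q (?T - {f}))"
      by (simp only: q_def[of ?T] distrib_right add.assoc)
  qed (use field J site U in simp_all)
  then show ?thesis by (auto simp: q_def V_def)
qed

text \<open>
  A ring homomorphism may be applied to all coefficients; it is used for the evaluation of
  polynomials at a point.
\<close>

lemma energy_op_hom:
  assumes "\<And>x y. \<phi> (x + y) = \<phi> x + \<phi> y" "\<And>x y. \<phi> (x * y) = \<phi> x * \<phi> y" "\<phi> 0 = 0"
  shows "\<phi> ((energy_op n h J ^^ r) \<Lambda> \<alpha>) = (energy_op n (\<lambda>j. \<phi> (h j)) (\<lambda>j k. \<phi> (J j k)) ^^ r) (\<lambda>\<alpha>. \<phi> (\<Lambda> \<alpha>)) \<alpha>"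
proof (induction r arbitrary: \<Lambda>)
  case (Suc r)
  have sum: "\<phi> (\<Sum>i\<in>A. g i) = (\<Sum>i\<in>A. \<phi> (g i))" for g and A :: "nat set"
    by (induction A rule: infinite_finite_induct) (simp_all add: assms)
  show ?case
    unfolding funpow_Suc_right o_apply Suc.IH
    by (simp add: energy_op_def[abs_def] assms sum)
qed simp

section \<open>Even parts of stable polynomials\<close>

definition even_part :: "'a::comm_ring_1 poly \<Rightarrow> 'a poly" where
  "even_part B = Abs_poly (\<lambda>k. coeff B (2 * k))"

lemma coeff_even_part [simp]: "coeff (even_part B) k = coeff B (2 * k)"
proof -
  have "coeff B (2 * k) = 0" if "degree B < k" for k
    using that by (intro coeff_eq_0) simp
  then show ?thesis
    unfolding even_part_def by (subst coeff_Abs_poly[where n = "degree B"]) auto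
qed

lemma poly_eq_sum_lessThan:
  fixes x :: "'a::comm_ring_1"
  assumes "degree p < m" shows "poly p x = (\<Sum>i<m. coeff p i * x ^ i)"
  unfolding poly_altdef using assms
  by (intro sum.mono_neutral_left) (auto simp: coeff_eq_0)

lemma poly_even_part_square:
  fixes B :: "complex poly"
  shows "poly (even_part B) (z\<^sup>2) = (poly B z + poly B (- z)) / 2"
proof -
  have "(\<Sum>k<m. coeff B (2 * k) * (z\<^sup>2) ^ k) = ((\<Sum>i<2 * m. coeff B i * z ^ i) + (\<Sum>i<2 * m. coeff B i * (- z) ^ i)) / 2" for m
  proof (induction m)
    case (Suc m)
    then show ?case by (simp add: power_mult)
  qed simp
  moreover have "poly (even_part B) (z\<^sup>2) = (\<Sum>k<Suc (degree B). coeff (even_part B) k * (z\<^sup>2) ^ k)"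
  proof (rule poly_eq_sum_lessThan)
    show "degree (even_part B) < Suc (degree B)"
      by (rule le_imp_less_Suc, rule degree_le) (simp add: coeff_eq_0)
  qed
  moreover have "poly B w = (\<Sum>i<2 * Suc (degree B). coeff B i * w ^ i)" for w
    by (rule poly_eq_sum_lessThan) simp
  ultimately show ?thesis by (simp only: coeff_even_part)
qed

text \<open>
  The point \<open>- cnj z\<close> is the mirror image of \<open>z\<close> in the imaginary axis; a root in the left half-plane is
  closer to the mirror image than to \<open>z\<close>.
\<close>

lemma norm_stable_product_reflect:
  assumes z: "0 < Re z" and A: "\<And>x. x \<in># A \<Longrightarrow> Re x < 0" "A \<noteq> {#}"
  shows "norm (poly (\<Prod>x\<in>#A. [:- x, 1:]) (- cnj z)) < norm (poly (\<Prod>x\<in>#A. [:- x, 1:]) z)"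
proof -
  have factor: "norm (- cnj z - x) < norm (z - x)" if "Re x < 0" for x
  proof -
    have "(norm (z - x))\<^sup>2 - (norm (- cnj z - x))\<^sup>2 = - 4 * Re z * Re x"
      unfolding cmod_power2 by (simp add: power2_eq_square algebra_simps)
    also have "\<dots> > 0" using z that by (simp add: mult_pos_neg)
    finally show ?thesis by (simp add: power2_less_imp_less)
  qed
  have "A = {#} \<or> norm (poly (\<Prod>x\<in>#A. [:- x, 1:]) (- cnj z)) < norm (poly (\<Prod>x\<in>#A. [:- x, 1:]) z)"
    using A(1)
  proof (induction A)
    case (add x A)
    let ?p = "\<Prod>x\<in>#A. [:- x, 1:]"
    have IH: "norm (poly ?p (- cnj z)) \<le> norm (poly ?p z)" "0 < norm (poly ?p z)"
    proof -
      have "A = {#} \<or> norm (poly ?p (- cnj z)) < norm (poly ?p z)"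
        using add.prems by (intro add.IH) simp
      then have "A = {#} \<or> norm (poly ?p (- cnj z)) < norm (poly ?p z) \<and> 0 < norm (poly ?p z)"
        using le_less_trans[OF norm_ge_zero] by blast
      then show "norm (poly ?p (- cnj z)) \<le> norm (poly ?p z)" "0 < norm (poly ?p z)" by auto
    qed
    have "norm (- cnj z - x) * norm (poly ?p (- cnj z)) \<le> norm (- cnj z - x) * norm (poly ?p z)"
      using IH by (intro mult_left_mono) auto
    also have "\<dots> < norm (z - x) * norm (poly ?p z)"
      using factor[of x] add.prems IH(2) by (intro mult_strict_right_mono) simp_all
    finally have "norm (- cnj z - x) * norm (poly ?p (- cnj z)) < norm (z - x) * norm (poly ?p z)" .
    moreover have "poly (\<Prod>y\<in>#add_mset x A. [:- y, 1:]) w = (w - x) * poly ?p w" for w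
      by (simp add: algebra_simps)
    ultimately show ?case by (simp only: norm_mult) blast
  qed simp
  with A(2) show ?thesis by blast
qed

lemma cnj_poly_of_real: "cnj (poly (map_poly of_real p) z) = poly (map_poly of_real p) (cnj z)"
  by (induction p) (simp_all add: map_poly_pCons)

text \<open>
  If the even part vanishes at \<open>z\<^sup>2\<close> then \<open>B z\<close> and \<open>B (- z)\<close> have equal modulus. For \<open>Re z > 0\<close> this is
  impossible, since \<open>\<bar>B (- z)\<bar> = \<bar>B (- cnj z)\<bar>\<close> for real \<open>B\<close> and all roots of \<open>B\<close> lie in the open
  left half-plane. Hence \<open>z\<close> is imaginary.
\<close>

lemma even_part_stable_zeros:
  fixes B :: "real poly"
  assumes stable: "\<And>z. 0 \<le> Re z \<Longrightarrow> poly (map_poly of_real B) z \<noteq> (0::complex)"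
    and zero: "poly (map_poly of_real (even_part B)) s = (0::complex)"
  shows "\<exists>c>0. s = - of_real (1 / c)"
proof -
  let ?B = "map_poly complex_of_real B"
  define z where "z = csqrt s"
  have s: "s = z\<^sup>2" by (simp add: z_def)
  have "map_poly of_real (even_part B) = even_part ?B" by (simp add: poly_eq_iff coeff_map_poly)
  then have sum0: "poly ?B z + poly ?B (- z) = 0"
    using zero by (simp add: s poly_even_part_square)
  have "0 \<le> Re z" unfolding z_def by (rule Re_csqrt)
  have "\<not> 0 < Re z"
  proof
    assume z: "0 < Re z"
    have "?B \<noteq> 0"
    proof
      assume "?B = 0"
      then show False using stable[of 0] by simp
    qed
    from alg_closed_imp_factorization[OF this] obtain A
      where A: "?B = smult (lead_coeff ?B) (\<Prod>x\<in>#A. [:- x, 1:])" by blast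
    define p where "p = (\<Prod>x\<in>#A. [:- x, 1:])"
    have B: "poly ?B w = lead_coeff ?B * poly p w" for w
      by (subst A) (simp add: p_def)
    have "poly p x = 0" if "x \<in># A" for x
      using that unfolding p_def by (induction A) auto
    then have roots: "Re x < 0" if "x \<in># A" for x
      using stable[of x] B[of x] that by (cases "0 \<le> Re x") simp_all
    have "norm (poly ?B (- z)) = norm (poly ?B z)"
    proof -
      have "poly ?B (- z) = - poly ?B z" using sum0 by (rule eq_neg_iff_add_eq_0[THEN iffD2, OF trans[OF add.commute]])
      then show ?thesis by simp
    qed
    moreover have "norm (poly ?B (- z)) = norm (poly ?B (- cnj z))"
      using arg_cong[OF cnj_poly_of_real[of B "- z"], of norm] by simp
    ultimately have "norm (poly p (- cnj z)) = norm (poly p z)"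
      using \<open>?B \<noteq> 0\<close> by (simp add: B norm_mult)
    then have "A = {#}"
      using norm_stable_product_reflect[of z A, OF z roots] by (cases "A = {#}") (simp_all add: p_def)
    then have "poly ?B z = poly ?B (- z)" by (simp add: B p_def)
    with sum0 stable[of z] z show False by simp
  qed
  with \<open>0 \<le> Re z\<close> have "Re z = 0" by simp
  moreover have "Im z \<noteq> 0"
  proof
    assume "Im z = 0"
    with \<open>Re z = 0\<close> have "z = 0" by (simp add: complex_eq_iff)
    with sum0 stable[of 0] show False by simp
  qed
  ultimately have "0 < 1 / (Im z)\<^sup>2" by simp
  moreover have "s = - of_real (1 / (1 / (Im z)\<^sup>2))"
    using \<open>Re z = 0\<close> by (simp add: s complex_eq_iff power2_eq_square)
  ultimately show ?thesis by blast
qed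

lemma lin_prod_of_negative_zeros:
  fixes E :: "real poly"
  assumes E: "E \<noteq> 0" and zeros: "\<And>s. poly (map_poly of_real E) s = (0::complex) \<Longrightarrow> \<exists>c>0. s = - of_real (1 / c)"
  obtains cs where "\<And>c. c \<in> set cs \<Longrightarrow> 0 < c" "\<And>k. coeff E k = coeff E 0 * coeff (lin_prod cs) k"
proof -
  let ?E = "map_poly complex_of_real E"
  have "?E \<noteq> 0" using E by (simp add: poly_eq_iff coeff_map_poly)
  from alg_closed_imp_factorization[OF this] obtain A
    where A: "?E = smult (lead_coeff ?E) (\<Prod>x\<in>#A. [:- x, 1:])" by blast
  define p where "p = (\<Prod>x\<in>#A. [:- x, 1:])"
  have E_eq: "poly ?E w = lead_coeff ?E * poly p w" for w
    by (subst A) (simp add: p_def)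
  have "poly p x = 0" if "x \<in># A" for x
    using that unfolding p_def by (induction A) auto
  then have roots: "\<exists>c>0. x = - of_real (1 / c)" if "x \<in># A" for x
    using zeros[of x] E_eq[of x] that by simp
  then have "\<exists>K cs. p = smult K (lin_prod (map of_real cs)) \<and> (\<forall>c\<in>set cs. 0 < c)"
    unfolding p_def
  proof (induction A)
    case empty
    show ?case by (intro exI[of _ 1] exI[of _ "[]"]) simp
  next
    case (add x A)
    obtain K cs where IH: "(\<Prod>x\<in>#A. [:- x, 1:]) = smult K (lin_prod (map of_real cs))" "\<forall>c\<in>set cs. 0 < c"
      using add.IH add.prems by auto
    obtain c where c: "0 < c" "x = - of_real (1 / c)" using add.prems[of x] by auto
    have "[:- x, 1:] = smult (of_real (1 / c)) [:1, of_real c:]" using c by simp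
    then have "(\<Prod>x\<in>#add_mset x A. [:- x, 1:]) = smult (of_real (1 / c) * K) (lin_prod (map of_real (c # cs)))"
      by (simp only: image_mset_add_mset prod_mset.add_mset IH list.map lin_prod_Cons
          mult_smult_left mult_smult_right smult_smult mult.commute)
    moreover have "\<forall>c\<in>set (c # cs). 0 < c" using IH c by simp
    ultimately show ?case by blast
  qed
  then obtain K' cs where K': "p = smult K' (lin_prod (map of_real cs))" and cs: "\<forall>c\<in>set cs. 0 < c" by blast
  define K where "K = lead_coeff ?E * K'"
  have K: "?E = smult K (lin_prod (map of_real cs))"
    by (subst A) (simp add: p_def[symmetric] K' K_def)
  have coeff: "of_real (coeff E k) = K * of_real (coeff (lin_prod cs) k)" for k
    using arg_cong[OF K, of "\<lambda>p. coeff p k"] by (simp add: coeff_map_poly coeff_lin_prod_of_real)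
  have "K = of_real (coeff E 0)" using coeff[of 0] by (simp add: coeff_lin_prod_0)
  have "coeff E k = coeff E 0 * coeff (lin_prod cs) k" for k
  proof -
    have "complex_of_real (coeff E k) = of_real (coeff E 0 * coeff (lin_prod cs) k)"
      by (simp only: coeff[of k] \<open>K = of_real (coeff E 0)\<close> of_real_mult)
    then show ?thesis by (simp only: of_real_eq_iff)
  qed
  with cs show ?thesis using that by blast
qed

section \<open>The moment inequality for polynomial generating functions\<close>

text \<open>
  The \<open>r\<close>-th term of the exponential series for the energy \<open>w + z \<Sum> a\<^sub>j x\<^sub>j\<close>, as a polynomial in \<open>z\<close>.
  Summed over \<open>r\<close>, its coefficient of \<open>z^i\<close> is the moment of \<open>(\<Sum> a\<^sub>j x\<^sub>j)^i / i!\<close> with weight \<open>exp w\<close>.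
\<close>

definition gibbs_poly ::
    "nat \<Rightarrow> nat \<Rightarrow> (nat \<Rightarrow> real) \<Rightarrow> (nat \<Rightarrow> real) \<Rightarrow> (nat \<Rightarrow> nat \<Rightarrow> real) \<Rightarrow> ((nat \<Rightarrow> nat) \<Rightarrow> real) \<Rightarrow> real poly" where
  "gibbs_poly r n a h J m = smult (1 / fact r)
     ((energy_op n (\<lambda>j. [:h j, a j:]) (\<lambda>j k. [:J j k:]) ^^ r) (\<lambda>\<alpha>. [:m \<alpha>:]) (\<lambda>_. 0))"

lemma poly_gibbs_poly:
  "poly (map_poly of_real (\<Sum>r<K. gibbs_poly r n a h J m)) z
    = gibbs_sum K n (\<lambda>j. of_real (h j) + z * of_real (a j)) (\<lambda>j k. of_real (J j k)) (\<lambda>\<alpha>. of_real (m \<alpha>))"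
proof -
  let ?\<phi> = "\<lambda>p. poly (map_poly complex_of_real p) z"
  have add: "?\<phi> (p + q) = ?\<phi> p + ?\<phi> q" for p q 
  proof -
    have "map_poly complex_of_real (p + q) = map_poly of_real p + map_poly of_real q"
      by (simp add: poly_eq_iff coeff_map_poly)
    then show ?thesis by simp
  qed
  have mult: "?\<phi> (p * q) = ?\<phi> p * ?\<phi> q" for p q 
  proof -
    have "map_poly complex_of_real (p * q) = map_poly of_real p * map_poly of_real q"
      by (simp add: poly_eq_iff coeff_map_poly coeff_mult)
    then show ?thesis by simp
  qed
  have "?\<phi> (\<Sum>r<K. gibbs_poly r n a h J m) = (\<Sum>r<K. ?\<phi> (gibbs_poly r n a h J m))"
    by (induction K) (simp_all add: add)
  also have "\<dots> = gibbs_sum K n (\<lambda>j. of_real (h j) + z * of_real (a j)) (\<lambda>j k. of_real (J j k)) (\<lambda>\<alpha>. of_real (m \<alpha>))"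
    unfolding gibbs_sum_def gibbs_poly_def
    by (intro sum.cong refl)
      (simp add: map_poly_smult energy_op_hom[of ?\<phi>, OF add mult] map_poly_pCons)
  finally show ?thesis .
qed

text \<open>
  The moments of the symmetric formal law with moment generating function \<open>\<Prod> (1 + c z\<^sup>2)\<close>.
\<close>

definition formal_moment :: "real list \<Rightarrow> nat \<Rightarrow> real" where
  "formal_moment cs k = (if even k then fact k * coeff (lin_prod cs) (k div 2) else 0)"

lemma coeff_square_lin_prod:
  fixes cs :: "'a::comm_ring_1 list"
  shows "coeff (\<Prod>c\<leftarrow>cs. [:1, 0, c:]) k = (if even k then coeff (lin_prod cs) (k div 2) else 0)"
proof (induction cs arbitrary: k)
  case (Cons c cs)
  have "coeff ([:1, 0, c:] * p) k = coeff p k + (if k < 2 then 0 else c * coeff p (k - 2))" for p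
    by (cases k; cases "k - 1") (auto simp: mult_pCons_left algebra_simps)
  moreover have "(k - 2) div 2 = k div 2 - 1" "even (k - 2) = even k" "k div 2 \<noteq> 0" if "2 \<le> k"
    using that by presburger+
  ultimately show ?case
    by (simp only: list.map prod_list.Cons lin_prod_Cons coeff_linear_mult Cons) (cases "k < 2"; simp; presburger)
qed (auto intro: odd_pos)

text \<open>
  Each factor \<open>1 + c z\<^sup>2\<close> is contributed by a pair of formal spins with first moments \<open>\<plusminus>\<i> sqrt c\<close>.
\<close>

lemma spin_moment_pairs:
  assumes "\<And>c. c \<in> set cs \<Longrightarrow> 0 \<le> c"
  shows "spin_moment (\<lambda>(j, i, b). (if b then 1 else - 1) * \<i> * of_real (sqrt (cs ! i))) ({j :: nat} \<times> {..<length cs} \<times> (UNIV :: bool set)) k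
    = of_real (formal_moment cs k)"
proof -
  let ?\<beta> = "\<lambda>(j, i, b). (if b then 1 else - 1) * \<i> * complex_of_real (sqrt (cs ! i))"
  have "(\<Prod>e\<in>{j} \<times> {..<length cs} \<times> (UNIV :: bool set). [:1, ?\<beta> e:])
      = (\<Prod>i<length cs. \<Prod>b\<in>(UNIV :: bool set). [:1, ?\<beta> (j, i, b):])"
  proof -
    have "(\<Prod>e\<in>{j} \<times> B. g e) = (\<Prod>x\<in>B. g (j, x))" for B and g :: "nat \<times> nat \<times> bool \<Rightarrow> complex poly"
    proof -
      have "{j} \<times> B = Pair j ` B" by auto
      then show ?thesis by (simp add: prod.reindex inj_on_def)
    qed
    then show ?thesis by (simp add: prod.cartesian_product split_def)
  qed
  also have "\<dots> = (\<Prod>i<length cs. [:1, 0, of_real (cs ! i):])"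
  proof (rule prod.cong[OF refl])
    fix i assume "i \<in> {..<length cs}"
    then have "0 \<le> cs ! i" using assms by simp
    then have "complex_of_real (sqrt (cs ! i)) * of_real (sqrt (cs ! i)) = of_real (cs ! i)"
      by (simp flip: of_real_mult)
    then show "(\<Prod>b\<in>(UNIV :: bool set). [:1, ?\<beta> (j, i, b):]) = [:1, 0, of_real (cs ! i):]"
      by (simp add: UNIV_bool mult_ac)
  qed
  also have "\<dots> = (\<Prod>c\<leftarrow>map of_real cs. [:1, 0, c:])"
    by (simp add: prod.list_conv_set_nth atLeast0LessThan)
  finally show ?thesis
    unfolding spin_moment_def by (simp add: coeff_square_lin_prod coeff_lin_prod_of_real formal_moment_def del: map_map)
qed


lemma coeff_energy_op:
  "coeff (energy_op n (\<lambda>j. [:h j, a j:]) (\<lambda>j k. [:J j k:]) \<Lambda> \<alpha>) i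
    = (\<Sum>j=1..n. h j * coeff (\<Lambda> (inc j \<alpha>)) i + (if i = 0 then 0 else a j * coeff (\<Lambda> (inc j \<alpha>)) (i - 1)))
      + (\<Sum>j=1..n. \<Sum>k=1..n. J j k * coeff (\<Lambda> (inc j (inc k \<alpha>))) i)"
proof -
  have "coeff ([:b, c:] * p) i = b * coeff p i + (if i = 0 then 0 else c * coeff p (i - 1))" for b c :: 'a and p
    by (cases i) (simp_all add: mult_pCons_left)
  then show ?thesis by (simp add: energy_op_def coeff_sum)
qed

text \<open>
  All operations have nonnegative coefficients, so larger moments give larger Gibbs moments.
\<close>

lemma coeff_energy_pow_mono:
  fixes a h :: "nat \<Rightarrow> real"
  assumes coef: "\<And>j. j \<in> {1..n} \<Longrightarrow> 0 \<le> a j" "\<And>j. j \<in> {1..n} \<Longrightarrow> 0 \<le> h j"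
      "\<And>j k. j \<in> {1..n} \<Longrightarrow> k \<in> {1..n} \<Longrightarrow> 0 \<le> J j k"
    and \<Lambda>: "\<And>\<alpha> i. 0 \<le> coeff (\<Lambda> \<alpha>) i" "\<And>\<alpha> i. coeff (\<Lambda> \<alpha>) i \<le> coeff (\<Lambda>' \<alpha>) i"
  shows "0 \<le> coeff ((energy_op n (\<lambda>j. [:h j, a j:]) (\<lambda>j k. [:J j k:]) ^^ r) \<Lambda> \<alpha>) i \<and>
    coeff ((energy_op n (\<lambda>j. [:h j, a j:]) (\<lambda>j k. [:J j k:]) ^^ r) \<Lambda> \<alpha>) i
      \<le> coeff ((energy_op n (\<lambda>j. [:h j, a j:]) (\<lambda>j k. [:J j k:]) ^^ r) \<Lambda>' \<alpha>) i"
proof (induction r arbitrary: \<alpha> i)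
  case (Suc r)
  show ?case
    unfolding funpow.simps o_apply coeff_energy_op
    using coef Suc
    by (auto intro!: add_nonneg_nonneg sum_nonneg mult_nonneg_nonneg add_mono sum_mono mult_left_mono)
qed (use \<Lambda> in simp)

lemma coeff_energy_pow_tendsto:
  fixes a :: "nat \<Rightarrow> real" and h :: "'b \<Rightarrow> nat \<Rightarrow> real"
  assumes h: "\<And>j. ((\<lambda>N. h N j) \<longlongrightarrow> h' j) F" and \<Lambda>: "\<And>\<alpha> i. ((\<lambda>N. coeff (\<Lambda> N \<alpha>) i) \<longlongrightarrow> coeff (\<Lambda>' \<alpha>) i) F"
  shows "((\<lambda>N. coeff ((energy_op n (\<lambda>j. [:h N j, a j:]) (\<lambda>j k. [:J j k:]) ^^ r) (\<Lambda> N) \<alpha>) i)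
    \<longlongrightarrow> coeff ((energy_op n (\<lambda>j. [:h' j, a j:]) (\<lambda>j k. [:J j k:]) ^^ r) \<Lambda>' \<alpha>) i) F"
proof (induction r arbitrary: \<alpha> i)
  case (Suc r)
  show ?case
    unfolding funpow.simps o_apply coeff_energy_op
    by (cases "i = 0") (auto intro!: tendsto_intros h Suc)
qed (use \<Lambda> in simp)

definition formal_functional :: "nat \<Rightarrow> (nat \<Rightarrow> real list) \<Rightarrow> (nat \<Rightarrow> nat) \<Rightarrow> real" where
  "formal_functional n cs \<alpha> = (\<Prod>j=1..n. formal_moment (cs j) (\<alpha> j))"

lemma formal_functional_nonneg:
  assumes "\<And>j c. j \<in> {1..n} \<Longrightarrow> c \<in> set (cs j) \<Longrightarrow> 0 \<le> c"
  shows "0 \<le> formal_functional n cs \<alpha>"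
  unfolding formal_functional_def formal_moment_def
  using assms by (intro prod_nonneg) (auto intro!: mult_nonneg_nonneg coeff_lin_prod_nonneg)

lemma formal_functional_zero: "formal_functional n cs (\<lambda>_. 0) = 1"
  by (simp add: formal_functional_def formal_moment_def coeff_lin_prod_0)

lemma coeff_gibbs_poly_nonneg:
  assumes "\<And>j. j \<in> {1..n} \<Longrightarrow> 0 \<le> a j" "\<And>j. j \<in> {1..n} \<Longrightarrow> 0 \<le> h j"
      "\<And>j k. j \<in> {1..n} \<Longrightarrow> k \<in> {1..n} \<Longrightarrow> 0 \<le> J j k" "\<And>\<alpha>. 0 \<le> m \<alpha>"
  shows "0 \<le> coeff (gibbs_poly r n a h J m) i"
proof -
  have "0 \<le> coeff [:m \<alpha>:] i" for \<alpha> i using assms(4) by (cases i) simp_all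
  from coeff_energy_pow_mono[OF assms(1-3) this order_refl] show ?thesis by (simp add: gibbs_poly_def)
qed

lemma coeff_gibbs_poly_sum_ge_1:
  assumes "\<And>j. j \<in> {1..n} \<Longrightarrow> 0 \<le> a j" "\<And>j. j \<in> {1..n} \<Longrightarrow> 0 \<le> h j"
      "\<And>j k. j \<in> {1..n} \<Longrightarrow> k \<in> {1..n} \<Longrightarrow> 0 \<le> J j k" "\<And>\<alpha>. 0 \<le> m \<alpha>" and "m (\<lambda>_. 0) = 1" "0 < K"
  shows "1 \<le> coeff (\<Sum>r<K. gibbs_poly r n a h J m) 0"
proof -
  have "coeff (gibbs_poly 0 n a h J m) 0 \<le> (\<Sum>r<K. coeff (gibbs_poly r n a h J m) 0)"
    using coeff_gibbs_poly_nonneg[OF assms(1-4)] \<open>0 < K\<close> by (intro member_le_sum) auto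
  then show ?thesis by (simp add: coeff_sum gibbs_poly_def[of 0] \<open>m (\<lambda>_. 0) = 1\<close>)
qed

text \<open>
  Log-concavity in homogeneous form for polynomial single-spin generating functions. Strict
  positivity of \<open>h\<close> makes the real part of every vertex variable \<open>1 / \<beta> + h\<^sub>j + z a\<^sub>j\<close> positive on the
  closed half-plane \<open>Re z \<ge> 0\<close>, so that the partition function has no zeros even on the imaginary axis;
  it also covers sites with \<open>a\<^sub>j = 0\<close>.
\<close>

lemma gibbs_poly_moment_inequality_pos:
  assumes cs: "\<And>j c. j \<in> {1..n} \<Longrightarrow> c \<in> set (cs j) \<Longrightarrow> 0 < c"
    and a: "\<And>j. j \<in> {1..n} \<Longrightarrow> 0 \<le> a j" and h: "\<And>j. j \<in> {1..n} \<Longrightarrow> 0 < h j"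
    and J: "\<And>j k. j \<in> {1..n} \<Longrightarrow> k \<in> {1..n} \<Longrightarrow> 0 \<le> J j k"
    and K: "2 * (\<Sum>j=1..n. length (cs j)) < K" and kl: "0 < k" "k \<le> l"
  defines "B \<equiv> \<Sum>r<K. gibbs_poly r n a h J (formal_functional n cs)"
  shows "(fact l * coeff B (2 * l)) ^ k * coeff B 0 ^ (l - k) \<le> (fact k * coeff B (2 * k)) ^ l"
proof -
  define \<beta> :: "nat \<times> nat \<times> bool \<Rightarrow> complex"
    where "\<beta> = (\<lambda>(j, i, b). (if b then 1 else - 1) * \<i> * of_real (sqrt (cs j ! i)))"
  define U where "U = Sigma {1..n} (\<lambda>j. {..<length (cs j)} \<times> (UNIV :: bool set))"
  have U: "finite U" "card U = 2 * (\<Sum>j=1..n. length (cs j))"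
    by (simp_all add: U_def card_cartesian_product sum_distrib_left mult.commute)
  have moments: "spin_functional n fst \<beta> U \<alpha> = of_real (formal_functional n cs \<alpha>)" for \<alpha>
  proof -
    have "spin_moment \<beta> {e \<in> U. fst e = j} (\<alpha> j) = of_real (formal_moment (cs j) (\<alpha> j))" if j: "j \<in> {1..n}" for j
    proof -
      have "{e \<in> U. fst e = j} = {j} \<times> {..<length (cs j)} \<times> UNIV" using j by (auto simp: U_def)
      moreover have "spin_moment \<beta> ({j} \<times> {..<length (cs j)} \<times> UNIV) (\<alpha> j)
          = spin_moment (\<lambda>(j', i, b). (if b then 1 else - 1) * \<i> * of_real (sqrt (cs j ! i))) ({j} \<times> {..<length (cs j)} \<times> UNIV) (\<alpha> j)"
        unfolding spin_moment_def \<beta>_def by (intro arg_cong2[of _ _ _ _ "(*)"] refl arg_cong2[of _ _ _ _ coeff] prod.cong) auto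
      ultimately show ?thesis using spin_moment_pairs[of "cs j" j "\<alpha> j"] cs[OF j] by (simp add: less_imp_le)
    qed
    then show ?thesis by (simp add: spin_functional_def formal_functional_def)
  qed
  have stable: "poly (map_poly of_real B) z \<noteq> (0::complex)" if z: "0 \<le> Re z" for z
    unfolding B_def poly_gibbs_poly moments[symmetric]
  proof (rule gibbs_sum_spin_nonzero)
    show "card U < K" using U(2) K by simp
    fix e assume e: "e \<in> U"
    then obtain j i b where e_eq: "e = (j, i, b)" and j: "j \<in> {1..n}" and i: "i < length (cs j)" by (auto simp: U_def)
    have pos: "0 < cs j ! i" using cs[OF j] i by simp
    then show "\<beta> e \<noteq> 0" by (simp add: \<beta>_def e_eq)
    show "fst e \<in> {1..n}" using j by (simp add: e_eq)
    have "Re (1 / \<beta> e) = 0" by (simp add: \<beta>_def e_eq Re_divide)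
    moreover have "0 < h j + Re z * a j" using h[OF j] a[OF j] z by (simp add: add_pos_nonneg)
    ultimately show "0 < Re (1 / \<beta> e + (of_real (h (fst e)) + z * of_real (a (fst e))))"
      by (simp add: e_eq del: Re_divide_of_real)
  qed (use U J in auto)
  have B0: "1 \<le> coeff B 0"
    unfolding B_def using a h J cs K
    by (intro coeff_gibbs_poly_sum_ge_1 formal_functional_nonneg formal_functional_zero) (auto intro: less_imp_le)
  have "even_part B \<noteq> 0" using B0 by (metis coeff_0 coeff_even_part mult_0_right not_one_le_zero)
  from lin_prod_of_negative_zeros[OF this even_part_stable_zeros[OF stable]]
  obtain ds where ds: "\<And>c. c \<in> set ds \<Longrightarrow> 0 < c" "\<And>k. coeff (even_part B) k = coeff (even_part B) 0 * coeff (lin_prod ds) k"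
    by metis
  define b where "b k = fact k * coeff (lin_prod ds) k" for k
  have eq: "fact k * coeff B (2 * k) = coeff B 0 * b k" for k
    using ds(2)[of k] by (simp add: b_def)
  have "b l ^ k \<le> b k ^ l"
  proof (rule log_concave_root_decreasing)
    show "log_concave b" unfolding b_def using ds(1) by (intro log_concave_lin_prod less_imp_le)
    show "b 0 = 1" by (simp add: b_def coeff_lin_prod_0)
  qed (use kl in simp_all)
  then have "coeff B 0 ^ l * b l ^ k \<le> coeff B 0 ^ l * b k ^ l" using B0 by (intro mult_left_mono) simp_all
  moreover have "coeff B 0 ^ l = coeff B 0 ^ k * coeff B 0 ^ (l - k)" using kl by (simp flip: power_add)
  ultimately show ?thesis unfolding eq power_mult_distrib by (simp add: mult_ac)
qed

text \<open>
  Both sides are polynomials in the \<open>h\<^sub>j\<close>, so the case \<open>h \<ge> 0\<close> follows by continuity.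
\<close>

lemma gibbs_poly_moment_inequality:
  assumes cs: "\<And>j c. j \<in> {1..n} \<Longrightarrow> c \<in> set (cs j) \<Longrightarrow> 0 < c"
    and a: "\<And>j. j \<in> {1..n} \<Longrightarrow> 0 \<le> a j" and h: "\<And>j. j \<in> {1..n} \<Longrightarrow> 0 \<le> h j"
    and J: "\<And>j k. j \<in> {1..n} \<Longrightarrow> k \<in> {1..n} \<Longrightarrow> 0 \<le> J j k"
    and K: "2 * (\<Sum>j=1..n. length (cs j)) < K" and kl: "0 < k" "k \<le> l"
  defines "B \<equiv> \<Sum>r<K. gibbs_poly r n a h J (formal_functional n cs)"
  shows "(fact l * coeff B (2 * l)) ^ k * coeff B 0 ^ (l - k) \<le> (fact k * coeff B (2 * k)) ^ l"
proof -
  define B' where "B' N = (\<Sum>r<K. gibbs_poly r n a (\<lambda>j. h j + inverse (real (Suc N))) J (formal_functional n cs))" for N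
  have lim: "(\<lambda>N. coeff (B' N) i) \<longlonglongrightarrow> coeff B i" for i
  proof -
    have "(\<lambda>N. h j + inverse (real (Suc N))) \<longlonglongrightarrow> h j" for j
      using tendsto_add[OF tendsto_const LIMSEQ_inverse_real_of_nat, of "h j"] by simp
    then show ?thesis
      unfolding B'_def B_def gibbs_poly_def coeff_sum coeff_smult
      by (intro tendsto_sum tendsto_mult tendsto_const coeff_energy_pow_tendsto)
  qed
  have "(fact l * coeff (B' N) (2 * l)) ^ k * coeff (B' N) 0 ^ (l - k) \<le> (fact k * coeff (B' N) (2 * k)) ^ l" for N
    unfolding B'_def using cs a h J K kl
    by (intro gibbs_poly_moment_inequality_pos) (auto intro: add_nonneg_pos)
  then show ?thesis
    by (intro LIMSEQ_le[of "\<lambda>N. (fact l * coeff (B' N) (2 * l)) ^ k * coeff (B' N) 0 ^ (l - k)" _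
          "\<lambda>N. (fact k * coeff (B' N) (2 * k)) ^ l"] tendsto_intros lim) blast
qed

section \<open>Splitting zeros off an entire function\<close>

text \<open>
  The quotient by a linear factor that vanishes at a zero has a removable singularity there.
\<close>

lemma entire_linear_factor:
  fixes c :: real
  assumes H: "H holomorphic_on UNIV" "H 0 = 1" and c: "c \<noteq> 0" and zero: "H (- of_real (1 / c)) = 0"
  obtains G where "G holomorphic_on UNIV" "G 0 = 1" "\<And>s. H s = (1 + of_real c * s) * G s"
proof
  define \<zeta> :: complex where "\<zeta> = - of_real (1 / c)"
  define G where "G s = (if s = \<zeta> then deriv H \<zeta> else (H s - H \<zeta>) / (s - \<zeta>)) / of_real c" for s
  have c\<zeta>: "of_real c * \<zeta> = -1" using c by (simp add: \<zeta>_def)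
  show "G holomorphic_on UNIV"
    unfolding G_def using c by (intro holomorphic_intros pole_lemma_open H) simp_all
  show eq: "H s = (1 + of_real c * s) * G s" for s
  proof (cases "s = \<zeta>")
    case True
    then show ?thesis using zero c\<zeta> by (simp add: \<zeta>_def)
  next
    case False
    have "1 + of_real c * s = of_real c * (s - \<zeta>)" using c\<zeta> by (simp add: algebra_simps)
    moreover have "s - \<zeta> \<noteq> 0" using False by simp
    moreover have "H \<zeta> = 0" using zero by (simp add: \<zeta>_def)
    ultimately show ?thesis using False c by (simp add: G_def)
  qed
  show "G 0 = 1" using eq[of 0] H by simp
qed

lemma norm_lin_prod_ge_power:
  fixes s :: complex
  assumes "0 \<le> t" and "\<And>c. c \<in> set cs \<Longrightarrow> 1 + t \<le> c * norm s"
  shows "t ^ length cs \<le> norm (poly (lin_prod (map of_real cs)) s)"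
  using assms(2)
proof (induction cs)
  case (Cons c cs)
  have "1 + t \<le> norm (of_real c * s)"
    using Cons.prems[of c] mult_right_mono[OF abs_ge_self norm_ge_zero, of c s] by (simp add: norm_mult)
  moreover have "norm (of_real c * s) - norm (1::complex) \<le> norm (1 + of_real c * s)"
    by (metis add.commute norm_diff_ineq)
  ultimately have "t \<le> norm (1 + of_real c * s)" by simp
  with Cons \<open>0 \<le> t\<close> have "t * t ^ length cs \<le> norm (1 + of_real c * s) * norm (poly (lin_prod (map of_real cs)) s)"
    by (intro mult_mono) simp_all
  then show ?case by (simp add: norm_mult mult_ac)
qed simp

text \<open>
  The zeros are written as \<open>- 1 / c\<close> because the factor split off is \<open>1 + c s\<close>.
\<close>

definition negative_zeros :: "(complex \<Rightarrow> complex) \<Rightarrow> bool" where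
  "negative_zeros H \<longleftrightarrow> (\<forall>s. H s = 0 \<longrightarrow> (\<exists>c>0. s = - of_real (1 / c)))"

lemma maximum_modulus_disc:
  fixes f :: "complex \<Rightarrow> complex"
  assumes "f holomorphic_on UNIV" and "0 < R" and "\<And>z. norm z = R \<Longrightarrow> norm (f z) \<le> B" and "norm w \<le> R"
  shows "norm (f w) \<le> B"
proof (rule maximum_modulus_frontier[of f "cball 0 R"])
  show "f holomorphic_on interior (cball 0 R)" using assms(1) by (rule holomorphic_on_subset) simp
  show "continuous_on (closure (cball 0 R)) f"
    using holomorphic_on_imp_continuous_on[OF assms(1)] by (rule continuous_on_subset) simp
qed (use assms in \<open>auto simp: frontier_cball\<close>)

text \<open>
  Zeros in the disc of radius \<open>R\<close> are split off one at a time. The process stops, which is a crude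
  form of Jensen's inequality: on the circle of radius \<open>3 R\<close> every factor has modulus at least \<open>2\<close>, so \<open>m\<close>
  factors leave a quotient bounded by \<open>B / 2^m\<close> there, whereas it has the value \<open>1\<close> at \<open>0\<close>.
  Splitting them off singly avoids any mention of multiplicities.
\<close>

lemma extract_zeros:
  assumes H: "H holomorphic_on UNIV" "H 0 = 1" "negative_zeros H" and R: "0 < R"
  obtains cs G where "\<forall>c\<in>set cs. 1 / R \<le> c" "G holomorphic_on UNIV" "G 0 = 1" "negative_zeros G"
    "\<And>s. H s = poly (lin_prod (map of_real cs)) s * G s" "\<And>s. norm s \<le> R \<Longrightarrow> G s \<noteq> 0"
proof -
  define good where "good cs G \<longleftrightarrow> (\<forall>c\<in>set cs. 1 / R \<le> c) \<and> G holomorphic_on UNIV \<and> G 0 = 1 \<and>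
    (\<forall>s. H s = poly (lin_prod (map of_real cs)) s * G s)" for cs G
  have "compact (sphere (0::complex) (3 * R))" by simp
  then have "compact (H ` sphere 0 (3 * R))"
    using holomorphic_on_imp_continuous_on[OF H(1)] by (intro compact_continuous_image) (auto intro: continuous_on_subset)
  then obtain B where B: "\<And>s. norm s = 3 * R \<Longrightarrow> norm (H s) \<le> B"
    using compact_imp_bounded[of "H ` sphere 0 (3 * R)"] unfolding bounded_iff by force
  have bound: "2 ^ length cs \<le> B" if "good cs G" for cs G
  proof -
    have cs: "\<forall>c\<in>set cs. 1 / R \<le> c" and G: "G holomorphic_on UNIV" "G 0 = 1"
      and eq: "\<And>s. H s = poly (lin_prod (map of_real cs)) s * G s"
      using that by (auto simp: good_def)
    have "norm (G 0) \<le> B / 2 ^ length cs"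
    proof (rule maximum_modulus_disc[OF G(1)])
      fix s :: complex assume s: "norm s = 3 * R"
      have "2 ^ length cs \<le> norm (poly (lin_prod (map of_real cs)) s)"
        using cs R by (intro norm_lin_prod_ge_power[of 2]) (auto simp: s field_simps)
      then have "2 ^ length cs * norm (G s) \<le> norm (H s)"
        unfolding eq norm_mult by (intro mult_right_mono) simp_all
      also have "\<dots> \<le> B" using B s by simp
      finally show "norm (G s) \<le> B / 2 ^ length cs" by (simp add: field_simps)
    qed (use R in simp_all)
    then show ?thesis using G by (simp add: field_simps)
  qed
  obtain m where m: "B < 2 ^ m" using real_arch_pow[of 2 B] by auto
  have "length cs \<le> m" if "good cs G" for cs G
  proof -
    have "(2::real) ^ length cs < 2 ^ m" using bound[OF that] m by linarith
    then show ?thesis by simp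
  qed
  moreover have "good [] H" using H by (simp add: good_def)
  ultimately have "\<exists>cs. (\<exists>G. good cs G) \<and> (\<forall>cs'. (\<exists>G. good cs' G) \<longrightarrow> length cs' \<le> length cs)"
    by (intro ex_has_greatest_nat[of _ "[]" length "Suc m"]) (blast intro: le_imp_less_Suc)+
  then obtain cs G where good: "good cs G" and max: "\<And>cs' G'. good cs' G' \<Longrightarrow> length cs' \<le> length cs" by blast
  have zeros: "negative_zeros G" using good H(3) by (auto simp: good_def negative_zeros_def)
  have nz: "G s \<noteq> 0" if s: "norm s \<le> R" for s
  proof
    assume "G s = 0"
    with zeros obtain c where c: "0 < c" "s = - of_real (1 / c)" unfolding negative_zeros_def by blast
    then obtain G' where G': "G' holomorphic_on UNIV" "G' 0 = 1" "\<And>s. G s = (1 + of_real c * s) * G' s"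
      using entire_linear_factor[of G c] good \<open>G s = 0\<close> by (auto simp: good_def)
    have "1 / c \<le> R" using s c by (simp add: norm_divide)
    then have "good (c # cs) G'" using good G' c R
      by (auto simp: good_def field_simps)
    from max[OF this] show False by simp
  qed
  show ?thesis using that[of cs G] good zeros nz by (auto simp: good_def)
qed

text \<open>
  The map \<open>u \<mapsto> u / (2 M - u)\<close> sends the half-plane \<open>Re u < M\<close> into the unit disc and fixes \<open>0\<close>, which
  brings the Schwarz lemma into play.
\<close>

lemma Borel_Caratheodory:
  assumes g: "g holomorphic_on ball 0 R" "g 0 = 0" and R: "0 < R" and M: "0 < M"
    and Re: "\<And>s. norm s < R \<Longrightarrow> Re (g s) < M" and s: "norm s \<le> R / 2"
  shows "norm (g s) \<le> 2 * M"
proof -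
  define h where "h w = g (of_real R * w) / (of_real (2 * M) - g (of_real R * w))" for w
  have dom: "norm (of_real R * w) < R" if "norm w < 1" for w :: complex
    using that R by (simp add: norm_mult)
  have den: "norm (g w) < norm (of_real (2 * M) - g w)" if "norm w < R" for w
  proof -
    have "(norm (of_real (2 * M) - g w))\<^sup>2 - (norm (g w))\<^sup>2 = 4 * M * (M - Re (g w))"
      unfolding cmod_power2 by (simp add: power2_eq_square algebra_simps)
    also have "\<dots> > 0" using Re[OF that] M by simp
    finally show ?thesis by (simp add: power2_less_imp_less)
  qed
  have "norm (h w) \<le> norm w" if w: "norm w < 1" for w
  proof (rule Schwarz_Lemma(1)[OF _ _ _ w])
    have "(\<lambda>w. g (of_real R * w)) holomorphic_on ball 0 1"
      using g(1) dom by (intro holomorphic_on_compose_gen[of "\<lambda>w. of_real R * w" _ g "ball 0 R", unfolded o_def])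
        (auto intro!: holomorphic_intros)
    moreover have "of_real (2 * M) - g (of_real R * w) \<noteq> 0" if "w \<in> ball 0 1" for w
      using den[OF dom[of w]] that by auto
    ultimately show "h holomorphic_on ball 0 1"
      unfolding h_def by (intro holomorphic_intros) auto
    show "h 0 = 0" using g by (simp add: h_def)
    show "norm (h z) < 1" if "norm z < 1" for z
      using den[OF dom[OF that]] by (simp add: h_def norm_divide divide_less_eq)
  qed
  from this[of "s / of_real R"] have "norm (g s) / norm (of_real (2 * M) - g s) \<le> norm s / R"
    using s R by (simp add: h_def norm_divide)
  also have "\<dots> \<le> 1 / 2" using s R by (simp add: field_simps)
  finally have "norm (g s) \<le> norm (of_real (2 * M) - g s) / 2"
    using le_less_trans[OF norm_ge_zero den[of s]] s R by (simp add: divide_le_eq)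
  moreover have "norm (of_real (2 * M) - g s) \<le> 2 * M + norm (g s)"
    using norm_triangle_ineq4[of "of_real (2 * M)" "g s"] M by simp
  ultimately show ?thesis by simp
qed

text \<open>
  Cauchy's inequality on discs of radius \<open>R / 4\<close> bounds the second derivative. The point is the factor
  \<open>M / R\<^sup>2\<close>: if \<open>M\<close> grows only linearly in \<open>R\<close>, the deviation from the linear part tends to \<open>0\<close>.
\<close>

lemma log_almost_linear:
  assumes g: "g holomorphic_on ball 0 R" "g 0 = 0" and R: "0 < R" and M: "0 < M"
    and Re: "\<And>s. norm s < R \<Longrightarrow> Re (g s) < M" and s: "norm s \<le> R / 4"
  shows "norm (g s - deriv g 0 * s) \<le> 64 * M / R\<^sup>2 * (norm s)\<^sup>2"
proof -
  have sub: "x \<in> ball 0 R" if "norm x \<le> R / 4" for x :: complex using that R by simp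
  have gn: "(deriv ^^ i) g holomorphic_on ball 0 R" for i
    using g(1) by (intro holomorphic_higher_deriv) simp_all
  have second: "norm ((deriv ^^ 2) g x) \<le> 64 * M / R\<^sup>2" if x: "norm x \<le> R / 4" for x
  proof -
    have *: "norm y \<le> R / 2" if "dist x y \<le> R / 4" for y
      using x that norm_triangle_ineq4[of x "x - y"] by (simp add: dist_norm)
    have "norm ((deriv ^^ 2) g x) \<le> fact 2 * (2 * M) / (R / 4) ^ 2"
    proof (rule Cauchy_inequality)
      have "cball x (R / 4) \<subseteq> ball 0 R" using * R by fastforce
      then show "g holomorphic_on ball x (R / 4)" "continuous_on (cball x (R / 4)) g"
        using holomorphic_on_subset[OF g(1)] ball_subset_cball[of x "R / 4"]
        by (blast intro: holomorphic_on_imp_continuous_on)+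
      show "norm (g y) \<le> 2 * M" if "norm (x - y) = R / 4" for y
        using Borel_Caratheodory[OF g R M Re *[of y]] that by (simp add: dist_norm)
    qed (use R in simp)
    then show ?thesis by (simp add: power2_eq_square)
  qed
  have "norm ((deriv ^^ 0) g s - (\<Sum>i\<le>1. (deriv ^^ i) g 0 * (s - 0) ^ i / fact i))
      \<le> 64 * M / R\<^sup>2 * norm (s - 0) ^ Suc 1 / fact 1"
  proof (rule complex_Taylor[where S = "cball 0 (R / 4)"])
    show "((deriv ^^ i) g has_field_derivative (deriv ^^ Suc i) g x) (at x within cball 0 (R / 4))"
      if "x \<in> cball 0 (R / 4)" for i x
      using gn[of i] sub[of x] that by (auto intro!: holomorphic_derivI[OF _ open_ball])
    show "norm ((deriv ^^ Suc 1) g x) \<le> 64 * M / R\<^sup>2" if "x \<in> cball 0 (R / 4)" for x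
      using second[of x] that by (simp add: numeral_2_eq_2)
  qed (use s R in simp_all)
  then show ?thesis using g by (simp add: power2_eq_square algebra_simps)
qed

lemma coeff_lin_prod_1: "coeff (lin_prod cs) 1 = sum_list cs"
  by (induction cs) (simp_all only: lin_prod_Cons lin_prod_Nil coeff_linear_mult, simp_all add: coeff_lin_prod_0)

lemma coeff_lin_prod_append_mono:
  fixes cs :: "real list"
  assumes "\<And>c. c \<in> set (cs @ ds) \<Longrightarrow> 0 \<le> c"
  shows "coeff (lin_prod cs) k \<le> coeff (lin_prod (cs @ ds)) k"
proof -
  have "coeff (lin_prod cs) k * coeff (lin_prod ds) (k - k) \<le> (\<Sum>i\<le>k. coeff (lin_prod cs) i * coeff (lin_prod ds) (k - i))"
    using assms by (intro member_le_sum) (auto intro!: mult_nonneg_nonneg coeff_lin_prod_nonneg)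
  then show ?thesis by (simp add: lin_prod_append coeff_mult coeff_lin_prod_0)
qed

lemma poly_lin_prod_ge_1:
  assumes "\<And>c. c \<in> set cs \<Longrightarrow> 0 \<le> (c::real)" "0 \<le> x"
  shows "1 \<le> poly (lin_prod cs) x"
  using assms(1)
proof (induction cs)
  case (Cons c cs)
  then have "1 * 1 \<le> (1 + c * x) * poly (lin_prod cs) x"
    using \<open>0 \<le> x\<close> by (intro mult_mono) simp_all
  then show ?case by (simp add: mult_ac)
qed simp

lemma poly_lin_prod_le_exp:
  assumes "\<And>c. c \<in> set cs \<Longrightarrow> 0 \<le> (c::real)" "0 \<le> x"
  shows "poly (lin_prod cs) x \<le> exp (sum_list cs * x)"
  using assms(1)
proof (induction cs)
  case (Cons c cs)
  have "(1 + c * x) * poly (lin_prod cs) x \<le> exp (c * x) * exp (sum_list cs * x)"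
    using Cons poly_lin_prod_ge_1[of cs x] \<open>0 \<le> x\<close>
    by (intro mult_mono) (auto intro: order_trans[OF zero_le_one])
  also have "\<dots> = exp (sum_list (c # cs) * x)" by (simp add: distrib_right flip: exp_add)
  finally show ?case by simp
qed simp

text \<open>
  The rate \<open>\<eta>\<close> is split evenly between the first factor and the remaining ones.
\<close>

lemma poly_lin_prod_subexponential:
  assumes "\<And>c. c \<in> set cs \<Longrightarrow> 0 \<le> (c::real)" "0 < \<eta>"
  obtains B where "\<And>x. 0 \<le> x \<Longrightarrow> poly (lin_prod cs) x \<le> B * exp (\<eta> * x)"
proof -
  have "\<exists>B. \<forall>x\<ge>0. poly (lin_prod cs) x \<le> B * exp (\<eta> * x)"
    using assms
  proof (induction cs arbitrary: \<eta>)
    case Nil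
    then show ?case by (intro exI[of _ 1]) simp
  next
    case (Cons c cs)
    have c: "0 \<le> c" using Cons.prems by simp
    obtain B where B: "\<And>x. 0 \<le> x \<Longrightarrow> poly (lin_prod cs) x \<le> B * exp (\<eta> / 2 * x)"
      using Cons.IH[of "\<eta> / 2"] Cons.prems by auto
    show ?case
    proof (intro exI allI impI)
      fix x :: real assume x: "0 \<le> x"
      have "1 + c * x \<le> (1 + c / (\<eta> / 2)) * (1 + \<eta> / 2 * x)"
        using c x \<open>0 < \<eta>\<close> by (simp add: field_simps)
      also have "\<dots> \<le> (1 + c / (\<eta> / 2)) * exp (\<eta> / 2 * x)"
        using c \<open>0 < \<eta>\<close> by (intro mult_left_mono exp_ge_add_one_self) simp
      finally have "(1 + c * x) * poly (lin_prod cs) x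
          \<le> (1 + c / (\<eta> / 2)) * exp (\<eta> / 2 * x) * (B * exp (\<eta> / 2 * x))"
        using B[OF x] poly_lin_prod_ge_1[of cs x] Cons.prems c x
        by (intro mult_mono) (auto intro: order_trans[OF zero_le_one])
      also have "\<dots> = (1 + c / (\<eta> / 2)) * B * exp (\<eta> * x)"
        by (simp add: mult_ac flip: exp_add)
      finally show "poly (lin_prod (c # cs)) x \<le> (1 + c / (\<eta> / 2)) * B * exp (\<eta> * x)"
        by (simp add: mult_ac)
    qed
  qed
  then show ?thesis using that by blast
qed

lemma coeff_lin_prod_replicate:
  "coeff (lin_prod (replicate N c)) k = of_nat (N choose k) * c ^ k"
proof (induction N arbitrary: k)
  case (Suc N)
  then show ?case
    by (cases k) (simp_all only: replicate_Suc lin_prod_Cons coeff_linear_mult, simp_all add: algebra_simps)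
qed (simp add: binomial_eq_0)

text \<open>
  The coefficients of \<open>(1 + L s / N)^N\<close> approximate those of \<open>exp (L s)\<close> from below.
\<close>

lemma binomial_scaled_le:
  fixes L :: real assumes "0 \<le> L"
  shows "real (N choose m) * (L / real N) ^ m \<le> L ^ m / fact m"
proof (cases "N = 0")
  case False
  have "real ((N choose m) * fact m) \<le> real (N ^ m)" by (rule of_nat_mono[OF binomial_fact_pow])
  then have "real (N choose m) / real N ^ m \<le> 1 / fact m"
    using False by (simp add: field_simps)
  from mult_left_mono[OF this, of "L ^ m"] show ?thesis
    using assms by (simp add: power_divide mult_ac)
qed (cases m; use assms in simp)

lemma binomial_scaled_tendsto:
  fixes L :: real
  shows "(\<lambda>N. real (N choose m) * (L / real N) ^ m) \<longlonglongrightarrow> L ^ m / fact m"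
proof (induction m)
  case (Suc m)
  have "real (N choose Suc m) * (L / real N) ^ Suc m
      = (real (N choose m) * (L / real N) ^ m) * (L / real (Suc m) * (1 - real m * inverse (real N)))" if "0 < N" for N
  proof -
    have "real (Suc m) * real (N choose Suc m) = (real N - real m) * real (N choose m)"
      using gbinomial_mult_1[of "real N" m] by (simp add: binomial_gbinomial algebra_simps)
    then have "real (N choose Suc m) = (real N - real m) * real (N choose m) / real (Suc m)"
      by (simp add: field_simps)
    then show ?thesis using that by (simp add: power_divide) (simp add: field_simps)
  qed
  then have "eventually (\<lambda>N. real (N choose Suc m) * (L / real N) ^ Suc m
      = (real (N choose m) * (L / real N) ^ m) * (L / real (Suc m) * (1 - real m * inverse (real N)))) sequentially"
    by (intro eventually_sequentiallyI[of 1]) simp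
  moreover have "(\<lambda>N. (real (N choose m) * (L / real N) ^ m) * (L / real (Suc m) * (1 - real m * inverse (real N))))
      \<longlonglongrightarrow> (L ^ m / fact m) * (L / real (Suc m) * (1 - real m * 0))"
    by (intro tendsto_intros Suc LIMSEQ_inverse_real_of_nat lim_inverse_n)
  ultimately show ?case by (subst tendsto_cong) (simp_all add: field_simps)
qed simp


text \<open>
  The lists of zeros for increasing radii extend one another, since each step only splits further
  zeros off the previous quotient.
\<close>

lemma exhaust_zeros:
  assumes F: "F holomorphic_on UNIV" "F 0 = 1" "negative_zeros F"
  obtains cs :: "nat \<Rightarrow> real list" and G :: "nat \<Rightarrow> complex \<Rightarrow> complex"
  where "\<And>N c. c \<in> set (cs N) \<Longrightarrow> 1 / real (Suc N) \<le> c"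
    and "\<And>N. \<exists>ds. cs (Suc N) = cs N @ ds"
    and "\<And>N. G N holomorphic_on UNIV" "\<And>N. G N 0 = 1"
    and "\<And>N s. F s = poly (lin_prod (map of_real (cs N))) s * G N s"
    and "\<And>N s. norm s \<le> real (Suc N) \<Longrightarrow> G N s \<noteq> 0"
proof -
  define stage where "stage N x \<longleftrightarrow> (case x of (cs, G) \<Rightarrow> (\<forall>c\<in>set cs. 1 / real (Suc N) \<le> c) \<and> G holomorphic_on UNIV \<and> G 0 = 1 \<and>
    negative_zeros G \<and> (\<forall>s. F s = poly (lin_prod (map of_real cs)) s * G s) \<and>
    (\<forall>s. norm s \<le> real (Suc N) \<longrightarrow> G s \<noteq> 0))" for N and x :: "real list \<times> (complex \<Rightarrow> complex)"
  have "\<exists>X. \<forall>N. stage N (X N) \<and> (\<exists>ds. fst (X (Suc N)) = fst (X N) @ ds)"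
  proof (rule dependent_nat_choice)
    obtain cs G where "\<forall>c\<in>set cs. 1 / real (Suc 0) \<le> c" "G holomorphic_on UNIV" "G 0 = 1"
      "negative_zeros G" "\<And>s. F s = poly (lin_prod (map of_real cs)) s * G s"
      "\<And>s. norm s \<le> real (Suc 0) \<Longrightarrow> G s \<noteq> 0"
      using extract_zeros[OF F, of "real (Suc 0)"] by (metis of_nat_0_less_iff zero_less_Suc)
    then have "stage 0 (cs, G)" by (simp add: stage_def)
    then show "\<exists>x. stage 0 x" by blast
  next
    fix x N assume stage: "stage N x"
    obtain cs G where x: "x = (cs, G)" by (cases x)
    have G: "G holomorphic_on UNIV" "G 0 = 1" "negative_zeros G" and cs: "\<forall>c\<in>set cs. 1 / real (Suc N) \<le> c"
      and eq: "\<And>s. F s = poly (lin_prod (map of_real cs)) s * G s"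
      using stage by (auto simp: stage_def x)
    obtain ds H where ds: "\<forall>c\<in>set ds. 1 / real (Suc (Suc N)) \<le> c" and H: "H holomorphic_on UNIV" "H 0 = 1"
      "negative_zeros H" "\<And>s. G s = poly (lin_prod (map of_real ds)) s * H s"
      "\<And>s. norm s \<le> real (Suc (Suc N)) \<Longrightarrow> H s \<noteq> 0"
      using extract_zeros[OF G, of "real (Suc (Suc N))"] by auto
    have "1 / real (Suc (Suc N)) \<le> 1 / real (Suc N)" by (simp add: field_simps)
    then have "\<forall>c\<in>set cs. 1 / real (Suc (Suc N)) \<le> c" using cs by force
    then have "stage (Suc N) (cs @ ds, H)"
      using ds H eq by (auto simp: stage_def lin_prod_append simp del: of_nat_Suc)
    then show "\<exists>y. stage (Suc N) y \<and> (\<exists>ds. fst y = fst x @ ds)" by (force simp: x)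
  qed
  then obtain X where X: "\<And>N. stage N (X N)" "\<And>N. \<exists>ds. fst (X (Suc N)) = fst (X N) @ ds" by blast
  show ?thesis
  proof (rule that)
    show "1 / real (Suc N) \<le> c" if "c \<in> set (fst (X N))" for N c
      using X(1)[of N] that by (auto simp: stage_def split: prod.splits)
    show "\<exists>ds. fst (X (Suc N)) = fst (X N) @ ds" for N by (rule X(2))
    show "snd (X N) holomorphic_on UNIV" "snd (X N) 0 = 1"
      "F s = poly (lin_prod (map of_real (fst (X N)))) s * snd (X N) s"
      "norm s \<le> real (Suc N) \<Longrightarrow> snd (X N) s \<noteq> 0" for N s
      using X(1)[of N] by (auto simp: stage_def split: prod.splits)
  qed
qed

text \<open>
  A zero-free function with \<open>\<bar>G\<bar> \<le> exp K\<close> on a disc has a logarithm with real part less than \<open>K + 1\<close> there.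
\<close>

lemma zero_free_almost_exponential:
  assumes G: "G holomorphic_on UNIV" "G 0 = 1" and R: "0 < R" and nz: "\<And>s. norm s < R \<Longrightarrow> G s \<noteq> 0"
    and K: "0 \<le> K" and bound: "\<And>s. norm s < R \<Longrightarrow> norm (G s) \<le> exp K" and s: "norm s \<le> R / 4"
  shows "\<exists>r. G s = exp (deriv G 0 * s + r) \<and> norm r \<le> 64 * (K + 1) / R\<^sup>2 * (norm s)\<^sup>2"
proof -
  have holG: "G holomorphic_on ball 0 R" using G(1) by (rule holomorphic_on_subset) simp
  obtain g where g: "g holomorphic_on ball 0 R" "\<And>s. s \<in> ball 0 R \<Longrightarrow> exp (g s) = G s"
    using holomorphic_logarithm_exists[OF convex_ball open_ball holG, of 0] nz R by auto
  define g1 where "g1 s = g s - g 0" for s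
  have "exp (g 0) = 1" using g(2)[of 0] R G by simp
  then have exp_g1: "exp (g1 s) = G s" if "norm s < R" for s
    using g(2)[of s] that by (simp add: g1_def exp_diff)
  have g1: "g1 holomorphic_on ball 0 R" "g1 0 = 0"
    unfolding g1_def by (intro holomorphic_intros g) simp
  have "Re (g1 s) < K + 1" if "norm s < R" for s
  proof -
    have "exp (Re (g1 s)) \<le> exp K" using bound[OF that] exp_g1[OF that] by (simp flip: norm_exp_eq_Re)
    then show ?thesis by simp
  qed
  then have "norm (g1 s - deriv g1 0 * s) \<le> 64 * (K + 1) / R\<^sup>2 * (norm s)\<^sup>2"
    using log_almost_linear[OF g1 R, of "K + 1" s] K s by simp
  moreover have "deriv G 0 = deriv g1 0"
  proof -
    have "(g1 has_field_derivative deriv g1 0) (at 0)"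
      using R by (intro holomorphic_derivI[OF g1(1) open_ball]) simp
    then have "((\<lambda>s. exp (g1 s)) has_field_derivative exp (g1 0) * deriv g1 0) (at 0)"
      by (rule DERIV_chain2[OF DERIV_exp])
    then have "(G has_field_derivative exp (g1 0) * deriv g1 0) (at 0)"
      by (rule has_field_derivative_transform_within_open[of _ _ _ "ball 0 R"]) (use R exp_g1 in auto)
    then show ?thesis using DERIV_imp_deriv g1 by force
  qed
  ultimately show ?thesis using exp_g1[of s] s R by (intro exI[of _ "g1 s - deriv g1 0 * s"]) simp
qed

section \<open>Approximation from below by products of linear factors\<close>

text \<open>
  Write \<open>F = P\<^sub>N G\<^sub>N\<close>, where \<open>P\<^sub>N\<close> carries the zeros in the disc of radius \<open>N + 1\<close>. The growth of \<open>F\<close> makes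
  \<open>G\<^sub>N\<close> close to \<open>exp (a\<^sub>N s)\<close> with \<open>a\<^sub>N = f 1 - \<Sum> c\<close>, the sum running over the factors of \<open>P\<^sub>N\<close>. The
  numbers \<open>a\<^sub>N\<close> decrease, and they are nonnegative because a negative one would force \<open>F\<close> to decay on the
  positive axis, where \<open>F \<ge> f 0 = 1\<close>. With their limit \<open>L \<ge> 0\<close>, the polynomials
  \<open>P\<^sub>N (1 + L s / N)^N\<close> are products of the required form. Their coefficients are at most those of
  \<open>P\<^sub>N exp (L s)\<close>, which increase with \<open>N\<close> to those of \<open>F\<close>.
\<close>

theorem lin_prod_approximation:
  fixes f :: "nat \<Rightarrow> real" and F :: "complex \<Rightarrow> complex"
  assumes f: "f 0 = 1" "\<And>k. 0 \<le> f k"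
    and sums: "\<And>s. (\<lambda>k. of_real (f k) * s ^ k) sums F s"
    and growth: "\<And>s. norm (F s) \<le> C * exp (C' * norm s)" "0 < C" "0 \<le> C'"
    and zeros: "negative_zeros F"
  obtains q :: "nat \<Rightarrow> real list" where "\<And>N c. c \<in> set (q N) \<Longrightarrow> 0 \<le> c"
    and "\<And>N k. coeff (lin_prod (q N)) k \<le> f k"
    and "\<And>k. (\<lambda>N. coeff (lin_prod (q N)) k) \<longlonglongrightarrow> f k"
proof -
  define \<Phi> where "\<Phi> = Abs_fps (\<lambda>k. complex_of_real (f k))"
  have radius: "fps_conv_radius \<Phi> = \<infinity>"
    unfolding fps_conv_radius_def \<Phi>_def using sums
    by (intro conv_radius_inftyI'') (auto simp: sums_iff)
  have F_eq: "F = eval_fps \<Phi>"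
    using sums by (auto simp: fun_eq_iff eval_fps_def \<Phi>_def sums_iff)
  have F_exp: "F has_fps_expansion \<Phi>"
    unfolding F_eq using radius by (intro eval_fps_has_fps_expansion) simp
  have holF: "F holomorphic_on UNIV"
    unfolding F_eq by (rule holomorphic_on_eval_fps) (simp add: radius)
  have coef: "(deriv ^^ k) F 0 = fact k * of_real (f k)" for k
    using fps_nth_fps_expansion[OF F_exp, of k] by (simp add: \<Phi>_def field_simps)
  have F0: "F 0 = 1" using coef[of 0] f by simp
  have F_real: "1 \<le> norm (F (of_real x))" if "0 \<le> x" for x :: real
  proof -
    have "(\<lambda>k. of_real (f k * x ^ k)) sums F (of_real x)" using sums[of "of_real x"] by simp
    then have "(\<lambda>k. f k * x ^ k) sums Re (F (of_real x))" using sums_Re by fastforce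
    then have "f 0 * x ^ 0 \<le> Re (F (of_real x))"
      using sum_le_suminf[of "\<lambda>k. f k * x ^ k" "{0}"] f that by (auto simp: sums_iff)
    then show ?thesis using f complex_Re_le_cmod[of "F (of_real x)"] by simp
  qed
  have C: "1 \<le> C" using growth(1)[of 0] F0 by simp

  obtain cs :: "nat \<Rightarrow> real list" and G :: "nat \<Rightarrow> complex \<Rightarrow> complex"
    where cs: "\<And>N c. c \<in> set (cs N) \<Longrightarrow> 1 / real (Suc N) \<le> c"
      and ext: "\<And>N. \<exists>ds. cs (Suc N) = cs N @ ds"
      and G: "\<And>N. G N holomorphic_on UNIV" "\<And>N. G N 0 = 1"
      and FG: "\<And>N s. F s = poly (lin_prod (map of_real (cs N))) s * G N s"
      and nz: "\<And>N s. norm s \<le> real (Suc N) \<Longrightarrow> G N s \<noteq> 0"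
    by (rule exhaust_zeros[OF holF F0 zeros]) blast
  have cs_nonneg: "0 \<le> c" if "c \<in> set (cs N)" for c N
    using cs[OF that] by (rule order_trans[rotated]) simp
  define P :: "nat \<Rightarrow> nat \<Rightarrow> real" where "P N k = coeff (lin_prod (cs N)) k" for N k
  define a where "a N = f 1 - sum_list (cs N)" for N

  have derivG: "deriv (G N) 0 = of_real (a N)" for N
  proof -
    let ?p = "lin_prod (map complex_of_real (cs N))"
    have "((\<lambda>s. poly ?p s * G N s) has_field_derivative poly (pderiv ?p) 0 * G N 0 + poly ?p 0 * deriv (G N) 0) (at 0)"
      using holomorphic_derivI[OF G(1) open_UNIV, of 0 N]
      by (auto intro!: derivative_eq_intros simp: mult_ac)
    then have "deriv (\<lambda>s. poly ?p s * G N s) 0 = poly (pderiv ?p) 0 * G N 0 + poly ?p 0 * deriv (G N) 0"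
      by (rule DERIV_imp_deriv)
    then have "deriv F 0 = poly (pderiv ?p) 0 * G N 0 + poly ?p 0 * deriv (G N) 0"
      by (simp only: FG[of _ N, symmetric])
    moreover have "poly (pderiv ?p) 0 = of_real (sum_list (cs N))" "poly ?p 0 = 1"
      using coeff_lin_prod_of_real[of "cs N" 1] coeff_lin_prod_1[of "cs N"] coeff_lin_prod_0[of "map complex_of_real (cs N)"]
      by (simp_all add: poly_0_coeff_0 coeff_pderiv)
    ultimately show ?thesis using coef[of 1] G by (simp add: a_def eq_diff_eq add.commute)
  qed

  \<comment> \<open>The maximum principle on the circle of radius \<open>2 (N + 1)\<close>, where each factor of \<open>P\<^sub>N\<close> has modulus
    at least \<open>1\<close>, bounds \<open>G\<^sub>N\<close> by the growth of \<open>F\<close> there; hence the \<open>2\<close> in this error bound.\<close>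
  define \<epsilon> where "\<epsilon> N = 64 * (ln C + C' * (2 * real (Suc N)) + 1) / (real (Suc N))\<^sup>2" for N
  have \<epsilon>: "\<epsilon> \<longlonglongrightarrow> 0" unfolding \<epsilon>_def by real_asymp
  have approx: "\<exists>r. G N s = exp (of_real (a N) * s + r) \<and> norm r \<le> \<epsilon> N * (norm s)\<^sup>2"
    if s: "norm s \<le> real (Suc N) / 4" for N s
    unfolding \<epsilon>_def derivG[symmetric]
  proof (rule zero_free_almost_exponential[OF G])
    fix w :: complex assume w: "norm w < real (Suc N)"
    show "norm (G N w) \<le> exp (ln C + C' * (2 * real (Suc N)))"
    proof (rule maximum_modulus_disc[OF G(1)])
      fix z :: complex assume z: "norm z = 2 * real (Suc N)"
      have "1 \<le> norm (poly (lin_prod (map of_real (cs N))) z)"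
      proof -
        have "1 + 1 \<le> c * norm z" if "c \<in> set (cs N)" for c
          using cs[OF that] by (simp add: z field_simps)
        from norm_lin_prod_ge_power[of 1 "cs N" z, OF _ this] show ?thesis by simp
      qed
      then have "1 * norm (G N z) \<le> norm (F z)"
        unfolding FG[of z N] norm_mult by (rule mult_right_mono) simp
      also have "\<dots> \<le> exp (ln C + C' * (2 * real (Suc N)))"
        using growth(1)[of z] z \<open>0 < C\<close> by (simp add: exp_add)
      finally show "norm (G N z) \<le> exp (ln C + C' * (2 * real (Suc N)))" by simp
    qed (use w in simp_all)
  qed (use nz s C growth(3) in simp_all)

  have a_Suc: "a (Suc N) \<le> a N" for N
  proof -
    obtain ds where "cs (Suc N) = cs N @ ds" using ext by blast
    moreover from this have "0 \<le> sum_list ds" using cs_nonneg[of _ "Suc N"] by (intro sum_list_nonneg) simp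
    ultimately show ?thesis by (simp add: a_def)
  qed
  have ext': "\<exists>ds. cs N = cs M @ ds" if "M \<le> N" for M N
    using that
  proof (induction N rule: dec_induct)
    case (step N)
    then show ?case using ext[of N] by auto
  qed simp
  have a_nonneg: "0 \<le> a M" for M
  proof (rule ccontr)
    assume neg: "\<not> 0 \<le> a M"
    define \<eta> where "\<eta> = - a M / 2"
    have \<eta>: "0 < \<eta>" using neg by (simp add: \<eta>_def)
    \<comment> \<open>Replacing the zeros between the radii \<open>M\<close> and \<open>N\<close> by the exponential bound \<open>1 + c x \<le> exp (c x)\<close>
      turns \<open>a N\<close> back into \<open>a M\<close>, so the estimate survives the limit in \<open>N\<close>.\<close>
    have le: "1 \<le> poly (lin_prod (cs M)) x * exp (a M * x)" if x: "0 \<le> x" for x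
    proof -
      have "1 \<le> poly (lin_prod (cs M)) x * exp (a M * x + \<epsilon> N * x\<^sup>2)"
        if N: "M \<le> N" "4 * x \<le> real (Suc N)" for N
      proof -
        obtain r where r: "G N (of_real x) = exp (of_real (a N) * of_real x + r)" "norm r \<le> \<epsilon> N * x\<^sup>2"
          using approx[of "of_real x" N] N x by auto
        obtain ds where ds: "cs N = cs M @ ds" using ext' N by blast
        have ds_nonneg: "0 \<le> c" if "c \<in> set ds" for c using cs_nonneg[of c N] that ds by simp
        have "norm (poly (lin_prod (map of_real (cs N))) (complex_of_real x)) = poly (lin_prod (cs N)) x"
        proof -
          have "poly (lin_prod (map of_real ds)) (complex_of_real x) = of_real (poly (lin_prod ds) x)" for ds
            by (induction ds) simp_all
          then show ?thesis using poly_lin_prod_ge_1[of "cs N" x] cs_nonneg x by simp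
        qed
        then have "1 \<le> poly (lin_prod (cs N)) x * norm (G N (of_real x))"
          using F_real[OF x] unfolding FG[of _ N] norm_mult by simp
        also have "norm (G N (of_real x)) \<le> exp (a N * x + \<epsilon> N * x\<^sup>2)"
          using r abs_Re_le_cmod[of r] by (simp add: norm_exp_eq_Re)
        also have "poly (lin_prod (cs N)) x \<le> poly (lin_prod (cs M)) x * exp (sum_list ds * x)"
          unfolding ds lin_prod_append poly_mult
          using poly_lin_prod_le_exp[of ds x] poly_lin_prod_ge_1[of "cs M" x] ds_nonneg cs_nonneg x
          by (intro mult_left_mono) (auto intro: order_trans[OF zero_le_one])
        finally have "1 \<le> poly (lin_prod (cs M)) x * exp (sum_list ds * x) * exp (a N * x + \<epsilon> N * x\<^sup>2)"
          using poly_lin_prod_ge_1[of "cs N" x] cs_nonneg x by (simp add: mult_left_mono mult_right_mono)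
        also have "\<dots> = poly (lin_prod (cs M)) x * exp (a M * x + \<epsilon> N * x\<^sup>2)"
          by (simp add: a_def ds algebra_simps flip: exp_add)
        finally show ?thesis .
      qed
      moreover have "(\<lambda>N. poly (lin_prod (cs M)) x * exp (a M * x + \<epsilon> N * x\<^sup>2))
          \<longlonglongrightarrow> poly (lin_prod (cs M)) x * exp (a M * x + 0 * x\<^sup>2)"
        by (intro tendsto_intros \<epsilon>)
      moreover obtain N0 where "4 * x \<le> real N0" using real_arch_simple by blast
      ultimately show ?thesis
        by (intro Lim_bounded2[of _ _ "max M N0"]) auto
    qed
    obtain B where B: "\<And>x. 0 \<le> x \<Longrightarrow> poly (lin_prod (cs M)) x \<le> B * exp (\<eta> * x)"
      using poly_lin_prod_subexponential[of "cs M", OF cs_nonneg[of _ M] \<eta>] by blast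
    have up: "exp (\<eta> * x) \<le> B" if "0 \<le> x" for x
    proof -
      have "1 \<le> B * exp (\<eta> * x) * exp (a M * x)"
        using le[OF that] B[OF that] by (smt (verit) exp_gt_zero mult_right_mono)
      also have "\<dots> = B / exp (\<eta> * x)" by (simp add: \<eta>_def field_simps flip: exp_add)
      finally show ?thesis by (simp add: field_simps)
    qed
    then have "0 \<le> B" using up[of 0] by simp
    then show False using up[of "B / \<eta>"] \<eta> exp_ge_add_one_self[of B] by simp
  qed
  obtain L where L: "a \<longlonglongrightarrow> L"
    using decseq_convergent[OF decseq_SucI[of a, OF a_Suc], of 0] a_nonneg by blast
  have L_nonneg: "0 \<le> L" using L a_nonneg by (intro Lim_bounded2) auto

  \<comment> \<open>The coefficients of \<open>P\<^sub>N exp (L s)\<close>.\<close>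
  define \<kappa> where "\<kappa> N k = (\<Sum>i\<le>k. P N i * (L ^ (k - i) / fact (k - i)))" for N k
  have \<kappa>_lim: "(\<lambda>N. \<kappa> N k) \<longlonglongrightarrow> f k" for k
  proof -
    define E where "E N s = poly (lin_prod (map of_real (cs N))) s * exp (of_real L * s)" for N and s :: complex
    have E_exp: "E N has_fps_expansion (fps_of_poly (lin_prod (map of_real (cs N))) * fps_exp (of_real L))" for N
    proof -
      have "poly p has_fps_expansion fps_of_poly p" for p :: "complex poly"
        by (simp add: has_fps_expansion_def)
      then show ?thesis unfolding E_def by (intro has_fps_expansion_mult has_fps_expansion_exp)
    qed
    define B where "B = C * exp C'"
    define \<delta> where "\<delta> N = \<bar>L - a N\<bar> + \<epsilon> N" for N
    have close: "norm (E N s - F s) \<le> B * (exp (\<delta> N) * \<delta> N)" if s: "norm s < 1" and N: "4 \<le> N" for N s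
    proof -
      obtain r where r: "G N s = exp (of_real (a N) * s + r)" "norm r \<le> \<epsilon> N * (norm s)\<^sup>2"
        using approx[of s N] s N by auto
      have \<epsilon>0: "0 \<le> \<epsilon> N" using C growth(3) by (simp add: \<epsilon>_def)
      define w where "w = of_real (L - a N) * s - r"
      have "norm w \<le> norm (of_real (L - a N) * s) + norm r" unfolding w_def by (rule norm_triangle_ineq4)
      also have "\<dots> \<le> \<bar>L - a N\<bar> * 1 + \<epsilon> N * 1"
        using r(2) s \<epsilon>0 by (intro add_mono order_trans[OF r(2)] mult_left_mono)
          (auto simp: norm_mult power_le_one mult_left_le simp flip: of_real_diff)
      finally have w: "norm w \<le> \<delta> N" by (simp add: \<delta>_def)
      have "E N s = F s * exp w"
        unfolding E_def FG[of s N] r(1) w_def by (simp add: algebra_simps flip: exp_add)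
      then have "norm (E N s - F s) = norm (F s) * norm (exp w - 1)"
        by (simp add: algebra_simps flip: norm_mult)
      also have "\<dots> \<le> B * (exp (\<delta> N) * \<delta> N)"
      proof (rule mult_mono)
        have "C * exp (C' * norm s) \<le> B"
          unfolding B_def using s C growth(3) by (intro mult_left_mono) (simp_all add: mult_left_le)
        with growth(1)[of s] show "norm (F s) \<le> B" by linarith
        have "norm (exp w - 1) \<le> exp \<bar>Re w\<bar> * norm w" using Taylor_exp[of w 0] by simp
        also have "\<dots> \<le> exp (\<delta> N) * \<delta> N"
          using w abs_Re_le_cmod[of w] by (intro mult_mono) simp_all
        finally show "norm (exp w - 1) \<le> exp (\<delta> N) * \<delta> N" .
      qed (use C in \<open>simp_all add: B_def\<close>)
      finally show ?thesis .
    qed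
    have "uniform_limit (ball 0 1) E F sequentially"
      unfolding uniform_limit_iff
    proof (intro allI impI)
      fix e :: real assume "0 < e"
      have "(\<lambda>N. B * (exp (\<delta> N) * \<delta> N)) \<longlonglongrightarrow> B * (exp (\<bar>L - L\<bar> + 0) * (\<bar>L - L\<bar> + 0))"
        unfolding \<delta>_def by (intro tendsto_intros L \<epsilon>)
      then have "eventually (\<lambda>N. B * (exp (\<delta> N) * \<delta> N) < e) sequentially"
        using \<open>0 < e\<close> by (intro order_tendstoD) auto
      then show "eventually (\<lambda>N. \<forall>s\<in>ball 0 1. dist (E N s) (F s) < e) sequentially"
        using eventually_ge_at_top[of 4]
        by eventually_elim (auto simp: dist_norm intro: le_less_trans[OF close])
    qed
    then have "(\<lambda>N. (deriv ^^ k) (E N) 0) \<longlonglongrightarrow> (deriv ^^ k) F 0"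
      by (rule higher_deriv_complex_uniform_limit)
        (auto intro!: always_eventually holomorphic_intros simp: E_def[abs_def])
    then have "(\<lambda>N. (deriv ^^ k) (E N) 0 / fact k) \<longlonglongrightarrow> (deriv ^^ k) F 0 / fact k"
      by (intro tendsto_intros) auto
    moreover have "(deriv ^^ k) (E N) 0 / fact k = of_real (\<kappa> N k)" for N
      by (simp add: fps_nth_fps_expansion[OF E_exp, symmetric] fps_mult_nth \<kappa>_def P_def coeff_lin_prod_of_real atLeast0AtMost)
    ultimately show ?thesis by (simp add: coef tendsto_of_real_iff)
  qed
  have P_nonneg: "0 \<le> P N k" for N k
    unfolding P_def by (intro coeff_lin_prod_nonneg cs_nonneg)
  have P_Suc: "P N k \<le> P (Suc N) k" for N k
  proof -
    obtain ds where "cs (Suc N) = cs N @ ds" using ext by blast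
    then show ?thesis unfolding P_def using cs_nonneg[of _ "Suc N"] by (auto intro!: coeff_lin_prod_append_mono)
  qed
  have \<kappa>_le: "\<kappa> N k \<le> f k" for N k
  proof (rule incseq_le[OF _ \<kappa>_lim])
    show "incseq (\<lambda>N. \<kappa> N k)"
      unfolding \<kappa>_def using L_nonneg P_Suc by (intro incseq_SucI sum_mono mult_right_mono) simp_all
  qed
  have P_le: "P N i \<le> f i" for N i
  proof -
    have "P N i * (L ^ (i - i) / fact (i - i)) \<le> \<kappa> N i"
      unfolding \<kappa>_def using P_nonneg L_nonneg by (intro member_le_sum) auto
    with \<kappa>_le[of N i] show ?thesis by simp
  qed

  \<comment> \<open>For \<open>N = 0\<close> the division by zero is harmless, as no factor is added.\<close>
  define q where "q N = cs N @ replicate N (L / real N)" for N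
  define b where "b N m = real (N choose m) * (L / real N) ^ m" for N m
  have q_coeff: "coeff (lin_prod (q N)) k = (\<Sum>i\<le>k. P N i * b N (k - i))" for N k
    by (simp add: q_def lin_prod_append coeff_mult P_def b_def coeff_lin_prod_replicate)
  have b_le: "b N m \<le> L ^ m / fact m" for N m
    unfolding b_def by (rule binomial_scaled_le[OF L_nonneg])
  have q_le: "coeff (lin_prod (q N)) k \<le> \<kappa> N k" for N k
    unfolding q_coeff \<kappa>_def using b_le P_nonneg by (intro sum_mono mult_left_mono)
  have "(\<lambda>N. coeff (lin_prod (q N)) k) \<longlonglongrightarrow> f k" for k
  proof (rule tendsto_sandwich[OF _ _ _ \<kappa>_lim])
    show "eventually (\<lambda>N. coeff (lin_prod (q N)) k \<le> \<kappa> N k) sequentially" using q_le by simp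
    show "eventually (\<lambda>N. \<kappa> N k - (\<Sum>i\<le>k. f i * (L ^ (k - i) / fact (k - i) - b N (k - i)))
        \<le> coeff (lin_prod (q N)) k) sequentially"
    proof (intro always_eventually allI)
      fix N
      have "\<kappa> N k - coeff (lin_prod (q N)) k = (\<Sum>i\<le>k. P N i * (L ^ (k - i) / fact (k - i) - b N (k - i)))"
        by (simp add: \<kappa>_def q_coeff right_diff_distrib sum_subtractf)
      also have "\<dots> \<le> (\<Sum>i\<le>k. f i * (L ^ (k - i) / fact (k - i) - b N (k - i)))"
        using P_le b_le by (intro sum_mono mult_right_mono) auto
      finally show "\<kappa> N k - (\<Sum>i\<le>k. f i * (L ^ (k - i) / fact (k - i) - b N (k - i))) \<le> coeff (lin_prod (q N)) k"
        by linarith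
    qed
    have "(\<lambda>N. \<kappa> N k - (\<Sum>i\<le>k. f i * (L ^ (k - i) / fact (k - i) - b N (k - i))))
        \<longlonglongrightarrow> f k - (\<Sum>i\<le>k. f i * (L ^ (k - i) / fact (k - i) - L ^ (k - i) / fact (k - i)))"
      unfolding b_def by (intro tendsto_intros \<kappa>_lim binomial_scaled_tendsto)
    then show "(\<lambda>N. \<kappa> N k - (\<Sum>i\<le>k. f i * (L ^ (k - i) / fact (k - i) - b N (k - i)))) \<longlonglongrightarrow> f k" by simp
  qed
  moreover have "0 \<le> c" if "c \<in> set (q N)" for N c
    using that cs_nonneg L_nonneg by (auto simp: q_def)
  moreover have "coeff (lin_prod (q N)) k \<le> f k" for N k
    using q_le \<kappa>_le order_trans by blast
  ultimately show ?thesis using that by blast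
qed

section \<open>Laws of type L\<close>

text \<open>
  Odd moments are put to \<open>0\<close>, which is their value for a symmetric law.
\<close>

definition even_moment :: "real measure \<Rightarrow> nat \<Rightarrow> real" where
  "even_moment \<mu> k = (if even k then LINT x|\<mu>. x ^ k else 0)"

lemma even_moment_nonneg: "0 \<le> even_moment \<mu> k"
  unfolding even_moment_def by (auto intro!: integral_nonneg zero_le_even_power)

lemma cosh_sums:
  fixes x :: "'a::{real_normed_field,banach}"
  shows "(\<lambda>k. x ^ (2 * k) / fact (2 * k)) sums cosh x"
proof -
  have "(\<lambda>n. sum (\<lambda>n. if even n then x ^ n /\<^sub>R fact n else 0) {n * 2..<n * 2 + 2}) sums cosh x"
    by (intro sums_group cosh_converges) simp
  moreover have "{n * 2..<n * 2 + 2} = {2 * n, Suc (2 * n)}" for n :: nat by auto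
  ultimately show ?thesis
    by (simp add: scaleR_conv_of_real divide_inverse mult.commute)
qed

lemma type_LD:
  assumes "type_L \<mu>"
  shows type_L_prob_space: "prob_space \<mu>"
    and type_L_sets: "sets \<mu> = sets borel"
    and type_L_integrable: "\<And>z. integrable \<mu> (\<lambda>x. exp (z * complex_of_real x))"
    and type_L_even: "\<And>z. laplace \<mu> (\<lambda>x. x) (- z) = laplace \<mu> (\<lambda>x. x) z"
    and type_L_zero: "\<And>z. laplace \<mu> (\<lambda>x. x) z = 0 \<Longrightarrow> Re z = 0"
  using assms unfolding type_L_def type_L_rv_def by blast+

lemma integrable_cosh:
  assumes "type_L \<mu>" shows "integrable \<mu> (\<lambda>x. cosh (t * x))"
proof -
  have "integrable \<mu> (\<lambda>x. Re (exp (of_real t * complex_of_real x)))" for t :: real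
    by (intro integrable_Re type_L_integrable[OF assms])
  then have "integrable \<mu> (\<lambda>x. exp (t * x))" for t :: real by (simp add: Re_exp)
  from this[of t] this[of "- t"] show ?thesis by (simp add: cosh_def)
qed

lemma integrable_even_power:
  assumes L: "type_L \<mu>" shows "integrable \<mu> (\<lambda>x. x ^ (2 * k))"
proof (rule Bochner_Integration.integrable_bound)
  show "integrable \<mu> (\<lambda>x. fact (2 * k) * cosh (1 * x))"
    by (intro integrable_mult_right integrable_cosh L)
  show "(\<lambda>x. x ^ (2 * k)) \<in> borel_measurable \<mu>"
    unfolding measurable_cong_sets[OF type_L_sets[OF L] refl] by simp
  have "x ^ (2 * k) / fact (2 * k) \<le> cosh x" for x :: real
    using sum_le_suminf[of "\<lambda>k. x ^ (2 * k) / fact (2 * k)" "{k}"] cosh_sums[of x] by (auto simp: sums_iff)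
  then show "AE x in \<mu>. norm (x ^ (2 * k)) \<le> norm (fact (2 * k) * cosh (1 * x))"
    by (intro AE_I2) (simp add: field_simps abs_of_nonneg power_abs power_even_abs)
qed

text \<open>
  The evenness of the Laplace transform replaces the exponential by a hyperbolic cosine, whose
  series has integrable terms of even degree only; the partial sums of absolute values are
  dominated by \<open>cosh (\<bar>z\<bar> x)\<close>.
\<close>

lemma laplace_sums:
  assumes L: "type_L \<mu>"
  shows "(\<lambda>k. of_real (even_moment \<mu> (2 * k) / fact (2 * k)) * z ^ (2 * k)) sums laplace \<mu> (\<lambda>x. x) z"
proof -
  let ?g = "\<lambda>k x. (z * complex_of_real x) ^ (2 * k) / fact (2 * k)"
  have g_eq: "?g k x = of_real (x ^ (2 * k)) * (z ^ (2 * k) / fact (2 * k))" for k x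
    by (simp add: power_mult_distrib)
  have norm_g: "norm (?g k x) = (norm z * x) ^ (2 * k) / fact (2 * k)" for k x
    by (simp add: norm_mult norm_divide norm_power power_mult_distrib power_even_abs)
  have int: "integrable \<mu> (?g k)" for k
    unfolding g_eq using integrable_even_power[OF L] by (intro integrable_mult_left integrable_of_real) simp
  have cosh_eq: "(\<Sum>k. ?g k x) = cosh (z * of_real x)" for x
    using cosh_sums[of "z * of_real x"] by (simp add: sums_iff)
  have "(\<lambda>k. LINT x|\<mu>. ?g k x) sums (LINT x|\<mu>. (\<Sum>k. ?g k x))"
  proof (rule sums_integral[OF int])
    show "AE x in \<mu>. summable (\<lambda>k. norm (?g k x))"
      unfolding norm_g using cosh_sums by (auto simp: sums_iff)
    show "summable (\<lambda>k. LINT x|\<mu>. norm (?g k x))"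
    proof (rule summableI_nonneg_bounded)
      fix m
      have "(\<Sum>k<m. LINT x|\<mu>. norm (?g k x)) = (LINT x|\<mu>. (\<Sum>k<m. norm (?g k x)))"
        using int by (intro Bochner_Integration.integral_sum[symmetric] integrable_norm) simp
      also have "\<dots> \<le> (LINT x|\<mu>. cosh (norm z * x))"
      proof (rule integral_mono)
        show "integrable \<mu> (\<lambda>x. \<Sum>k<m. norm (?g k x))" using int by (intro Bochner_Integration.integrable_sum integrable_norm) simp
        show "(\<Sum>k<m. norm (?g k x)) \<le> cosh (norm z * x)" for x
          unfolding norm_g using sum_le_suminf[of "\<lambda>k. (norm z * x) ^ (2 * k) / fact (2 * k)" "{..<m}"] cosh_sums[of "norm z * x"]
          by (auto simp: sums_iff)
      qed (rule integrable_cosh[OF L])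
      finally show "(\<Sum>k<m. LINT x|\<mu>. norm (?g k x)) \<le> (LINT x|\<mu>. cosh (norm z * x))" .
    qed simp
  qed
  moreover have "(LINT x|\<mu>. ?g k x) = of_real (even_moment \<mu> (2 * k) / fact (2 * k)) * z ^ (2 * k)" for k
    unfolding g_eq integral_mult_left_zero integral_complex_of_real by (simp add: even_moment_def)
  moreover have "(LINT x|\<mu>. (\<Sum>k. ?g k x)) = laplace \<mu> (\<lambda>x. x) z"
  proof -
    have cosh_exp: "cosh (z * of_real x) = (exp (z * of_real x) + exp (- z * of_real x)) / 2" for x
      by (simp add: cosh_def scaleR_conv_of_real)
    have "(LINT x|\<mu>. (\<Sum>k. ?g k x)) = (laplace \<mu> (\<lambda>x. x) z + laplace \<mu> (\<lambda>x. x) (- z)) / 2"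
      unfolding cosh_eq cosh_exp laplace_def using type_L_integrable[OF L, of z] type_L_integrable[OF L, of "- z"] by simp
    also have "laplace \<mu> (\<lambda>x. x) (- z) = laplace \<mu> (\<lambda>x. x) z"
      by (rule type_L_even[OF L])
    finally show ?thesis by simp
  qed
  ultimately show ?thesis by simp
qed

lemma lin_prod_filter_nonzero: "lin_prod (filter (\<lambda>c. c \<noteq> 0) cs) = lin_prod cs"
  by (induction cs) (simp_all add: lin_prod_Cons)

text \<open>
  The function \<open>F s = E exp (sqrt s X)\<close> is well defined and entire by evenness. The growth and the
  zeros that type \<open>\<L>\<close> prescribes in terms of \<open>z\<close> become exponential type and negative zeros in \<open>s = z\<^sup>2\<close>.
\<close>

lemma type_L_approximation:
  assumes L: "type_L \<mu>"
  obtains q :: "nat \<Rightarrow> real list" where "\<And>N c. c \<in> set (q N) \<Longrightarrow> 0 < c"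
    and "\<And>N k. formal_moment (q N) k \<le> even_moment \<mu> k"
    and "\<And>k. (\<lambda>N. formal_moment (q N) k) \<longlonglongrightarrow> even_moment \<mu> k"
proof -
  define f where "f k = even_moment \<mu> (2 * k) / fact (2 * k)" for k
  define F where "F s = laplace \<mu> (\<lambda>x. x) (csqrt s)" for s
  interpret prob_space \<mu> by (rule type_L_prob_space[OF L])
  have f0: "f 0 = 1" by (simp add: f_def even_moment_def prob_space)
  have sums: "(\<lambda>k. of_real (f k) * s ^ k) sums F s" for s
    using laplace_sums[OF L, of "csqrt s"] by (simp add: f_def F_def power_mult)
  obtain C C' where C: "0 < C" "0 < C'" "\<And>z. norm (laplace \<mu> (\<lambda>x. x) z) \<le> C * exp (C' * (norm z)\<^sup>2)"
    using L unfolding type_L_def type_L_rv_def by blast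
  obtain q where q: "\<And>N c. c \<in> set (q N) \<Longrightarrow> 0 \<le> c" "\<And>N k. coeff (lin_prod (q N)) k \<le> f k"
    "\<And>k. (\<lambda>N. coeff (lin_prod (q N)) k) \<longlonglongrightarrow> f k"
  proof (rule lin_prod_approximation[OF f0 _ sums])
    show "0 \<le> f k" for k by (simp add: f_def even_moment_nonneg)
    show "norm (F s) \<le> C * exp (C' * norm s)" for s
    proof -
      have "(norm (csqrt s))\<^sup>2 = norm s" using norm_power[of "csqrt s" 2] by simp
      then show ?thesis using C(3)[of "csqrt s"] by (simp add: F_def)
    qed
    show "negative_zeros F"
      unfolding negative_zeros_def
    proof (intro allI impI)
      fix s assume "F s = 0"
      then have "Re (csqrt s) = 0" unfolding F_def by (rule type_L_zero[OF L])
      then have s: "s = - of_real ((Im (csqrt s))\<^sup>2)"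
      proof -
        have "w\<^sup>2 = - of_real ((Im w)\<^sup>2)" if "Re w = 0" for w
          using that by (simp add: complex_eq_iff power2_eq_square)
        from this[OF \<open>Re (csqrt s) = 0\<close>] show ?thesis by (simp only: power2_csqrt)
      qed
      have "s \<noteq> 0" using \<open>F s = 0\<close> sums[of 0] f0 by (auto simp: sums_iff)
      then have "Im (csqrt s) \<noteq> 0" using s by auto
      then have "0 < 1 / (Im (csqrt s))\<^sup>2" by simp
      moreover have "s = - of_real (1 / (1 / (Im (csqrt s))\<^sup>2))" using s by simp
      ultimately show "\<exists>c>0. s = - of_real (1 / c)" by blast
    qed
  qed (use C in auto)
  define q' where "q' N = filter (\<lambda>c. c \<noteq> 0) (q N)" for N
  have mom: "formal_moment (q' N) k = (if even k then fact k * coeff (lin_prod (q N)) (k div 2) else 0)" for N k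
    by (simp add: formal_moment_def q'_def lin_prod_filter_nonzero)
  have f_mom: "even_moment \<mu> k = (if even k then fact k * f (k div 2) else 0)" for k
    by (simp add: f_def even_moment_def)
  show ?thesis
  proof (rule that)
    show "0 < c" if "c \<in> set (q' N)" for N c using that q(1)[of c N] by (auto simp: q'_def less_le)
    show "formal_moment (q' N) k \<le> even_moment \<mu> k" for N k
      unfolding mom f_mom using q(2) by (auto intro!: mult_left_mono)
    show "(\<lambda>N. formal_moment (q' N) k) \<longlonglongrightarrow> even_moment \<mu> k" for k
      unfolding mom f_mom using q(3) by (auto intro!: tendsto_intros)
  qed
qed

text \<open>
  On the imaginary axis the Laplace transform is the characteristic function, which determines the law.
\<close>

lemma type_L_symmetric:
  assumes L: "type_L \<mu>" shows "distr \<mu> \<mu> uminus = \<mu>"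
proof -
  interpret prob_space \<mu> by (rule type_L_prob_space[OF L])
  have sets: "sets \<mu> = sets borel" by (rule type_L_sets[OF L])
  have um: "uminus \<in> \<mu> \<rightarrow>\<^sub>M (\<mu> :: real measure)"
    unfolding measurable_cong_sets[OF sets sets] by simp
  interpret d: prob_space "distr \<mu> \<mu> uminus" by (rule prob_space_distr[OF um])
  show ?thesis
  proof (rule Levy_uniqueness)
    show "real_distribution \<mu>"
      by (intro real_distribution.intro real_distribution_axioms.intro prob_space_axioms sets)
    show "real_distribution (distr \<mu> \<mu> uminus)"
      by (intro real_distribution.intro real_distribution_axioms.intro d.prob_space_axioms)
        (simp only: sets_distr sets)
    show "char (distr \<mu> \<mu> uminus) = char \<mu>"
    proof
      fix t
      have m: "(\<lambda>x. iexp (t * x)) \<in> borel_measurable \<mu>"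
        unfolding measurable_cong_sets[OF sets refl] by measurable
      have "char (distr \<mu> \<mu> uminus) t = (LINT x|\<mu>. iexp (t * - x))"
        unfolding char_def by (rule integral_distr[OF um m])
      also have "\<dots> = laplace \<mu> (\<lambda>x. x) (- (\<i> * of_real t))"
        by (simp add: laplace_def mult_ac)
      also have "\<dots> = char \<mu> t"
        unfolding type_L_even[OF L] by (simp add: laplace_def char_def mult_ac)
      finally show "char (distr \<mu> \<mu> uminus) t = char \<mu> t" .
    qed
  qed
qed

section \<open>Series expansion of Gibbs moments\<close>

definition moment_functional :: "nat \<Rightarrow> (nat \<Rightarrow> real measure) \<Rightarrow> (nat \<Rightarrow> nat) \<Rightarrow> real" where
  "moment_functional n \<mu> \<alpha> = (\<Prod>j=1..n. even_moment (\<mu> j) (\<alpha> j))"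

definition monomial :: "nat \<Rightarrow> (nat \<Rightarrow> real) \<Rightarrow> (nat \<Rightarrow> nat) \<Rightarrow> real" where
  "monomial n x \<alpha> = (\<Prod>j=1..n. x j ^ \<alpha> j)"

text \<open>
  The average of \<open>monomial n y \<alpha>\<close> over all sign changes \<open>y = flip n \<epsilon> x\<close>. Unlike the monomial itself it
  is nonnegative, so that series of such terms may be integrated termwise.
\<close>

definition even_monomial :: "nat \<Rightarrow> (nat \<Rightarrow> real) \<Rightarrow> (nat \<Rightarrow> nat) \<Rightarrow> real" where
  "even_monomial n x \<alpha> = (\<Prod>j=1..n. if even (\<alpha> j) then x j ^ \<alpha> j else 0)"

definition signs :: "nat \<Rightarrow> (nat \<Rightarrow> real) set" where
  "signs n = PiE {1..n} (\<lambda>_. {-1, 1})"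

definition flip :: "nat \<Rightarrow> (nat \<Rightarrow> real) \<Rightarrow> (nat \<Rightarrow> real) \<Rightarrow> nat \<Rightarrow> real" where
  "flip n \<epsilon> x = (\<lambda>j\<in>{1..n}. \<epsilon> j * x j)"

lemma finite_signs [simp]: "finite (signs n)" and card_signs: "card (signs n) = 2 ^ n"
  by (simp_all add: signs_def finite_PiE card_PiE numeral_2_eq_2)

lemma even_monomial_eq_average:
  "even_monomial n x \<alpha> = (\<Sum>\<epsilon>\<in>signs n. monomial n (flip n \<epsilon> x) \<alpha> / 2 ^ n)"
proof -
  have "even_monomial n x \<alpha> = (\<Prod>j=1..n. \<Sum>e\<in>{-1, 1}. (e * x j) ^ \<alpha> j / 2)"
    unfolding even_monomial_def by (intro prod.cong refl) simp
  also have "\<dots> = (\<Sum>\<epsilon>\<in>signs n. \<Prod>j=1..n. (\<epsilon> j * x j) ^ \<alpha> j / 2)"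
    unfolding signs_def by (rule prod_sum_PiE) simp_all
  also have "\<dots> = (\<Sum>\<epsilon>\<in>signs n. monomial n (flip n \<epsilon> x) \<alpha> / 2 ^ n)"
    unfolding monomial_def flip_def by (simp add: prod_dividef)
  finally show ?thesis .
qed

lemma monomial_inc: "j \<in> {1..n} \<Longrightarrow> monomial n y (inc j \<alpha>) = y j * monomial n y \<alpha>"
proof -
  assume j: "j \<in> {1..n}"
  have "(\<Prod>i\<in>{1..n} - {j}. y i ^ inc j \<alpha> i) = (\<Prod>i\<in>{1..n} - {j}. y i ^ \<alpha> i)"
    by (intro prod.cong) (auto simp: inc_def)
  then show ?thesis
    unfolding monomial_def using prod.remove[OF _ j, of "\<lambda>i. y i ^ inc j \<alpha> i"] prod.remove[OF _ j, of "\<lambda>i. y i ^ \<alpha> i"]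
    by (simp add: inc_def)
qed

definition hamiltonian :: "nat \<Rightarrow> (nat \<Rightarrow> real) \<Rightarrow> (nat \<Rightarrow> nat \<Rightarrow> real) \<Rightarrow> (nat \<Rightarrow> real) \<Rightarrow> real" where
  "hamiltonian n h J y = (\<Sum>j=1..n. h j * y j) + (\<Sum>j=1..n. \<Sum>k=1..n. J j k * y j * y k)"

text \<open>
  On the functional of point evaluation at \<open>y\<close>, the energy operator multiplies by the energy at \<open>y\<close>.
\<close>

lemma energy_pow_monomial:
  "(energy_op n (\<lambda>j. [:h j, a j:]) (\<lambda>j k. [:J j k:]) ^^ r) (\<lambda>\<alpha>. [:monomial n y \<alpha>:]) \<alpha>
    = smult (monomial n y \<alpha>) ([:hamiltonian n h J y, \<Sum>j=1..n. a j * y j:] ^ r)"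
proof (induction r arbitrary: \<alpha>)
  case (Suc r)
  let ?P = "[:hamiltonian n h J y, \<Sum>j=1..n. a j * y j:] ^ r"
  let ?m = "[:monomial n y \<alpha>:]"
  have const: "[:y j * c:] = [:y j:] * [:c:]" for j and c :: real by simp
  have "(energy_op n (\<lambda>j. [:h j, a j:]) (\<lambda>j k. [:J j k:]) ^^ Suc r) (\<lambda>\<alpha>. [:monomial n y \<alpha>:]) \<alpha>
      = (\<Sum>j=1..n. [:h j, a j:] * ([:monomial n y (inc j \<alpha>):] * ?P))
        + (\<Sum>j=1..n. \<Sum>k=1..n. [:J j k:] * ([:monomial n y (inc j (inc k \<alpha>)):] * ?P))"
    by (simp add: energy_op_def Suc)
  also have "\<dots> = (\<Sum>j=1..n. [:h j, a j:] * ([:y j:] * ?m * ?P))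
        + (\<Sum>j=1..n. \<Sum>k=1..n. [:J j k:] * ([:y j:] * ([:y k:] * ?m) * ?P))"
    by (intro arg_cong2[of _ _ _ _ "(+)"] sum.cong refl) (simp_all only: monomial_inc const)
  also have "\<dots> = ?m * (((\<Sum>j=1..n. [:h j, a j:] * [:y j:]) + (\<Sum>j=1..n. \<Sum>k=1..n. [:J j k:] * [:y j:] * [:y k:])) * ?P)"
    by (simp only: distrib_left distrib_right sum_distrib_left sum_distrib_right mult_ac)
  also have "(\<Sum>j=1..n. [:h j, a j:] * [:y j:]) + (\<Sum>j=1..n. \<Sum>k=1..n. [:J j k:] * [:y j:] * [:y k:])
      = [:hamiltonian n h J y, \<Sum>j=1..n. a j * y j:]"
    by (rule poly_eqI) (simp add: coeff_sum coeff_pCons hamiltonian_def mult_ac split: nat.split)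
  finally show ?case by simp
qed simp

text \<open>
  The \<open>i\<close>-th coefficient of \<open>(w + s z)^r / r!\<close> is \<open>(s^i / i!) (w^(r - i) / (r - i)!)\<close>.
\<close>

lemma gibbs_poly_monomial_sums:
  "(\<lambda>r. coeff (gibbs_poly r n a h J (monomial n y)) i) sums
     ((\<Sum>j=1..n. a j * y j) ^ i / fact i * exp (hamiltonian n h J y))"
proof -
  define w s where "w = hamiltonian n h J y" and "s = (\<Sum>j=1..n. a j * y j)"
  have gp: "gibbs_poly r n a h J (monomial n y) = smult (1 / fact r) ([:w, s:] ^ r)" for r
    unfolding gibbs_poly_def energy_pow_monomial by (simp add: w_def s_def monomial_def)
  have low: "coeff (gibbs_poly r n a h J (monomial n y)) i = 0" if "r < i" for r
  proof -
    have "degree ([:w, s:] ^ r) \<le> degree [:w, s:] * r" by (rule degree_power_le)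
    also have "\<dots> \<le> 1 * r" by (intro mult_right_mono) auto
    finally show ?thesis using that by (simp add: gp coeff_eq_0)
  qed
  have high: "coeff (gibbs_poly (r + i) n a h J (monomial n y)) i = s ^ i / fact i * (w ^ r / fact r)" for r
    by (simp add: gp coeff_linear_poly_power binomial_fact field_simps)
  have "(\<lambda>r. s ^ i / fact i * (w ^ r / fact r)) sums (s ^ i / fact i * exp w)"
    using exp_converges[of w] by (intro sums_mult) (simp add: divide_inverse mult.commute)
  then show ?thesis
    unfolding w_def[symmetric] s_def[symmetric] high[symmetric]
    by (subst (asm) sums_iff_shift) (simp add: low)
qed

lemma gibbs_poly_sum:
  "coeff (gibbs_poly r n a h J (\<lambda>\<alpha>. \<Sum>\<epsilon>\<in>A. m \<epsilon> \<alpha> / c)) i = (\<Sum>\<epsilon>\<in>A. coeff (gibbs_poly r n a h J (m \<epsilon>)) i / c)"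
proof -
  have "[:\<Sum>\<epsilon>\<in>A. m \<epsilon> \<alpha> / c:] = (\<Sum>\<epsilon>\<in>A. [:1 / c:] * [:m \<epsilon> \<alpha>:])" for \<alpha>
    by (rule poly_eqI) (simp add: coeff_sum coeff_pCons split: nat.split)
  then show ?thesis
    unfolding gibbs_poly_def by (simp only: energy_pow_sum) (simp add: coeff_sum sum_distrib_left)
qed

lemma gibbs_poly_even_monomial_sums:
  "(\<lambda>r. coeff (gibbs_poly r n a h J (even_monomial n x)) i) sums
     (\<Sum>\<epsilon>\<in>signs n. (\<Sum>j=1..n. a j * flip n \<epsilon> x j) ^ i / fact i * exp (hamiltonian n h J (flip n \<epsilon> x)) / 2 ^ n)"
  unfolding even_monomial_eq_average[abs_def] gibbs_poly_sum
  by (intro sums_sum sums_divide gibbs_poly_monomial_sums)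


lemma flip_measurable [measurable]:
  assumes "\<And>j. j \<in> {1..n} \<Longrightarrow> sets (\<mu> j) = sets borel"
  shows "flip n \<epsilon> \<in> PiM {1..n} \<mu> \<rightarrow>\<^sub>M PiM {1..n} \<mu>"
  unfolding flip_def
proof (rule measurable_restrict)
  fix j assume j: "j \<in> {1..n}"
  have "(\<lambda>x. x j) \<in> PiM {1..n} \<mu> \<rightarrow>\<^sub>M \<mu> j" using j by (rule measurable_component_singleton)
  then have "(\<lambda>x. \<epsilon> j * x j) \<in> borel_measurable (PiM {1..n} \<mu>)"
    unfolding measurable_cong_sets[OF refl assms[OF j]] by measurable
  then show "(\<lambda>x. \<epsilon> j * x j) \<in> PiM {1..n} \<mu> \<rightarrow>\<^sub>M \<mu> j"
    unfolding measurable_cong_sets[OF refl assms[OF j]] .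
qed

lemma distr_flip:
  assumes prob: "\<And>j. prob_space (\<mu> j)" and L: "\<And>j. j \<in> {1..n} \<Longrightarrow> type_L (\<mu> j)" and \<epsilon>: "\<epsilon> \<in> signs n"
  shows "distr (PiM {1..n} \<mu>) (PiM {1..n} \<mu>) (flip n \<epsilon>) = PiM {1..n} \<mu>"
proof -
  interpret prob_space "\<mu> j" for j by (rule prob)
  interpret product_sigma_finite \<mu> by unfold_locales
  have sets: "sets (\<mu> j) = sets borel" if "j \<in> {1..n}" for j by (rule type_L_sets[OF L[OF that]])
  have space: "space (\<mu> j) = UNIV" if "j \<in> {1..n}" for j
    using sets_eq_imp_space_eq[OF sets[OF that]] by simp
  note flip_meas = flip_measurable[of n \<mu> \<epsilon>, OF sets]
  show ?thesis
  proof (rule PiM_eqI)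
    fix A assume A: "\<And>j. j \<in> {1..n} \<Longrightarrow> A j \<in> sets (\<mu> j)"
    let ?B = "\<lambda>j. (\<lambda>t. \<epsilon> j * t) -` A j"
    have meas: "(\<lambda>t. \<epsilon> j * t) \<in> \<mu> j \<rightarrow>\<^sub>M \<mu> j" if j: "j \<in> {1..n}" for j
      unfolding measurable_cong_sets[OF sets[OF j] sets[OF j]] by measurable
    have B: "?B j \<in> sets (\<mu> j)" "emeasure (\<mu> j) (?B j) = emeasure (\<mu> j) (A j)" if j: "j \<in> {1..n}" for j
    proof -
      show "?B j \<in> sets (\<mu> j)"
        using measurable_sets[OF meas[OF j] A[OF j]] space[OF j] by simp
      have "\<epsilon> j = 1 \<or> \<epsilon> j = -1" using \<epsilon> j by (auto simp: signs_def PiE_def Pi_def)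
      then have "distr (\<mu> j) (\<mu> j) (\<lambda>t. \<epsilon> j * t) = \<mu> j"
        using type_L_symmetric[OF L[OF j]] by (auto simp: distr_id)
      then have "emeasure (\<mu> j) (A j) = emeasure (distr (\<mu> j) (\<mu> j) (\<lambda>t. \<epsilon> j * t)) (A j)" by simp
      also have "\<dots> = emeasure (\<mu> j) (?B j)"
        using meas[OF j] A[OF j] space[OF j] by (subst emeasure_distr) simp_all
      finally show "emeasure (\<mu> j) (?B j) = emeasure (\<mu> j) (A j)" by simp
    qed
    have "emeasure (distr (PiM {1..n} \<mu>) (PiM {1..n} \<mu>) (flip n \<epsilon>)) (PiE {1..n} A)
        = emeasure (PiM {1..n} \<mu>) (flip n \<epsilon> -` PiE {1..n} A \<inter> space (PiM {1..n} \<mu>))"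
      using A by (intro emeasure_distr flip_meas sets_PiM_I_finite) auto
    also have "flip n \<epsilon> -` PiE {1..n} A \<inter> space (PiM {1..n} \<mu>) = PiE {1..n} ?B"
      using space by (auto simp: space_PiM flip_def PiE_def Pi_def extensional_def)
    also have "emeasure (PiM {1..n} \<mu>) (PiE {1..n} ?B) = (\<Prod>j\<in>{1..n}. emeasure (\<mu> j) (?B j))"
      using B by (intro emeasure_PiM) auto
    also have "\<dots> = (\<Prod>j\<in>{1..n}. emeasure (\<mu> j) (A j))" using B by (intro prod.cong) auto
    finally show "emeasure (distr (PiM {1..n} \<mu>) (PiM {1..n} \<mu>) (flip n \<epsilon>)) (PiE {1..n} A)
        = (\<Prod>j\<in>{1..n}. emeasure (\<mu> j) (A j))" .
  qed simp_all
qed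

lemma has_integral_even_monomial:
  assumes prob: "\<And>j. prob_space (\<mu> j)" and L: "\<And>j. j \<in> {1..n} \<Longrightarrow> type_L (\<mu> j)"
  shows "has_bochner_integral (PiM {1..n} \<mu>) (\<lambda>x. even_monomial n x \<alpha>) (moment_functional n \<mu> \<alpha>)"
proof -
  interpret prob_space "\<mu> j" for j by (rule prob)
  interpret product_sigma_finite \<mu> by unfold_locales
  let ?f = "\<lambda>j x. if even (\<alpha> j) then x ^ \<alpha> j else 0 :: real"
  have int: "integrable (\<mu> j) (?f j)" if "j \<in> {1..n}" for j
    using integrable_even_power[OF L[OF that], of "\<alpha> j div 2"] by (cases "even (\<alpha> j)") simp_all
  have "(\<integral>x. (\<Prod>j\<in>{1..n}. ?f j (x j)) \<partial>PiM {1..n} \<mu>) = (\<Prod>j\<in>{1..n}. \<integral>x. ?f j x \<partial>\<mu> j)"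
    by (rule product_integral_prod[OF _ int]) simp_all
  moreover have "integrable (PiM {1..n} \<mu>) (\<lambda>x. \<Prod>j\<in>{1..n}. ?f j (x j))"
    by (rule product_integrable_prod[OF _ int]) simp_all
  moreover have "(\<integral>x. ?f j x \<partial>\<mu> j) = even_moment (\<mu> j) (\<alpha> j)" for j
    by (simp add: even_moment_def)
  ultimately show ?thesis
    by (simp add: has_bochner_integral_iff even_monomial_def moment_functional_def)
qed

lemma has_integral_gibbs_poly:
  assumes prob: "\<And>j. prob_space (\<mu> j)" and L: "\<And>j. j \<in> {1..n} \<Longrightarrow> type_L (\<mu> j)"
  shows "has_bochner_integral (PiM {1..n} \<mu>) (\<lambda>x. coeff (gibbs_poly r n a h J (even_monomial n x)) i)
    (coeff (gibbs_poly r n a h J (moment_functional n \<mu>)) i)"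
proof -
  have "has_bochner_integral (PiM {1..n} \<mu>)
      (\<lambda>x. coeff ((energy_op n (\<lambda>j. [:h j, a j:]) (\<lambda>j k. [:J j k:]) ^^ r) (\<lambda>\<alpha>. [:even_monomial n x \<alpha>:]) \<alpha>) i)
      (coeff ((energy_op n (\<lambda>j. [:h j, a j:]) (\<lambda>j k. [:J j k:]) ^^ r) (\<lambda>\<alpha>. [:moment_functional n \<mu> \<alpha>:]) \<alpha>) i)" for \<alpha>
  proof (induction r arbitrary: \<alpha> i)
    case 0
    have "has_bochner_integral (PiM {1..n} \<mu>) (\<lambda>x. even_monomial n x \<alpha>) (moment_functional n \<mu> \<alpha>)"
      by (rule has_integral_even_monomial[OF prob L])
    then show ?case by (cases i) (simp_all add: has_bochner_integral_zero)
  next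
    case (Suc r)
    show ?case
      unfolding funpow.simps o_apply coeff_energy_op
    proof (intro has_bochner_integral_add has_bochner_integral_sum has_bochner_integral_mult_right Suc)
      fix j
      show "has_bochner_integral (PiM {1..n} \<mu>)
        (\<lambda>x. if i = 0 then 0 else a j * coeff ((energy_op n (\<lambda>j. [:h j, a j:]) (\<lambda>j k. [:J j k:]) ^^ r) (\<lambda>\<alpha>. [:even_monomial n x \<alpha>:]) (inc j \<alpha>)) (i - 1))
        (if i = 0 then 0 else a j * coeff ((energy_op n (\<lambda>j. [:h j, a j:]) (\<lambda>j k. [:J j k:]) ^^ r) (\<lambda>\<alpha>. [:moment_functional n \<mu> \<alpha>:]) (inc j \<alpha>)) (i - 1))"
        using Suc by (cases "i = 0") (auto intro: has_bochner_integral_mult_right)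
    qed
  qed
  then show ?thesis
    unfolding gibbs_poly_def coeff_smult by (intro has_bochner_integral_mult_right)
qed

text \<open>
  The product measure is invariant under sign changes of the coordinates, so the integrand may be
  replaced by its average over all signs. The average is a series of nonnegative functions, and it is
  integrated term by term. Both sides may be infinite.
\<close>

lemma nn_integral_gibbs_moment:
  assumes prob: "\<And>j. prob_space (\<mu> j)" and L: "\<And>j. j \<in> {1..n} \<Longrightarrow> type_L (\<mu> j)"
    and a: "\<And>j. j \<in> {1..n} \<Longrightarrow> 0 \<le> a j" and h: "\<And>j. j \<in> {1..n} \<Longrightarrow> 0 \<le> h j"
    and J: "\<And>j k. j \<in> {1..n} \<Longrightarrow> k \<in> {1..n} \<Longrightarrow> 0 \<le> J j k"
    and i: "even i"
  shows "(\<integral>\<^sup>+x. ennreal ((\<Sum>j=1..n. a j * x j) ^ i / fact i * gibbs_weight n h J x) \<partial>PiM {1..n} \<mu>)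
    = (\<Sum>r. ennreal (coeff (gibbs_poly r n a h J (moment_functional n \<mu>)) i))"
proof -
  define P where "P = PiM {1..n} \<mu>"
  define G where "G x = (\<Sum>j=1..n. a j * x j) ^ i / fact i * gibbs_weight n h J x" for x
  have sets: "sets (\<mu> j) = sets borel" if "j \<in> {1..n}" for j by (rule type_L_sets[OF L[OF that]])
  have comp: "(\<lambda>x. x j) \<in> borel_measurable P" if j: "j \<in> {1..n}" for j
    using measurable_component_singleton[OF j, of \<mu>] unfolding P_def measurable_cong_sets[OF refl sets[OF j]] .
  have G_meas [measurable]: "G \<in> borel_measurable P"
    unfolding G_def gibbs_weight_def using comp by measurable
  have G_nonneg: "0 \<le> G x" for x
    unfolding G_def gibbs_weight_def using i by (simp add: zero_le_even_power)
  have c_nonneg: "0 \<le> coeff (gibbs_poly r n a h J (even_monomial n x)) i" for r x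
    using a h J by (intro coeff_gibbs_poly_nonneg) (auto simp: even_monomial_def intro!: prod_nonneg zero_le_even_power)
  have c_sums: "(\<lambda>r. coeff (gibbs_poly r n a h J (even_monomial n x)) i) sums (\<Sum>\<epsilon>\<in>signs n. G (flip n \<epsilon> x) / 2 ^ n)" for x
    using gibbs_poly_even_monomial_sums[of n a h J x i]
    by (simp add: G_def gibbs_weight_def hamiltonian_def)
  have flip_meas: "flip n \<epsilon> \<in> P \<rightarrow>\<^sub>M P" for \<epsilon>
    unfolding P_def by (rule flip_measurable[OF sets])
  have c_int: "integrable P (\<lambda>x. coeff (gibbs_poly r n a h J (even_monomial n x)) i)"
    and c_eq: "(\<integral>x. coeff (gibbs_poly r n a h J (even_monomial n x)) i \<partial>P) = coeff (gibbs_poly r n a h J (moment_functional n \<mu>)) i" for r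
    using has_integral_gibbs_poly[of \<mu> n r a h J i, OF prob L] by (simp_all add: P_def has_bochner_integral_iff)
  have "(\<Sum>r. ennreal (coeff (gibbs_poly r n a h J (moment_functional n \<mu>)) i))
      = (\<Sum>r. \<integral>\<^sup>+x. ennreal (coeff (gibbs_poly r n a h J (even_monomial n x)) i) \<partial>P)"
    using c_nonneg by (simp add: nn_integral_eq_integral[OF c_int] c_eq)
  also have "\<dots> = (\<integral>\<^sup>+x. (\<Sum>r. ennreal (coeff (gibbs_poly r n a h J (even_monomial n x)) i)) \<partial>P)"
    by (intro nn_integral_suminf[symmetric] measurable_compose[OF _ measurable_ennreal]
        borel_measurable_integrable c_int)
  also have "\<dots> = (\<integral>\<^sup>+x. (\<Sum>\<epsilon>\<in>signs n. ennreal (1 / 2 ^ n) * ennreal (G (flip n \<epsilon> x))) \<partial>P)"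
  proof (rule nn_integral_cong)
    fix x
    have "(\<Sum>r. ennreal (coeff (gibbs_poly r n a h J (even_monomial n x)) i)) = ennreal (\<Sum>\<epsilon>\<in>signs n. G (flip n \<epsilon> x) / 2 ^ n)"
      by (rule suminf_ennreal_eq[OF c_nonneg c_sums])
    also have "\<dots> = (\<Sum>\<epsilon>\<in>signs n. ennreal (G (flip n \<epsilon> x) / 2 ^ n))"
      using G_nonneg by (intro sum_ennreal[symmetric]) simp
    also have "\<dots> = (\<Sum>\<epsilon>\<in>signs n. ennreal (1 / 2 ^ n) * ennreal (G (flip n \<epsilon> x)))"
      using G_nonneg by (simp flip: ennreal_mult')
    finally show "(\<Sum>r. ennreal (coeff (gibbs_poly r n a h J (even_monomial n x)) i))
      = (\<Sum>\<epsilon>\<in>signs n. ennreal (1 / 2 ^ n) * ennreal (G (flip n \<epsilon> x)))" .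
  qed
  also have "\<dots> = (\<Sum>\<epsilon>\<in>signs n. ennreal (1 / 2 ^ n) * (\<integral>\<^sup>+x. ennreal (G (flip n \<epsilon> x)) \<partial>P))"
  proof -
    have "(\<lambda>x. ennreal (G (flip n \<epsilon> x))) \<in> borel_measurable P" for \<epsilon>
      using flip_meas[of \<epsilon>] by measurable
    then show ?thesis by (simp add: nn_integral_sum nn_integral_cmult)
  qed
  also have "\<dots> = (\<Sum>\<epsilon>\<in>signs n. ennreal (1 / 2 ^ n) * (\<integral>\<^sup>+x. ennreal (G x) \<partial>P))"
  proof (intro sum.cong refl arg_cong2[of _ _ _ _ "(*)"])
    fix \<epsilon> assume "\<epsilon> \<in> signs n"
    then have "P = distr P P (flip n \<epsilon>)" unfolding P_def using distr_flip[OF prob L] by simp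
    then have "(\<integral>\<^sup>+x. ennreal (G x) \<partial>P) = (\<integral>\<^sup>+x. ennreal (G x) \<partial>distr P P (flip n \<epsilon>))" by simp
    also have "\<dots> = (\<integral>\<^sup>+x. ennreal (G (flip n \<epsilon> x)) \<partial>P)"
      by (intro nn_integral_distr flip_meas) simp
    finally show "(\<integral>\<^sup>+x. ennreal (G (flip n \<epsilon> x)) \<partial>P) = (\<integral>\<^sup>+x. ennreal (G x) \<partial>P)" by simp
  qed
  also have "\<dots> = of_nat (2 ^ n) * ennreal (1 / 2 ^ n) * (\<integral>\<^sup>+x. ennreal (G x) \<partial>P)"
    by (simp only: sum_constant card_signs mult.assoc)
  also have "of_nat (2 ^ n) * ennreal (1 / 2 ^ n) = ennreal (real (2 ^ n) * (1 / 2 ^ n))"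
    by (simp only: ennreal_of_nat_eq_real_of_nat) (rule ennreal_mult[symmetric]; simp)
  finally show ?thesis by (simp add: G_def P_def)
qed

section \<open>Passage to the limit\<close>

text \<open>
  The inequality is known for the polynomial approximations of all laws. Its right-hand side is bounded by
  the true moments as the approximations lie below them; on the left-hand side, a partial sum over
  \<open>r < R\<close> survives the limit in the approximation, and then \<open>R\<close> tends to infinity. Since \<open>c 0\<close> has a
  first term \<open>1\<close>, the resulting bound on the partial sums also gives convergence of the left-hand side.
\<close>

lemma gibbs_moment_series:
  fixes n :: nat and \<mu> :: "nat \<Rightarrow> real measure"
  assumes L: "\<And>j. j \<in> {1..n} \<Longrightarrow> type_L (\<mu> j)"
    and a: "\<And>j. j \<in> {1..n} \<Longrightarrow> 0 \<le> a j" and h: "\<And>j. j \<in> {1..n} \<Longrightarrow> 0 \<le> h j"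
    and J: "\<And>j k. j \<in> {1..n} \<Longrightarrow> k \<in> {1..n} \<Longrightarrow> 0 \<le> J j k"
    and kl: "0 < k" "k \<le> l"
  defines "c \<equiv> \<lambda>i r. coeff (gibbs_poly r n a h J (moment_functional n \<mu>)) i"
  assumes summable: "summable (c (2 * k))" "summable (c 0)"
  shows "summable (c (2 * l))"
    and "(fact l * suminf (c (2 * l))) ^ k * suminf (c 0) ^ (l - k) \<le> (fact k * suminf (c (2 * k))) ^ l"
    and "1 \<le> suminf (c 0)"
proof -
  have "\<exists>q. \<forall>j\<in>{1..n}. (\<forall>N. \<forall>c\<in>set (q j N). 0 < c) \<and> (\<forall>N k. formal_moment (q j N) k \<le> even_moment (\<mu> j) k)
      \<and> (\<forall>k. (\<lambda>N. formal_moment (q j N) k) \<longlonglongrightarrow> even_moment (\<mu> j) k)"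
  proof (rule bchoice, rule ballI)
    fix j assume "j \<in> {1..n}"
    from type_L_approximation[OF L[OF this]] show "\<exists>q. (\<forall>N. \<forall>c\<in>set (q N). 0 < c)
      \<and> (\<forall>N k. formal_moment (q N) k \<le> even_moment (\<mu> j) k) \<and> (\<forall>k. (\<lambda>N. formal_moment (q N) k) \<longlonglongrightarrow> even_moment (\<mu> j) k)"
      by metis
  qed
  then obtain q :: "nat \<Rightarrow> nat \<Rightarrow> real list" where
    q: "\<And>j N c. j \<in> {1..n} \<Longrightarrow> c \<in> set (q j N) \<Longrightarrow> 0 < c"
       "\<And>j N k. j \<in> {1..n} \<Longrightarrow> formal_moment (q j N) k \<le> even_moment (\<mu> j) k"
       "\<And>j k. j \<in> {1..n} \<Longrightarrow> (\<lambda>N. formal_moment (q j N) k) \<longlonglongrightarrow> even_moment (\<mu> j) k"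
    by blast
  define m where "m N = formal_functional n (\<lambda>j. q j N)" for N
  have m_nonneg: "0 \<le> m N \<alpha>" for N \<alpha>
    unfolding m_def using q(1) by (intro formal_functional_nonneg) (auto intro: less_imp_le)
  have m_le: "m N \<alpha> \<le> moment_functional n \<mu> \<alpha>" for N \<alpha>
    unfolding m_def formal_functional_def moment_functional_def
  proof (rule prod_mono)
    fix j assume j: "j \<in> {1..n}"
    have "0 \<le> formal_moment (q j N) (\<alpha> j)"
      using less_imp_le[OF q(1)[OF j]] by (auto simp: formal_moment_def intro!: mult_nonneg_nonneg coeff_lin_prod_nonneg)
    then show "0 \<le> formal_moment (q j N) (\<alpha> j) \<and> formal_moment (q j N) (\<alpha> j) \<le> even_moment (\<mu> j) (\<alpha> j)"
      using q(2)[OF j] by blast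
  qed
  have m_lim: "(\<lambda>N. m N \<alpha>) \<longlonglongrightarrow> moment_functional n \<mu> \<alpha>" for \<alpha>
    unfolding m_def formal_functional_def moment_functional_def by (intro tendsto_prod q(3))
  define cN where "cN N i r = coeff (gibbs_poly r n a h J (m N)) i" for N i r
  have cN_nonneg: "0 \<le> cN N i r" for N i r
    unfolding cN_def by (intro coeff_gibbs_poly_nonneg a h J m_nonneg)
  have cN_le: "cN N i r \<le> c i r" for N i r
  proof -
    have "0 \<le> coeff [:m N \<alpha>:] i" "coeff [:m N \<alpha>:] i \<le> coeff [:moment_functional n \<mu> \<alpha>:] i" for \<alpha> i
      using m_nonneg m_le by (simp_all add: coeff_pCons split: nat.split)
    from coeff_energy_pow_mono[OF a h J this] show ?thesis
      by (simp add: cN_def c_def gibbs_poly_def divide_right_mono)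
  qed
  have c_nonneg: "0 \<le> c i r" for i r using cN_nonneg[of 0 i r] cN_le[of 0 i r] by linarith
  have cN_lim: "(\<lambda>N. cN N i r) \<longlonglongrightarrow> c i r" for i r
  proof -
    have "(\<lambda>N. coeff [:m N \<alpha>:] i) \<longlonglongrightarrow> coeff [:moment_functional n \<mu> \<alpha>:] i" for \<alpha> i
      using m_lim by (cases i) simp_all
    then show ?thesis
      unfolding cN_def c_def gibbs_poly_def coeff_smult
      by (intro tendsto_mult tendsto_const coeff_energy_pow_tendsto)
  qed
  have m0: "moment_functional n \<mu> (\<lambda>_. 0) = 1"
    using m_lim[of "\<lambda>_. 0"] by (simp add: m_def formal_functional_zero LIMSEQ_const_iff)

  have partial: "(fact l * (\<Sum>r<R. c (2 * l) r)) ^ k * (\<Sum>r<R. c 0 r) ^ (l - k) \<le> (fact k * suminf (c (2 * k))) ^ l" for R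
  proof (rule LIMSEQ_le_const2)
    show "(\<lambda>N. (fact l * (\<Sum>r<R. cN N (2 * l) r)) ^ k * (\<Sum>r<R. cN N 0 r) ^ (l - k))
        \<longlonglongrightarrow> (fact l * (\<Sum>r<R. c (2 * l) r)) ^ k * (\<Sum>r<R. c 0 r) ^ (l - k)"
      by (intro tendsto_intros cN_lim)
    have "(fact l * (\<Sum>r<R. cN N (2 * l) r)) ^ k * (\<Sum>r<R. cN N 0 r) ^ (l - k) \<le> (fact k * suminf (c (2 * k))) ^ l" for N
    proof -
      \<comment> \<open>Large enough for the exponential series of the nilpotent spins to be complete, and at least \<open>R\<close>.\<close>
      define K where "K = R + Suc (2 * (\<Sum>j=1..n. length (q j N)))"
      define B where "B = (\<Sum>r<K. gibbs_poly r n a h J (m N))"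
      have coeff_B: "coeff B i = (\<Sum>r<K. cN N i r)" for i by (simp add: B_def coeff_sum cN_def)
      have le: "(\<Sum>r<R. cN N i r) \<le> coeff B i" for i
        unfolding coeff_B using cN_nonneg by (intro sum_mono2) (auto simp: K_def)
      have pos: "0 \<le> (\<Sum>r<R. cN N i r)" for i using cN_nonneg by (intro sum_nonneg)
      have "(fact l * (\<Sum>r<R. cN N (2 * l) r)) ^ k * (\<Sum>r<R. cN N 0 r) ^ (l - k)
          \<le> (fact l * coeff B (2 * l)) ^ k * coeff B 0 ^ (l - k)"
        using le pos order_trans[OF pos le] by (intro mult_mono power_mono) (auto intro!: mult_nonneg_nonneg)
      also have "\<dots> \<le> (fact k * coeff B (2 * k)) ^ l"
        unfolding B_def m_def using q(1) a h J kl
        by (intro gibbs_poly_moment_inequality) (auto simp: K_def)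
      also have "\<dots> \<le> (fact k * suminf (c (2 * k))) ^ l"
      proof (intro power_mono mult_left_mono)
        have "coeff B (2 * k) \<le> (\<Sum>r<K. c (2 * k) r)" unfolding coeff_B by (intro sum_mono cN_le)
        also have "\<dots> \<le> suminf (c (2 * k))" using summable c_nonneg by (intro sum_le_suminf) auto
        finally show "coeff B (2 * k) \<le> suminf (c (2 * k))" .
        show "0 \<le> fact k * coeff B (2 * k)" using order_trans[OF pos le] by simp
      qed simp
      finally show ?thesis .
    qed
    then show "\<exists>N0. \<forall>N\<ge>N0. (fact l * (\<Sum>r<R. cN N (2 * l) r)) ^ k * (\<Sum>r<R. cN N 0 r) ^ (l - k)
        \<le> (fact k * suminf (c (2 * k))) ^ l" by blast
  qed
  have c00: "c 0 0 = 1" by (simp add: c_def gibbs_poly_def m0)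
  have c0_ge: "1 \<le> (\<Sum>r<R. c 0 r)" if "0 < R" for R
    using member_le_sum[of 0 "{..<R}" "c 0"] c_nonneg c00 that by simp
  show "1 \<le> suminf (c 0)"
    using sum_le_suminf[OF summable(2), of "{0}"] c_nonneg c00 by simp
  define D where "D = (fact k * suminf (c (2 * k))) ^ l"
  have "0 \<le> D" unfolding D_def using summable c_nonneg by (intro zero_le_power mult_nonneg_nonneg suminf_nonneg) auto
  show "summable (c (2 * l))"
  proof (rule summableI_nonneg_bounded)
    fix R
    define y where "y = (\<Sum>r<Suc R. c (2 * l) r)"
    have "0 \<le> y" unfolding y_def using c_nonneg by (intro sum_nonneg)
    have "y \<le> fact l * y" using \<open>0 \<le> y\<close> fact_ge_1[of l] by (simp add: mult_le_cancel_right1)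
    then have "y ^ k * 1 \<le> (fact l * y) ^ k * (\<Sum>r<Suc R. c 0 r) ^ (l - k)"
      using \<open>0 \<le> y\<close> c0_ge[of "Suc R"] by (intro mult_mono power_mono one_le_power) auto
    also have "\<dots> \<le> D" using partial[of "Suc R"] by (simp only: y_def D_def)
    finally have "y ^ k \<le> D" by simp
    have "y \<le> 1 + D"
    proof (cases "y \<le> 1")
      case False
      then have "y \<le> y ^ k" using kl by (intro self_le_power) auto
      with \<open>y ^ k \<le> D\<close> show ?thesis by simp
    qed (use \<open>0 \<le> D\<close> in simp)
    moreover have "(\<Sum>r<R. c (2 * l) r) \<le> y" unfolding y_def using c_nonneg by simp
    ultimately show "(\<Sum>r<R. c (2 * l) r) \<le> 1 + D" by simp
  qed (rule c_nonneg)
  then show "(fact l * suminf (c (2 * l))) ^ k * suminf (c 0) ^ (l - k) \<le> (fact k * suminf (c (2 * k))) ^ l"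
    using partial summable(2)
    by (intro LIMSEQ_le_const2[of "\<lambda>R. (fact l * (\<Sum>r<R. c (2 * l) r)) ^ k * (\<Sum>r<R. c 0 r) ^ (l - k)"]
        tendsto_intros summable_LIMSEQ) auto
qed

section \<open>Comparison with Gaussian moments\<close>

lemma Lp_norm_eq:
  assumes "(\<integral>\<^sup>+\<omega>. ennreal (\<bar>Y \<omega>\<bar> powr p) \<partial>M) = ennreal v" "0 \<le> v"
  shows "Lp_norm M p Y = ennreal (v powr (1 / p))"
  using assms by (simp add: Lp_norm_def)

lemma powr_even: "0 < k \<Longrightarrow> \<bar>x\<bar> powr real (2 * k) = (x::real) ^ (2 * k)"
  using powr_realpow[of "\<bar>x\<bar>" "2 * k"] by (cases "x = 0") (simp_all add: power_even_abs)

text \<open>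
  The even moments \<open>(2k)! / (2^k k!)\<close> of the Gaussian are what turns coefficients into the sequence \<open>b\<close>.
\<close>

lemma Lp_norm_std_normal:
  assumes G: "distributed N lborel G (\<lambda>x. ennreal (std_normal_density x))" and k: "0 < k"
  shows "Lp_norm N (real (2 * k)) G = ennreal ((fact (2 * k) / (2 ^ k * fact k)) powr (1 / real (2 * k)))"
proof (rule Lp_norm_eq)
  have "(\<integral>\<^sup>+\<omega>. ennreal (\<bar>G \<omega>\<bar> powr real (2 * k)) \<partial>N)
      = (\<integral>\<^sup>+x. ennreal (std_normal_density x) * ennreal (\<bar>x\<bar> powr real (2 * k)) \<partial>lborel)"
    by (rule distributed_nn_integral[OF G, symmetric]) measurable
  also have "\<dots> = (\<integral>\<^sup>+x. ennreal (std_normal_density x * x ^ (2 * k)) \<partial>lborel)"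
    by (intro nn_integral_cong) (simp only: powr_even[OF k], rule ennreal_mult[symmetric]; simp)
  also have "\<dots> = ennreal (fact (2 * k) / (2 ^ k * fact k))"
    using std_normal_moment_even[of k] by (subst nn_integral_eq_integral) (auto simp: has_bochner_integral_iff)
  finally show "(\<integral>\<^sup>+\<omega>. ennreal (\<bar>G \<omega>\<bar> powr real (2 * k)) \<partial>N) = ennreal (fact (2 * k) / (2 ^ k * fact k))" .
qed simp

text \<open>
  Both sides of the hypothesis are raised to the power \<open>1 / (2 k l)\<close>.
\<close>

lemma root_comparison:
  fixes A B s t :: real
  assumes pos: "0 \<le> A" "0 \<le> B" "0 < s" "0 < t" "0 < k" "0 < l" and le: "(A / s) ^ k \<le> (B / t) ^ l"
  shows "A powr (1 / real (2 * l)) \<le> s powr (1 / real (2 * l)) / t powr (1 / real (2 * k)) * B powr (1 / real (2 * k))"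
proof -
  have pp: "(u ^ i) powr e = u powr (real i * e)" if "0 \<le> u" "0 < i" for u e :: real and i
    using that by (cases "u = 0") (simp_all add: powr_powr flip: powr_realpow)
  let ?e = "1 / real (2 * k * l)"
  have "(A / s) powr (1 / real (2 * l)) = ((A / s) ^ k) powr ?e"
    using pos by (subst pp) simp_all
  also have "\<dots> \<le> ((B / t) ^ l) powr ?e"
    using pos le by (intro powr_mono2) simp_all
  also have "\<dots> = (B / t) powr (1 / real (2 * k))"
    using pos by (subst pp) simp_all
  finally show ?thesis
    using pos by (simp add: powr_divide field_simps)
qed

theorem corollary4:
  fixes n :: nat
    and \<mu> :: "nat \<Rightarrow> real measure"
    and h :: "nat \<Rightarrow> real" and J :: "nat \<Rightarrow> nat \<Rightarrow> real"
    and M :: "'a measure" and X :: "nat \<Rightarrow> 'a \<Rightarrow> real"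
    and N :: "'b measure" and G :: "'b \<Rightarrow> real"
    and a :: "nat \<Rightarrow> real" and p q :: nat
  assumes "\<And>j. j \<in> {1..n} \<Longrightarrow> type_L (\<mu> j)"
    and "\<And>j. j \<in> {1..n} \<Longrightarrow> h j \<ge> 0"
    and "\<And>j k. j \<in> {1..n} \<Longrightarrow> k \<in> {1..n} \<Longrightarrow> J j k \<ge> 0"
    and "prob_space M"
    and "distributed M (PiM {1..n} \<mu>) (\<lambda>\<omega>. \<lambda>j\<in>{1..n}. X j \<omega>)
           (\<lambda>x. ennreal (gibbs_weight n h J x) / gibbs_Z n \<mu> h J)"
    and "prob_space N"
    and "distributed N lborel G (\<lambda>x. ennreal (std_normal_density x))"
    and "\<And>j. j \<in> {1..n} \<Longrightarrow> a j \<ge> 0"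
    and "even p" and "even q" and "0 < p" and "p \<le> q"
  shows "Lp_norm M (real q) (\<lambda>\<omega>. \<Sum>j=1..n. a j * X j \<omega>)
           \<le> Lp_norm N (real q) G / Lp_norm N (real p) G
              * Lp_norm M (real p) (\<lambda>\<omega>. \<Sum>j=1..n. a j * X j \<omega>)"
proof -
  note L = assms(1) and h = assms(2) and J = assms(3) and law = assms(5) and G = assms(7) and a = assms(8)
  interpret M: prob_space M by fact
  obtain k l where pq: "p = 2 * k" "q = 2 * l" using \<open>even p\<close> \<open>even q\<close> by (auto elim!: evenE)
  then have kl: "0 < k" "k \<le> l" using \<open>0 < p\<close> \<open>p \<le> q\<close> by auto
  define P where "P = PiM {1..n} \<mu>"
  define Z where "Z = gibbs_Z n \<mu> h J"
  define Y where "Y \<omega> = (\<Sum>j=1..n. a j * X j \<omega>)" for \<omega>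
  define c where "c i r = coeff (gibbs_poly r n a h J (moment_functional n \<mu>)) i" for i r

  have expand: "(\<integral>\<^sup>+x. ennreal ((\<Sum>j=1..n. a j * x j) ^ i / fact i * gibbs_weight n h J x) \<partial>P) = (\<Sum>r. ennreal (c i r))"
    if i: "even i" for i
  proof -
    \<comment> \<open>The laws outside \<open>{1..n}\<close> are arbitrary; a point mass there leaves the product measure unchanged.\<close>
    define \<mu>' where "\<mu>' j = (if j \<in> {1..n} then \<mu> j else return borel 0)" for j
    have prob: "prob_space (\<mu>' j)" for j
      using type_L_prob_space[OF L] by (auto simp: \<mu>'_def intro!: prob_space_return)
    have L': "type_L (\<mu>' j)" if "j \<in> {1..n}" for j using L[OF that] that by (simp add: \<mu>'_def)
    have "PiM {1..n} \<mu>' = P" unfolding P_def by (intro PiM_cong) (auto simp: \<mu>'_def)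
    moreover have "moment_functional n \<mu>' = moment_functional n \<mu>"
      by (auto simp: moment_functional_def fun_eq_iff \<mu>'_def intro!: prod.cong)
    ultimately show ?thesis
      using nn_integral_gibbs_moment[of \<mu>' n a h J i, OF prob L' a h J i] by (simp add: c_def)
  qed
  have Z_eq: "Z = (\<Sum>r. ennreal (c 0 r))"
    using expand[of 0] by (simp add: Z_def gibbs_Z_def P_def)
  have comp: "(\<lambda>x. x j) \<in> borel_measurable P" if j: "j \<in> {1..n}" for j
    using measurable_component_singleton[OF j, of \<mu>] unfolding P_def measurable_cong_sets[OF refl type_L_sets[OF L[OF j]]] .
  have W [measurable]: "gibbs_weight n h J \<in> borel_measurable P"
    unfolding gibbs_weight_def[abs_def] using comp by measurable
  have lin [measurable]: "(\<lambda>x. \<Sum>j=1..n. a j * x j) \<in> borel_measurable P"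
    using comp by measurable
  have Y_eq: "Y \<omega> = (\<Sum>j=1..n. a j * (\<lambda>j\<in>{1..n}. X j \<omega>) j)" for \<omega>
    by (simp add: Y_def)

  \<comment> \<open>An infinite normalising constant would make the density vanish.\<close>
  have Z_finite: "Z \<noteq> \<infinity>"
  proof
    assume "Z = \<infinity>"
    have "(\<integral>\<^sup>+x. ennreal (gibbs_weight n h J x) / Z * 1 \<partial>P) = (\<integral>\<^sup>+\<omega>. 1 \<partial>M)"
      unfolding P_def Z_def by (rule distributed_nn_integral[OF law]) simp
    then show False using \<open>Z = \<infinity>\<close> by (simp add: M.emeasure_space_1)
  qed
  have c_nonneg: "0 \<le> c i r" for i r
    unfolding c_def by (intro coeff_gibbs_poly_nonneg a h J)
      (auto simp: moment_functional_def intro!: prod_nonneg even_moment_nonneg)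
  have sum0: "summable (c 0)"
    using Z_finite c_nonneg unfolding Z_eq by (intro summable_suminf_not_top) auto
  have Y_moment: "(\<integral>\<^sup>+\<omega>. ennreal (\<bar>Y \<omega>\<bar> powr real (2 * i)) \<partial>M) = ennreal (fact (2 * i)) / Z * (\<Sum>r. ennreal (c (2 * i) r))"
    if "0 < i" for i
  proof -
    have "(\<integral>\<^sup>+\<omega>. ennreal (\<bar>Y \<omega>\<bar> powr real (2 * i)) \<partial>M)
        = (\<integral>\<^sup>+x. ennreal (gibbs_weight n h J x) / Z * ennreal (\<bar>\<Sum>j=1..n. a j * x j\<bar> powr real (2 * i)) \<partial>P)"
      unfolding Y_eq P_def Z_def
      by (rule distributed_nn_integral[OF law, symmetric]) (use lin[unfolded P_def] in measurable)
    also have "\<dots> = (\<integral>\<^sup>+x. ennreal (fact (2 * i)) / Z * ennreal ((\<Sum>j=1..n. a j * x j) ^ (2 * i) / fact (2 * i) * gibbs_weight n h J x) \<partial>P)"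
    proof (rule nn_integral_cong)
      fix x
      define w y where "w = gibbs_weight n h J x" and "y = (\<Sum>j=1..n. a j * x j) ^ (2 * i)"
      have "0 \<le> w" "0 \<le> y" by (simp_all add: w_def y_def gibbs_weight_def)
      have "ennreal w / Z * ennreal y = ennreal (w * y) / Z"
        using \<open>0 \<le> w\<close> \<open>0 \<le> y\<close> by (simp add: ennreal_mult divide_ennreal_def mult_ac)
      also have "w * y = fact (2 * i) * (y / fact (2 * i) * w)" by simp
      also have "ennreal \<dots> / Z = ennreal (fact (2 * i)) / Z * ennreal (y / fact (2 * i) * w)"
        using \<open>0 \<le> w\<close> \<open>0 \<le> y\<close> by (subst ennreal_mult) (simp_all add: divide_ennreal_def mult_ac)
      finally show "ennreal (gibbs_weight n h J x) / Z * ennreal (\<bar>\<Sum>j=1..n. a j * x j\<bar> powr real (2 * i))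
          = ennreal (fact (2 * i)) / Z * ennreal ((\<Sum>j=1..n. a j * x j) ^ (2 * i) / fact (2 * i) * gibbs_weight n h J x)"
        unfolding powr_even[OF that] w_def y_def .
    qed
    also have "\<dots> = ennreal (fact (2 * i)) / Z * (\<Sum>r. ennreal (c (2 * i) r))"
    proof -
      have "(\<lambda>x. ennreal ((\<Sum>j=1..n. a j * x j) ^ (2 * i) / fact (2 * i) * gibbs_weight n h J x)) \<in> borel_measurable P"
        by measurable
      moreover have "even (2 * i)" by simp
      ultimately show ?thesis by (simp only: nn_integral_cmult expand)
    qed
    finally show ?thesis .
  qed

  define g :: "nat \<Rightarrow> real" where "g i = fact (2 * i) / (2 ^ i * fact i)" for i
  have g_pos: "0 < g i" for i by (simp add: g_def)
  have ratio: "Lp_norm N (real q) G / Lp_norm N (real p) G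
      = ennreal (g l powr (1 / real (2 * l)) / g k powr (1 / real (2 * k)))"
    unfolding pq using kl Lp_norm_std_normal[OF G] g_pos[of k] by (simp add: divide_ennreal g_def)
  have ratio_pos: "0 < g l powr (1 / real (2 * l)) / g k powr (1 / real (2 * k))"
    using g_pos[of k] g_pos[of l] by simp

  show ?thesis
  proof (cases "(\<Sum>r. ennreal (c (2 * k) r)) = \<infinity>")
    case True
    have "(\<integral>\<^sup>+\<omega>. ennreal (\<bar>Y \<omega>\<bar> powr real (2 * k)) \<partial>M) = \<infinity>"
      unfolding Y_moment[OF kl(1)] True using Z_finite
      by (simp add: ennreal_mult_eq_top_iff ennreal_divide_eq_0_iff)
    then have "Lp_norm M (real p) Y = \<infinity>" by (simp add: Lp_norm_def pq)
    then have "Lp_norm N (real q) G / Lp_norm N (real p) G * Lp_norm M (real p) Y = \<infinity>"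
      unfolding ratio using g_pos[of k] g_pos[of l] by (simp add: ennreal_mult_eq_top_iff)
    then show ?thesis by (simp add: Y_def[abs_def])
  next
    case False
    have sumk: "summable (c (2 * k))"
      using False c_nonneg by (intro summable_suminf_not_top) auto
    have series: "summable (c (2 * l))"
      "(fact l * suminf (c (2 * l))) ^ k * suminf (c 0) ^ (l - k) \<le> (fact k * suminf (c (2 * k))) ^ l"
      "1 \<le> suminf (c 0)"
      using gibbs_moment_series[of n \<mu> a h J k l, OF L a h J kl] sumk sum0
      unfolding c_def[abs_def] by simp_all
    define s where "s i = suminf (c i)" for i
    have s_nonneg: "0 \<le> s i" if "summable (c i)" for i
      unfolding s_def using that c_nonneg by (intro suminf_nonneg) auto
    have s0: "1 \<le> s 0" unfolding s_def by (rule series(3))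
    have norm_Y: "Lp_norm M (real (2 * i)) Y = ennreal ((fact (2 * i) * s (2 * i) / s 0) powr (1 / real (2 * i)))"
      if "0 < i" "summable (c (2 * i))" for i
    proof (rule Lp_norm_eq)
      show "(\<integral>\<^sup>+\<omega>. ennreal (\<bar>Y \<omega>\<bar> powr real (2 * i)) \<partial>M) = ennreal (fact (2 * i) * s (2 * i) / s 0)"
        unfolding Y_moment[OF that(1)] Z_eq suminf_ennreal2[OF c_nonneg that(2)] suminf_ennreal2[OF c_nonneg sum0]
        using s0 s_nonneg[OF that(2)] unfolding s_def
        by (simp add: divide_ennreal ennreal_mult[symmetric])
    qed (use s0 s_nonneg[OF that(2)] in simp)
    have "(fact l * s (2 * l) / s 0) ^ k \<le> (fact k * s (2 * k) / s 0) ^ l"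
    proof -
      have "s 0 ^ l = s 0 ^ k * s 0 ^ (l - k)" using kl by (simp flip: power_add)
      then have "(fact l * s (2 * l) / s 0) ^ k = (fact l * s (2 * l)) ^ k * s 0 ^ (l - k) / s 0 ^ l"
        using s0 by (simp add: power_divide)
      also have "\<dots> \<le> (fact k * s (2 * k)) ^ l / s 0 ^ l"
        using series(2) s0 by (intro divide_right_mono) (simp_all add: s_def)
      finally show ?thesis by (simp add: power_divide)
    qed
    then have "(2 ^ l * (fact l * s (2 * l) / s 0)) ^ k \<le> (2 ^ k * (fact k * s (2 * k) / s 0)) ^ l"
      unfolding power_mult_distrib power_mult[symmetric] by (simp add: mult.commute[of k l] mult_left_mono)
    then have "(fact (2 * l) * s (2 * l) / s 0 / g l) ^ k \<le> (fact (2 * k) * s (2 * k) / s 0 / g k) ^ l"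
      by (simp add: g_def mult_ac)
    then have "(fact (2 * l) * s (2 * l) / s 0) powr (1 / real (2 * l))
        \<le> g l powr (1 / real (2 * l)) / g k powr (1 / real (2 * k)) * (fact (2 * k) * s (2 * k) / s 0) powr (1 / real (2 * k))"
      using s0 s_nonneg[OF sumk] s_nonneg[OF series(1)] g_pos kl by (intro root_comparison) simp_all
    then have "Lp_norm M (real q) Y \<le> Lp_norm N (real q) G / Lp_norm N (real p) G * Lp_norm M (real p) Y"
      unfolding ratio unfolding pq norm_Y[OF kl(1) sumk] using norm_Y[of l] series(1) kl ratio_pos
      by (simp add: ennreal_leI ennreal_mult[symmetric] less_imp_le)
    then show ?thesis by (simp add: Y_def[abs_def])
  qed
qed

end
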